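(* Consider a weight $\rho(z)$ on an interval $E\subseteq\mathbb R$, with rational logarithmic derivative of the form $$-\frac{\rho'(z)}{\rho(z)}=\frac{b_0+b_1z+b_2z^2}{a_0+a_1z+a_2z^2}=:\frac{B(z)}{A(z)},$$ and boundary condition $$A(z)\rho(z)z^k\big|_{\partial E}=0\quad\text{for all }k=0,1,2,\ldots$$ Then the expression $$g(x):=\frac{\partial}{\partial x}\log\int_{E^n}\Delta^2(z)\prod_{k=1}^n e^{xz_k}\rho(z_k)\,dz_k$$ satisfies a third order differential equation, equivalent to Painlevé V, namely $$g'''+6g'^2+\frac{4a_2(g''+2gg')}{a_2x-b_2}+\frac{2a_2^2g^2+P_2g'}{(a_2x-b_2)^2}+\frac{P_1g-nQ_1}{(a_2x-b_2)^3}=0,$$ which can be transformed into the Painlevé V equation. Here $P_1,P_2,Q_1$ are the polynomials in $x$ $$P_2(x)=(4a_0a_2-a_1^2)x^2+2(2a_1a_2n-2a_0b_2+a_1b_1-2a_2b_0)x-4a_2^2n^2-4(2a_1b_2-a_2b_1)n+4b_0b_2-b_1^2+2a_2^2,$$ $$P_1(x)=(2a_1a_2^2n+2a_0a_2b_2-a_1^2b_2+a_1a_2b_1-2a_2^2b_0)x-4a_2^3n^2+(-6a_1a_2b_2+4a_2^2b_1)n-2a_0b_2^2+a_1b_1b_2+2a_2b_0b_2-a_2b_1^2,$$ $$Q_1(x)=(2a_0a_2^2n-a_1^2a_2n+a_0a_1b_2-2a_0a_2b_1+a_1a_2b_0)x+2a_1a_2^2n^2+(2a_1^2b_2-a_1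a_2b_1-2a_2^2b_0)n+a_0b_1b_2-2a_1b_0b_2+a_2b_0b_1.$$
   Context: Here $n\ge 1$ is an integer, the $a_i,b_i$ are real constants, $\Delta(z)=\prod_{1\le i<j\le n}(z_i-z_j)$ is (up to sign) the Vandermonde determinant in $z_1,\dots,z_n$, $\partial E$ denotes the endpoints of $E$, and primes on $g$ denote derivatives in $x$. When $E$ is a finite interval the integral always converges; for an infinite interval one may have to require $x>\alpha$ or $x<\alpha$ for some $\alpha\in\mathbb R$. The canonical form of the Painlevé V equation, for an unknown function $G(z)$ and constants $A_1,\dots,A_4$, is $(zG'')^2=(zG'-G)\bigl(-4G'^2+A_1(zG'-G)+A_2\bigr)+A_3G'+A_4$.
   Formalization: The transformation into Painlevé V is claimed only for a_2≠0 (for a_2=0, b_2≠0 the equation has no pole and is of Painlevé IV type); the converse direction is for solutions with G''≠0, as affine G solve Painlevé V spuriously. The third order equation is stated where a_2x-b_2≠0. *)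

theory Defs
  imports "HOL-Analysis.Analysis"
begin

definition quadratic :: "real \<Rightarrow> real \<Rightarrow> real \<Rightarrow> real \<Rightarrow> real" where
  "quadratic c0 c1 c2 z = c0 + c1 * z + c2 * z\<^sup>2"

text \<open>
  The endpoints of an interval \<open>E\<close> are its finite endpoints (the points of \<open>frontier E\<close>)
  together with \<open>\<plusminus>\<infinity>\<close> whenever \<open>E\<close> is unbounded in that direction. A function vanishes at
  the endpoints if its limit from inside \<open>E\<close> at each of them is \<open>0\<close>.
\<close>
definition vanishes_at_endpoints :: "real set \<Rightarrow> (real \<Rightarrow> real) \<Rightarrow> bool" where
  "vanishes_at_endpoints E f \<longleftrightarrow>
     (\<forall>e\<in>frontier E. (f \<longlongrightarrow> 0) (at e within interior E)) \<and>
     (\<not> bdd_above E \<longrightarrow> (f \<longlongrightarrow> 0) at_top) \<and>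
     (\<not> bdd_below E \<longrightarrow> (f \<longlongrightarrow> 0) at_bot)"

definition Vdm :: "nat \<Rightarrow> (nat \<Rightarrow> real) \<Rightarrow> real" where
  "Vdm n z = (\<Prod>j\<in>{1..n}. \<Prod>i\<in>{1..<j}. z i - z j)"

definition integrand :: "nat \<Rightarrow> (real \<Rightarrow> real) \<Rightarrow> real \<Rightarrow> (nat \<Rightarrow> real) \<Rightarrow> real" where
  "integrand n \<rho> x z = (Vdm n z)\<^sup>2 * (\<Prod>k\<in>{1..n}. exp (x * z k) * \<rho> (z k))"

definition tau :: "nat \<Rightarrow> real set \<Rightarrow> (real \<Rightarrow> real) \<Rightarrow> real \<Rightarrow> real" where
  "tau n E \<rho> x =
     set_lebesgue_integral (PiM {1..n} (\<lambda>_. lborel)) (PiE {1..n} (\<lambda>_. E)) (integrand n \<rho> x)"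

text \<open>
  The largest open set of parameters on which the integral converges. (The set of all
  parameters of convergence is an interval; for bounded \<open>E\<close> it is everything or nothing.)
\<close>
definition convergence_domain :: "nat \<Rightarrow> real set \<Rightarrow> (real \<Rightarrow> real) \<Rightarrow> real set" where
  "convergence_domain n E \<rho> = interior
     {x. set_integrable (PiM {1..n} (\<lambda>_. lborel)) (PiE {1..n} (\<lambda>_. E)) (integrand n \<rho> x)}"

definition log_deriv_tau :: "nat \<Rightarrow> real set \<Rightarrow> (real \<Rightarrow> real) \<Rightarrow> real \<Rightarrow> real" where
  "log_deriv_tau n E \<rho> = deriv (\<lambda>x. ln (tau n E \<rho> x))"

text \<open>Meant for open \<open>S\<close>.\<close>
definition times_differentiable_on :: "nat \<Rightarrow> (real \<Rightarrow> real) \<Rightarrow> real set \<Rightarrow> bool" where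
  "times_differentiable_on m h S \<longleftrightarrow> (\<forall>j<m. \<forall>x\<in>S. (deriv ^^ j) h differentiable (at x))"

definition P2 :: "nat \<Rightarrow> real \<Rightarrow> real \<Rightarrow> real \<Rightarrow> real \<Rightarrow> real \<Rightarrow> real \<Rightarrow> real \<Rightarrow> real" where
  "P2 n a0 a1 a2 b0 b1 b2 x =
     (4*a0*a2 - a1^2) * x^2
     + 2 * (2*a1*a2*real n - 2*a0*b2 + a1*b1 - 2*a2*b0) * x
     - 4*a2^2*(real n)^2 - 4*(2*a1*b2 - a2*b1)*real n + 4*b0*b2 - b1^2 + 2*a2^2"

definition P1 :: "nat \<Rightarrow> real \<Rightarrow> real \<Rightarrow> real \<Rightarrow> real \<Rightarrow> real \<Rightarrow> real \<Rightarrow> real \<Rightarrow> real" where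
  "P1 n a0 a1 a2 b0 b1 b2 x =
     (2*a1*a2^2*real n + 2*a0*a2*b2 - a1^2*b2 + a1*a2*b1 - 2*a2^2*b0) * x
     - 4*a2^3*(real n)^2 + (- 6*a1*a2*b2 + 4*a2^2*b1)*real n
     - 2*a0*b2^2 + a1*b1*b2 + 2*a2*b0*b2 - a2*b1^2"

definition Q1 :: "nat \<Rightarrow> real \<Rightarrow> real \<Rightarrow> real \<Rightarrow> real \<Rightarrow> real \<Rightarrow> real \<Rightarrow> real \<Rightarrow> real" where
  "Q1 n a0 a1 a2 b0 b1 b2 x =
     (2*a0*a2^2*real n - a1^2*a2*real n + a0*a1*b2 - 2*a0*a2*b1 + a1*a2*b0) * x
     + 2*a1*a2^2*(real n)^2 + (2*a1^2*b2 - a1*a2*b1 - 2*a2^2*b0)*real n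
     + a0*b1*b2 - 2*a1*b0*b2 + a2*b0*b1"

definition solves_third_order_ode ::
  "nat \<Rightarrow> real \<Rightarrow> real \<Rightarrow> real \<Rightarrow> real \<Rightarrow> real \<Rightarrow> real \<Rightarrow> real set \<Rightarrow> (real \<Rightarrow> real) \<Rightarrow> bool" where
  "solves_third_order_ode n a0 a1 a2 b0 b1 b2 S g \<longleftrightarrow>
     times_differentiable_on 3 g S \<and>
     (\<forall>x\<in>S.
        (deriv ^^ 3) g x + 6 * (deriv g x)^2
        + 4*a2 * ((deriv ^^ 2) g x + 2 * g x * deriv g x) / (a2*x - b2)
        + (2*a2^2 * (g x)^2 + P2 n a0 a1 a2 b0 b1 b2 x * deriv g x) / (a2*x - b2)^2
        + (P1 n a0 a1 a2 b0 b1 b2 x * g x - real n * Q1 n a0 a1 a2 b0 b1 b2 x) / (a2*x - b2)^3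
        = 0)"

definition solves_painleve_V ::
  "real \<Rightarrow> real \<Rightarrow> real \<Rightarrow> real \<Rightarrow> real set \<Rightarrow> (real \<Rightarrow> real) \<Rightarrow> bool" where
  "solves_painleve_V A1 A2 A3 A4 S G \<longleftrightarrow>
     times_differentiable_on 2 G S \<and>
     (\<forall>z\<in>S.
        (z * (deriv ^^ 2) G z)^2
        = (z * deriv G z - G z) * (- 4 * (deriv G z)^2 + A1 * (z * deriv G z - G z) + A2)
          + A3 * deriv G z + A4)"

text \<open>
  The change of variables from the third order equation to Painleve V: move the pole
  \<open>x = c\<close> of the coefficients to \<open>z = 0\<close> by \<open>z = x - c\<close>, multiply by \<open>z\<close>, and add an
  affine function of \<open>z\<close>.
\<close>
definition painleve_transform ::
  "real \<Rightarrow> real \<Rightarrow> real \<Rightarrow> (real \<Rightarrow> real) \<Rightarrow> real \<Rightarrow> real" where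
  "painleve_transform c \<alpha> \<beta> h z = z * h (z + c) + \<alpha> * z + \<beta>"

text \<open>
  The third order equation can be transformed into Painleve V: the constants
  \<open>\<alpha>, \<beta>, A1, A2, A3\<close> depend on the coefficients of the equation only, while \<open>A4\<close> is the
  constant of integration gained in lowering the order from three to two, so it depends on
  the solution. Affine \<open>G\<close> have to be kept out of the converse because the derivative of the
  Painleve V equation is \<open>G''\<close> times the third order equation.
  The pole \<open>b2 / a2\<close> makes sense only for \<open>a2 \<noteq> 0\<close>.
\<close>
definition transforms_into_painleve_V ::
  "nat \<Rightarrow> real \<Rightarrow> real \<Rightarrow> real \<Rightarrow> real \<Rightarrow> real \<Rightarrow> real \<Rightarrow> bool" where
  "transforms_into_painleve_V n a0 a1 a2 b0 b1 b2 \<longleftrightarrow>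
     (\<exists>\<alpha> \<beta> A1 A2 A3. \<forall>I h.
        open I \<longrightarrow> is_interval I \<longrightarrow> (\<forall>x\<in>I. a2*x - b2 \<noteq> 0) \<longrightarrow>
        (let c = b2 / a2; J = (\<lambda>x. x - c) ` I; G = painleve_transform c \<alpha> \<beta> h in
           (solves_third_order_ode n a0 a1 a2 b0 b1 b2 I h \<longrightarrow>
              (\<exists>A4. solves_painleve_V A1 A2 A3 A4 J G)) \<and>
           (times_differentiable_on 3 h I \<longrightarrow> (\<forall>z\<in>J. (deriv ^^ 2) G z \<noteq> 0) \<longrightarrow>
              (\<exists>A4. solves_painleve_V A1 A2 A3 A4 J G) \<longrightarrow>
              solves_third_order_ode n a0 a1 a2 b0 b1 b2 I h)))"

end

theory Submission
  imports Defs "Jordan_Normal_Form.Determinant"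
begin

text \<open>
  The integral is \<open>n!\<close> times the Hankel determinant of the moments of \<open>exp (x * z) * \<rho> z\<close>, and
  inserting a power sum \<open>p\<^sub>k\<close> into it amounts to shifting each row by \<open>k\<close> in turn; in particular
  \<open>d/dx\<close> is the insertion of \<open>p\<^sub>1\<close>. The Pluecker relation between the minors with partitions
  \<open>0, 1, 2, 11, 21, 22\<close> is the KP equation, which involves the averages of
  \<open>p\<^sub>1\<^sup>4 + 3 * p\<^sub>2\<^sup>2 - 4 * p\<^sub>1 * p\<^sub>3\<close>, \<open>p\<^sub>1\<^sup>3\<close>, \<open>p\<^sub>1\<^sup>2\<close>, \<open>p\<^sub>1\<close>, \<open>p\<^sub>2\<close> and \<open>p\<^sub>3\<close>.
  Integrating the derivative of \<open>A z * z ^ k * exp (x * z) * \<rho> z\<close> gives a recursion for the moments,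
  and, summed over the rows and columns of the determinant, the Virasoro constraints. These express
  the averages of \<open>p\<^sub>2\<close>, \<open>p\<^sub>3\<close> and \<open>p\<^sub>2\<^sup>2\<close> by derivatives in \<open>x\<close>, which turns the KP equation into
  the ordinary differential equation.
\<close>

section \<open>Determinants as functions of their rows\<close>

text \<open>The derivative in x inserts \<open>p\<^sub>1\<close> only. Differentiating the
  constraints for \<open>p\<^sub>2\<close> and \<open>p\<^sub>3\<close> therefore yields the
  averages of \<open>p\<^sub>1 * p\<^sub>2\<close> and \<open>p\<^sub>1 * p\<^sub>3\<close>, whereas
  that of \<open>p\<^sub>2\<^sup>2\<close> needs the lowest constraint with \<open>p\<^sub>2\<close>
  already inserted. What remains in the KP equation are powers of \<open>p\<^sub>1\<close>, so the
  system closes. Each elimination divides by \<open>a2 * x - b2\<close>, which is the origin of the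
  poles of order up to three. Three obstacles shape the rest. The determinant may have fewer than
  the four rows that power sums of total degree four can reach. Convergence is assumed for the
  n-fold integral, whereas moments need one-dimensional integrability; the passage costs a lower
  bound for the Vandermonde factor. And A may vanish inside E, where nothing is assumed of the
  weight: boundary terms disappear there only because a function of size 1 / |z - p| is not
  integrable near p.\<close>

definition fdet :: "nat \<Rightarrow> (nat \<Rightarrow> nat \<Rightarrow> real) \<Rightarrow> real" where
  "fdet n a = Determinant.det (mat n n (\<lambda>(i, j). a i j))"

lemma fdet_perm:
  "fdet n a = (\<Sum>p | p permutes {..<n}. signof p * (\<Prod>i<n. a i (p i)))"
proof -
  have "(\<Prod>i = 0..<n. mat n n (\<lambda>(i, j). a i j) $$ (i, p i)) = (\<Prod>i<n. a i (p i))"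
    if "p permutes {..<n}" for p
  proof (rule prod.cong)
    fix i assume "i \<in> {..<n}"
    then have "i < n" "p i < n" using permutes_in_image[OF that, of i] by blast+
    then show "mat n n (\<lambda>(i, j). a i j) $$ (i, p i) = a i (p i)" by simp
  qed (rule atLeast0LessThan)
  then show ?thesis
    unfolding fdet_def by (subst det_def'[of _ n]) (simp_all add: atLeast0LessThan)
qed

lemma fdet_cong: "(\<And>i j. i < n \<Longrightarrow> j < n \<Longrightarrow> a i j = b i j) \<Longrightarrow> fdet n a = fdet n b"
  unfolding fdet_def by (intro arg_cong[of _ _ Determinant.det]) auto

lemma fdet_transpose: "fdet n (\<lambda>i j. a j i) = fdet n a"
proof -
  have "transpose_mat (mat n n (\<lambda>(i, j). a i j)) = mat n n (\<lambda>(i, j). a j i)" by auto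
  then show ?thesis
    unfolding fdet_def using det_transpose[of "mat n n (\<lambda>(i, j). a i j)" n] by simp
qed

lemma fdet_eq_rows:
  assumes "i < n" "j < n" "i \<noteq> j" "\<And>c. c < n \<Longrightarrow> a i c = a j c"
  shows "fdet n a = 0"
proof -
  let ?A = "mat n n (\<lambda>(i, j). a i j)"
  have "row ?A i = row ?A j"
  proof (rule eq_vecI)
    fix c assume "c < dim_vec (row ?A j)"
    then show "row ?A i $ c = row ?A j $ c" using assms(1,2) assms(4)[of c] by simp
  qed simp
  then show ?thesis
    unfolding fdet_def using assms(1-3) by (intro det_identical_rows[of ?A n i j]) simp_all
qed

lemma fdet_row_sum:
  assumes "i < n" "finite S"
  shows "fdet n (a(i := \<lambda>c. \<Sum>k\<in>S. \<alpha> k * b k c)) = (\<Sum>k\<in>S. \<alpha> k * fdet n (a(i := b k)))"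
proof -
  have rem: "(\<Prod>r<n. (a(i := v)) r (p r)) = v (p i) * (\<Prod>r\<in>{..<n} - {i}. a r (p r))" for v p
    using assms(1) by (subst prod.remove[of _ i]) auto
  show ?thesis
    unfolding fdet_perm rem sum_distrib_left sum_distrib_right
    by (subst sum.swap) (simp add: mult_ac)
qed

lemma fdet_row_add:
  assumes "i < n"
  shows "fdet n (a(i := \<lambda>c. u c + v c)) = fdet n (a(i := u)) + fdet n (a(i := v))"
  using fdet_row_sum[OF assms, of "{0, 1::nat}" a "\<lambda>_. 1" "\<lambda>k. if k = 0 then u else v"] by simp

lemma fdet_row_scale:
  assumes "i < n"
  shows "fdet n (a(i := \<lambda>c. s * u c)) = s * fdet n (a(i := u))"
  using fdet_row_sum[OF assms, of "{0::nat}" a "\<lambda>_. s" "\<lambda>k. u"] by simp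

lemma fdet_row_zero:
  assumes "i < n" "\<And>c. c < n \<Longrightarrow> a i c = 0"
  shows "fdet n a = 0"
proof -
  have "(\<Prod>r<n. a r (p r)) = 0" if "p permutes {..<n}" for p
    using assms permutes_in_image[OF that] by (intro prod_zero) auto
  then show ?thesis unfolding fdet_perm by (intro sum.neutral ballI) simp
qed

lemma fdet_col_zero:
  assumes "j < n" "\<And>r. r < n \<Longrightarrow> a r j = 0"
  shows "fdet n a = 0"
  using fdet_row_zero[of j n "\<lambda>r c. a c r"] assms by (simp add: fdet_transpose[of n a])

text \<open>Polarisation: with \<open>a i + a j\<close> in both rows the determinant vanishes, and
  so do the two diagonal terms of its bilinear expansion.\<close>

lemma fdet_row_swap:
  assumes "i < n" "j < n" "i \<noteq> j"
  shows "fdet n (a(i := a j, j := a i)) = - fdet n a"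
proof -
  have z: "fdet n (b(i := u, j := u)) = 0" for b u
    using assms by (intro fdet_eq_rows[of i n j]) auto
  have s: "fdet n (b(i := \<lambda>c. u c + v c)) = fdet n (b(i := u)) + fdet n (b(i := v))"
          "fdet n (b(j := \<lambda>c. u c + v c)) = fdet n (b(j := u)) + fdet n (b(j := v))" for b u v
    using assms fdet_row_add by auto
  let ?s = "\<lambda>c. a i c + a j c"
  have t: "fdet n (a(i := ?s, j := u)) = fdet n (a(i := a i, j := u)) + fdet n (a(i := a j, j := u))" for u
    unfolding fun_upd_twist[OF assms(3)] by (rule s)
  have "0 = fdet n (a(i := ?s, j := ?s))" by (simp add: z)
  also have "\<dots> = fdet n (a(i := ?s, j := a i)) + fdet n (a(i := ?s, j := a j))"
    by (rule s)
  also have "\<dots> = fdet n (a(i := a j, j := a i)) + fdet n a"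
    using z[of a "a i"] z[of a "a j"] unfolding t by simp
  finally show ?thesis by simp
qed

text \<open>A Leibniz term meets each row and each column exactly once, so reindexing by its
  permutation turns the sum over the replaced row into the sum over the replaced column. This lets
  weights attached to columns be treated alongside weights attached to rows.\<close>

lemma sum_row_replace_eq_sum_col_replace:
  "(\<Sum>i<n. fdet n (a(i := X i))) = (\<Sum>j<n. fdet n (\<lambda>r c. if c = j then X r c else a r c))"
proof -
  have "(\<Sum>i<n. \<Prod>r<n. (a(i := X i)) r (p r)) =
      (\<Sum>j<n. \<Prod>r<n. if p r = j then X r (p r) else a r (p r))" if p: "p permutes {..<n}" for p
  proof -
    have "(\<Sum>j<n. \<Prod>r<n. if p r = j then X r (p r) else a r (p r)) =
        (\<Sum>i<n. \<Prod>r<n. if p r = p i then X r (p r) else a r (p r))"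
      by (rule sum.reindex_bij_betw[OF permutes_imp_bij[OF p], symmetric])
    also have "\<dots> = (\<Sum>i<n. \<Prod>r<n. (a(i := X i)) r (p r))"
      using permutes_inj[OF p] by (intro sum.cong prod.cong) (auto simp: inj_eq)
    finally show ?thesis by simp
  qed
  then show ?thesis
    unfolding fdet_perm by (subst (1 2) sum.swap) (simp add: sum_distrib_left[symmetric])
qed

lemma fdet_has_real_derivative:
  assumes "\<And>i j. i < n \<Longrightarrow> j < n \<Longrightarrow> ((\<lambda>x. a x i j) has_real_derivative X i j) (at x)"
  shows "((\<lambda>x. fdet n (a x)) has_real_derivative (\<Sum>i<n. fdet n ((a x)(i := X i)))) (at x)"
proof -
  have rem: "(\<Prod>r<n. ((a x)(i := X i)) r (p r)) = X i (p i) * (\<Prod>r\<in>{..<n} - {i}. a x r (p r))"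
    if "i < n" for i p
    using that by (subst prod.remove[of _ i]) auto
  have "((\<lambda>x. \<Sum>p | p permutes {..<n}. signof p * (\<Prod>i<n. a x i (p i))) has_real_derivative
     (\<Sum>p | p permutes {..<n}. signof p *
        (\<Sum>i<n. X i (p i) * (\<Prod>r\<in>{..<n} - {i}. a x r (p r))))) (at x)"
    by (auto intro!: DERIV_sum DERIV_cmult has_field_derivative_prod assms
        dest!: permutes_in_image)
  moreover have "(\<Sum>p | p permutes {..<n}. signof p *
        (\<Sum>i<n. X i (p i) * (\<Prod>r\<in>{..<n} - {i}. a x r (p r)))) =
      (\<Sum>i<n. fdet n ((a x)(i := X i)))"
    unfolding fdet_perm sum_distrib_left
    by (subst sum.swap) (intro sum.cong refl, simp add: rem del: fun_upd_apply)
  ultimately show ?thesis by (simp add: fdet_perm)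
qed

text \<open>Cramer's rule with the determinant kept on the left, so that nothing is inverted:
  multiply the row \<open>u\<close> by the identity for \<open>adj_mat A * A\<close>.\<close>

lemma fdet_row_combination:
  obtains c where "\<And>l. l < n \<Longrightarrow> fdet n a * u l = (\<Sum>k<n. c k * a k l)"
proof -
  define A where "A = mat n n (\<lambda>(i, j). a i j)"
  define B where "B = adj_mat A"
  have A: "A \<in> carrier_mat n n" by (simp add: A_def)
  have B: "B \<in> carrier_mat n n" and BA: "B * A = fdet n a \<cdot>\<^sub>m 1\<^sub>m n"
    using adj_mat[OF A] by (auto simp: B_def fdet_def A_def)
  have ent: "(\<Sum>k<n. B $$ (j, k) * a k l) = (if j = l then fdet n a else 0)"
    if "j < n" "l < n" for j l
  proof -
    have "(B * A) $$ (j, l) = (\<Sum>k<n. B $$ (j, k) * a k l)"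
      using that A B by (auto simp: scalar_prod_def A_def atLeast0LessThan intro!: sum.cong)
    then have "(\<Sum>k<n. B $$ (j, k) * a k l) = (fdet n a \<cdot>\<^sub>m 1\<^sub>m n) $$ (j, l)"
      by (simp only: BA)
    then show ?thesis using that by simp
  qed
  have "fdet n a * u l = (\<Sum>k<n. (\<Sum>j<n. u j * B $$ (j, k)) * a k l)" if "l < n" for l
  proof -
    have "(\<Sum>k<n. (\<Sum>j<n. u j * B $$ (j, k)) * a k l) = (\<Sum>j<n. u j * (\<Sum>k<n. B $$ (j, k) * a k l))"
      by (simp add: sum_distrib_left sum_distrib_right mult_ac) (rule sum.swap)
    also have "\<dots> = (\<Sum>j<n. if j = l then u j * fdet n a else 0)"
      using that by (intro sum.cong) (auto simp: ent)
    also have "\<dots> = fdet n a * u l" using that by simp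
    finally show ?thesis by simp
  qed
  then show ?thesis by (rule that)
qed

text \<open>The three-term Pluecker relation. When \<open>u\<close> is expanded in the rows of
  \<open>a\<close>, only the coefficients at \<open>p\<close> and \<open>q\<close> survive, and by
  Cramer's rule these are the determinants with \<open>u\<close> in row \<open>p\<close> or in row
  \<open>q\<close>.\<close>

lemma fdet_plucker:
  assumes "p < n" "q < n" "p \<noteq> q" and nz: "fdet n a \<noteq> 0"
  shows "fdet n a * fdet n (a(p := u, q := v)) =
    fdet n (a(p := u)) * fdet n (a(q := v)) - fdet n (a(q := u)) * fdet n (a(p := v))"
proof -
  obtain c where c: "\<And>l. l < n \<Longrightarrow> fdet n a * u l = (\<Sum>k<n. c k * a k l)"
    using fdet_row_combination by blast
  have exp: "fdet n a * fdet n (a(p := u, q := w)) =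
      c p * fdet n (a(q := w)) + c q * fdet n (a(p := a q, q := w))" for w
  proof -
    have "fdet n a * fdet n (a(p := u, q := w)) = fdet n ((a(q := w))(p := \<lambda>l. fdet n a * u l))"
      using fdet_row_scale[OF assms(1), of "a(q := w)"] fun_upd_twist[OF assms(3), of a] by simp
    also have "\<dots> = fdet n ((a(q := w))(p := \<lambda>l. \<Sum>k<n. c k * a k l))"
      using c by (intro fdet_cong) auto
    also have "\<dots> = (\<Sum>k<n. c k * fdet n ((a(q := w))(p := a k)))"
      using assms by (intro fdet_row_sum) auto
    finally have "fdet n a * fdet n (a(p := u, q := w)) = (\<Sum>k<n. c k * fdet n ((a(q := w))(p := a k)))" .
    also have "\<dots> = (\<Sum>k\<in>{p, q}. c k * fdet n ((a(q := w))(p := a k)))"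
    proof (rule sum.mono_neutral_right)
      show "\<forall>k\<in>{..<n} - {p, q}. c k * fdet n ((a(q := w))(p := a k)) = 0"
      proof
        fix k assume "k \<in> {..<n} - {p, q}"
        \<comment> \<open>Row \<open>k\<close> is still in its own place, so \<open>a k\<close>
          occurs twice.\<close>
        then have "fdet n ((a(q := w))(p := a k)) = 0"
          using assms by (intro fdet_eq_rows[of p n k]) auto
        then show "c k * fdet n ((a(q := w))(p := a k)) = 0" by simp
      qed
    qed (use assms in auto)
    moreover have "(a(q := w))(p := a p) = a(q := w)"
      using assms(3) by (simp add: fun_upd_idem_iff)
    ultimately show ?thesis
      using assms(3) fun_upd_twist[OF assms(3), of a] by simp
  qed
  have 1: "fdet n (a(p := u)) = c p"
  proof -
    have "fdet n (a(p := a q, q := a q)) = 0" using assms by (intro fdet_eq_rows[of p n q]) auto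
    then have "fdet n a * fdet n (a(p := u)) = c p * fdet n a"
      using exp[of "a q"] assms(3) by (simp add: fun_upd_idem)
    then show ?thesis using nz by simp
  qed
  have 2: "fdet n (a(q := u)) = c q"
  proof -
    have "fdet n (a(q := a p)) = 0" using assms by (intro fdet_eq_rows[of p n q]) auto
    then have "fdet n a * fdet n (a(p := u, q := a p)) = - c q * fdet n a"
      using exp[of "a p"] fdet_row_swap[OF assms(1-3), of a] by simp
    then have "fdet n a * fdet n (a(p := u, q := a p)) = fdet n a * (- c q)" by simp
    then have "fdet n (a(p := u, q := a p)) = - c q" using nz mult_left_cancel by blast
    moreover have "fdet n (a(p := u, q := a p)) = - fdet n (a(q := u))"
      using fdet_row_swap[OF assms(1-3), of "a(q := u)"] assms(3) by (simp add: fun_upd_twist)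
    ultimately show ?thesis by simp
  qed
  have 3: "fdet n (a(p := a q, q := v)) = - fdet n (a(p := v))"
    using fdet_row_swap[OF assms(1-3), of "a(p := v)"] assms(3) by (simp add: fun_upd_twist)
  show ?thesis using exp[of v] by (simp add: 1 2 3)
qed

section \<open>The KP equation as a Pluecker relation\<close>

text \<open>The operator acts on functions of a whole choice of rows, not on single determinants, so
  that insertions compose: an iterated shift may raise a row that was raised before, as a product of
  power sums requires.\<close>

definition shift :: "nat \<Rightarrow> nat \<Rightarrow> ((nat \<Rightarrow> nat) \<Rightarrow> real) \<Rightarrow> (nat \<Rightarrow> nat) \<Rightarrow> real" where
  "shift n k F r = (\<Sum>i<n. F (r(i := r i + k)))"

definition alternating :: "nat \<Rightarrow> ((nat \<Rightarrow> nat) \<Rightarrow> real) \<Rightarrow> bool" where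
  "alternating n F \<longleftrightarrow> (\<forall>r i j. i < n \<longrightarrow> j < n \<longrightarrow> i \<noteq> j \<longrightarrow> F (r(i := r j, j := r i)) = - F r)"

lemma alternatingD:
  "alternating n F \<Longrightarrow> i < n \<Longrightarrow> j < n \<Longrightarrow> i \<noteq> j \<Longrightarrow> F (r(i := r j, j := r i)) = - F r"
  by (simp add: alternating_def)

lemma alternating_eq_0:
  assumes "alternating n F" "i < n" "j < n" "i \<noteq> j" "r i = r j"
  shows "F r = 0"
proof -
  have "r(i := r j, j := r i) = r" using assms(5) by auto
  then show ?thesis using alternatingD[OF assms(1-4), of r] by simp
qed

text \<open>The transposition only permutes the summands: raising row \<open>l\<close> before it
  corresponds to raising row \<open>t l\<close> after it.\<close>

lemma alternating_shift:
  assumes F: "alternating n F"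
  shows "alternating n (shift n k F)"
  unfolding alternating_def
proof (intro allI impI)
  fix r :: "nat \<Rightarrow> nat" and i j assume ij: "i < n" "j < n" "i \<noteq> j"
  define t where "t = Transposition.transpose i j"
  let ?r = "r(i := r j, j := r i)"
  have t: "bij_betw t {..<n} {..<n}"
    unfolding t_def using ij by (intro bij_betw_byWitness[of _ "Transposition.transpose i j"])
      (auto simp: transpose_def)
  have *: "F (?r(t l := ?r (t l) + k)) = - F (r(l := r l + k))" for l
  proof -
    let ?s = "r(l := r l + k)"
    have "?r(t l := ?r (t l) + k) = ?s(i := ?s j, j := ?s i)"
      using ij by (auto simp: t_def transpose_def fun_eq_iff)
    then show ?thesis using alternatingD[OF F ij, of ?s] by simp
  qed
  have "shift n k F ?r = (\<Sum>l<n. F (?r(t l := ?r (t l) + k)))"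
    unfolding shift_def by (rule sum.reindex_bij_betw[OF t, symmetric])
  also have "\<dots> = - shift n k F r" by (simp only: * shift_def sum_negf)
  finally show "shift n k F ?r = - shift n k F r" .
qed

lemma alternating_fdet_rows: "alternating n (\<lambda>r. fdet n (\<lambda>i. f (r i)))"
  unfolding alternating_def
proof (intro allI impI)
  fix r :: "nat \<Rightarrow> nat" and i j assume ij: "i < n" "j < n" "i \<noteq> j"
  have "(\<lambda>l. f ((r(i := r j, j := r i)) l)) = (\<lambda>l. f (r l))(i := f (r j), j := f (r i))"
    using ij by auto
  then show "fdet n (\<lambda>l. f ((r(i := r j, j := r i)) l)) = - fdet n (\<lambda>l. f (r l))"
    using fdet_row_swap[OF ij, of "\<lambda>l. f (r l)"] by simp
qed

text \<open>
  The partition \<open>(d - 3, c - 2, b - 1, a)\<close>. Four parts suffice, because the power sums are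
  applied to a total degree of at most four.
\<close>

definition last_rows :: "nat \<Rightarrow> nat \<Rightarrow> nat \<Rightarrow> nat \<Rightarrow> nat \<Rightarrow> nat \<Rightarrow> nat" where
  "last_rows m a b c d =
    (\<lambda>i. i)(m := m + a, m + 1 := m + b, m + 2 := m + c, m + 3 := m + d)"

lemma id_eq_last_rows: "(\<lambda>i. i) = last_rows m 0 1 2 3"
  by (auto simp: last_rows_def)

text \<open>Only the last four rows contribute. A lower row raised by \<open>k\<close> lands either
  on another row below \<open>m\<close>, or on one of the values m, ..., m + k - 1, which the
  hypothesis places among the last four rows. Either way two rows coincide.\<close>

lemma shift_last_rows:
  assumes F: "alternating (m + 4) F" and sub: "{..<k} \<subseteq> {a, b, c, d}" "k > 0"
  shows "shift (m + 4) k F (last_rows m a b c d) =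
    F (last_rows m (a + k) b c d) + F (last_rows m a (b + k) c d) +
    F (last_rows m a b (c + k) d) + F (last_rows m a b c (d + k))"
proof -
  let ?r = "last_rows m a b c d"
  have "F (?r(i := ?r i + k)) = 0" if i: "i < m" for i
  proof -
    have "\<exists>j<m + 4. j \<noteq> i \<and> ?r j = i + k"
    proof (cases "i + k < m")
      case True
      then show ?thesis using sub(2) by (intro exI[of _ "i + k"]) (auto simp: last_rows_def)
    next
      case False
      then have "i + k - m \<in> {..<k}" using i by auto
      then consider "i + k = m + a" | "i + k = m + b" | "i + k = m + c" | "i + k = m + d"
        using sub(1) False by fastforce
      then show ?thesis
      proof cases
        case 1 then show ?thesis using i by (intro exI[of _ m]) (auto simp: last_rows_def)
      next
        case 2 then show ?thesis using i by (intro exI[of _ "m + 1"]) (auto simp: last_rows_def)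
      next
        case 3 then show ?thesis using i by (intro exI[of _ "m + 2"]) (auto simp: last_rows_def)
      next
        case 4 then show ?thesis using i by (intro exI[of _ "m + 3"]) (auto simp: last_rows_def)
      qed
    qed
    then obtain j where j: "j < m + 4" "j \<noteq> i" "?r j = i + k" by blast
    have "?r i = i" using i by (simp add: last_rows_def)
    then show ?thesis
      using j i by (intro alternating_eq_0[OF F, of i j]) auto
  qed
  then have z: "(\<Sum>i<m. F (?r(i := ?r i + k))) = 0" by (intro sum.neutral) auto
  have n: "m + 4 = Suc (Suc (Suc (Suc m)))" by simp
  have "?r(m := ?r m + k) = last_rows m (a + k) b c d"
    "?r(Suc m := ?r (Suc m) + k) = last_rows m a (b + k) c d"
    "?r(Suc (Suc m) := ?r (Suc (Suc m)) + k) = last_rows m a b (c + k) d"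
    "?r(Suc (Suc (Suc m)) := ?r (Suc (Suc (Suc m))) + k) = last_rows m a b c (d + k)"
    by (auto simp: last_rows_def fun_eq_iff)
  then show ?thesis unfolding shift_def n sum.lessThan_Suc z by simp
qed

lemma last_rows_swap:
  assumes F: "alternating (m + 4) F"
  shows "F (last_rows m b a c d) = - F (last_rows m a b c d)"
    "F (last_rows m a c b d) = - F (last_rows m a b c d)"
    "F (last_rows m a b d c) = - F (last_rows m a b c d)"
proof -
  have "last_rows m b a c d = (last_rows m a b c d)(m := last_rows m a b c d (m + 1), m + 1 := last_rows m a b c d m)"
    "last_rows m a c b d = (last_rows m a b c d)(m + 1 := last_rows m a b c d (m + 2), m + 2 := last_rows m a b c d (m + 1))"
    "last_rows m a b d c = (last_rows m a b c d)(m + 2 := last_rows m a b c d (m + 3), m + 3 := last_rows m a b c d (m + 2))"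
    by (auto simp: last_rows_def fun_eq_iff)
  then show "F (last_rows m b a c d) = - F (last_rows m a b c d)"
    "F (last_rows m a c b d) = - F (last_rows m a b c d)"
    "F (last_rows m a b d c) = - F (last_rows m a b c d)"
    by (simp_all add: alternatingD[OF F])
qed

lemma last_rows_eq_0:
  assumes F: "alternating (m + 4) F" and "a = b \<or> a = c \<or> a = d \<or> b = c \<or> b = d \<or> c = d"
  shows "F (last_rows m a b c d) = 0"
proof -
  have "\<exists>i j. i < m + 4 \<and> j < m + 4 \<and> i \<noteq> j \<and> last_rows m a b c d i = last_rows m a b c d j"
    using assms(2)
  proof (elim disjE)
    assume "a = b" then show ?thesis by (intro exI[of _ m] exI[of _ "m + 1"]) (auto simp: last_rows_def)
  next
    assume "a = c" then show ?thesis by (intro exI[of _ m] exI[of _ "m + 2"]) (auto simp: last_rows_def)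
  next
    assume "a = d" then show ?thesis by (intro exI[of _ m] exI[of _ "m + 3"]) (auto simp: last_rows_def)
  next
    assume "b = c" then show ?thesis by (intro exI[of _ "m + 1"] exI[of _ "m + 2"]) (auto simp: last_rows_def)
  next
    assume "b = d" then show ?thesis by (intro exI[of _ "m + 1"] exI[of _ "m + 3"]) (auto simp: last_rows_def)
  next
    assume "c = d" then show ?thesis by (intro exI[of _ "m + 2"] exI[of _ "m + 3"]) (auto simp: last_rows_def)
  qed
  then show ?thesis using alternating_eq_0[OF F] by blast
qed

text \<open>
  Hirota's bilinear form of the KP equation is the three-term Pluecker relation for the rows
  \<open>m + 2, \<dots>, m + 5\<close> over the common rows \<open>0, \<dots>, m + 1\<close>, rewritten in power sums.
\<close>

lemma kp_large:
  fixes f :: "nat \<Rightarrow> nat \<Rightarrow> real" and m :: nat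
  defines "F \<equiv> \<lambda>r. fdet (m + 4) (\<lambda>i. f (r i))"
  defines "S \<equiv> shift (m + 4)" and "e \<equiv> \<lambda>i::nat. i"
  assumes nz: "F e \<noteq> 0"
  shows "F e * (S 1 (S 1 (S 1 (S 1 F))) e + 3 * S 2 (S 2 F) e - 4 * S 3 (S 1 F) e)
     - 4 * S 1 (S 1 (S 1 F)) e * S 1 F e + 3 * (S 1 (S 1 F) e)\<^sup>2 - 3 * (S 2 F e)\<^sup>2
     + 4 * S 1 F e * S 3 F e = 0"
proof -
  let ?T = "last_rows m"
  have F: "alternating (m + 4) F" unfolding F_def by (rule alternating_fdet_rows)
  have SF: "alternating (m + 4) (S k G)" if "alternating (m + 4) G" for k G
    unfolding S_def using that by (rule alternating_shift)
  have s: "S k G (?T a b c d) = G (?T (a + k) b c d) + G (?T a (b + k) c d) +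
      G (?T a b (c + k) d) + G (?T a b c (d + k))"
    if "{..<k} \<subseteq> {a, b, c, d}" "k > 0" "alternating (m + 4) G" for k G a b c d
    unfolding S_def using that shift_last_rows by blast
  have l: "{..<1} = {0::nat}" "{..<2} = {0, 1::nat}" "{..<3} = {0, 1, 2::nat}" by auto
  note rules = s l F SF last_rows_eq_0
  have e: "e = ?T 0 1 2 3" unfolding e_def by (rule id_eq_last_rows)
  \<comment> \<open>The suffixes of these facts are partitions: \<open>P1_21\<close> applies
    \<open>p\<^sub>1\<close> to the partition (2,1), which is \<open>?T 0 1 3 5\<close>. The minus
    signs for \<open>p\<^sub>2\<close> and \<open>p\<^sub>3\<close> come from sorting the rows after
    a jump, as in the Murnaghan-Nakayama rule.\<close>
  have P1: "S 1 G e = G (?T 0 1 2 4)" if "alternating (m + 4) G" for G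
    unfolding e by (simp add: rules that del: One_nat_def)
  have P1_1: "S 1 G (?T 0 1 2 4) = G (?T 0 1 2 5) + G (?T 0 1 3 4)" if "alternating (m + 4) G" for G
    by (simp add: rules that del: One_nat_def)
  have P1_2: "S 1 G (?T 0 1 2 5) = G (?T 0 1 2 6) + G (?T 0 1 3 5)" if "alternating (m + 4) G" for G
    by (simp add: rules that del: One_nat_def)
  have P1_11: "S 1 G (?T 0 1 3 4) = G (?T 0 1 3 5) + G (?T 0 2 3 4)" if "alternating (m + 4) G" for G
    by (simp add: rules that del: One_nat_def)
  have P1_3: "S 1 G (?T 0 1 2 6) = G (?T 0 1 2 7) + G (?T 0 1 3 6)" if "alternating (m + 4) G" for G
    by (simp add: rules that del: One_nat_def)
  have P1_21: "S 1 G (?T 0 1 3 5) = G (?T 0 1 3 6) + G (?T 0 1 4 5) + G (?T 0 2 3 5)" if "alternating (m + 4) G" for G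
    by (simp add: rules that del: One_nat_def)
  have P1_111: "S 1 G (?T 0 2 3 4) = G (?T 0 2 3 5) + G (?T 1 2 3 4)" if "alternating (m + 4) G" for G
    by (simp add: rules that del: One_nat_def)
  have P2: "S 2 G e = G (?T 0 1 2 5) - G (?T 0 1 3 4)" if "alternating (m + 4) G" for G
    unfolding e using last_rows_swap(3)[OF that, of 0 1 3 4]
    by (simp add: rules that del: One_nat_def)
  have P2_2: "S 2 G (?T 0 1 2 5) = G (?T 0 1 2 7) + G (?T 0 1 4 5) - G (?T 0 2 3 5)"
    if "alternating (m + 4) G" for G
    using last_rows_swap(2)[OF that, of 0 2 3 5] by (simp add: rules that del: One_nat_def)
  have P2_11: "S 2 G (?T 0 1 3 4) = G (?T 0 1 3 6) - G (?T 0 1 4 5) - G (?T 1 2 3 4)"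
    if "alternating (m + 4) G" for G
    using last_rows_swap(3)[OF that, of 0 1 4 5] last_rows_swap(1)[OF that, of 1 2 3 4]
    by (simp add: rules that numeral_2_eq_2[symmetric] del: One_nat_def)
  have P3: "S 3 G e = G (?T 0 1 2 6) - G (?T 0 1 3 5) + G (?T 0 2 3 4)"
    if "alternating (m + 4) G" for G
    unfolding e using last_rows_swap(3)[OF that, of 0 1 3 5]
      last_rows_swap(2)[OF that, of 0 2 4 3] last_rows_swap(3)[OF that, of 0 2 3 4]
    by (simp add: rules that del: One_nat_def)
  note P = P1 P1_1 P1_2 P1_11 P1_3 P1_21 P1_111 P2 P2_2 P2_11 P3
  \<comment> \<open>Indexed by partitions, with 0 for the empty one, this reads F_0 F_22 - F_1 F_21
    + F_2 F_11 = 0.\<close>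
  have pl: "F e * F (?T 0 1 4 5) - F (?T 0 1 2 4) * F (?T 0 1 3 5) + F (?T 0 1 2 5) * F (?T 0 1 3 4) = 0"
  proof -
    let ?a = "\<lambda>i. f (e i)"
    have rows: "(\<lambda>i. f (?T 0 1 c 3 i))(m + 3 := f (m + d)) = (\<lambda>i. f (?T 0 1 c d i))"
      for c d by (auto simp: last_rows_def e_def fun_eq_iff)
    have row2: "(?a)(m + 2 := f (m + c)) = (\<lambda>i. f (?T 0 1 c 3 i))" for c
      by (auto simp: last_rows_def e_def fun_eq_iff)
    have row3: "(?a)(m + 3 := f (m + d)) = (\<lambda>i. f (?T 0 1 2 d i))" for d
      by (auto simp: last_rows_def e_def fun_eq_iff)
    have "F e * F (?T 0 1 4 5) = F (?T 0 1 4 3) * F (?T 0 1 2 5) - F (?T 0 1 2 4) * F (?T 0 1 5 3)"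
      using fdet_plucker[of "m + 2" "m + 4" "m + 3" ?a "f (m + 4)" "f (m + 5)"] nz
      unfolding F_def row2 row3 rows by simp
    then show ?thesis
      using last_rows_swap(3)[OF F, of 0 1 3 4] last_rows_swap(3)[OF F, of 0 1 3 5]
      by (simp add: mult_ac)
  qed
  \<comment> \<open>In \<open>p\<^sub>1\<^sup>4 + 3 * p\<^sub>2\<^sup>2 - 4 * p\<^sub>1 *
    p\<^sub>3\<close> all partitions of 4 cancel except (2,2), which occurs 12 times; the other
    products sum to -12 F_1 F_21 + 12 F_2 F_11. The left side is thus 12 times that of
    \<open>pl\<close>.\<close>
  show ?thesis
    using pl by (simp add: P F SF power2_eq_square del: One_nat_def) (simp add: algebra_simps)
qed

text \<open>
  A minor with fewer than four rows is bordered by a unit row and a unit column; since the new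
  top row cannot be shifted without leaving a zero column, shifting commutes with bordering.
\<close>

definition border :: "(nat \<Rightarrow> nat \<Rightarrow> real) \<Rightarrow> nat \<Rightarrow> nat \<Rightarrow> real" where
  "border f k j = (if k = 0 then (if j = 0 then 1 else 0) else if j = 0 then 0 else f (k - 1) (j - 1))"

definition border_index :: "(nat \<Rightarrow> nat) \<Rightarrow> nat \<Rightarrow> nat" where
  "border_index r i = (if i = 0 then 0 else r (i - 1) + 1)"

text \<open>The second clause expresses that without the unit row the first column is zero. Being
  stated for arbitrary \<open>F\<close> and \<open>F'\<close>, the relation passes through iterated
  shifts.\<close>

definition bordered :: "nat \<Rightarrow> ((nat \<Rightarrow> nat) \<Rightarrow> real) \<Rightarrow> ((nat \<Rightarrow> nat) \<Rightarrow> real) \<Rightarrow> bool" where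
  "bordered n F F' \<longleftrightarrow> (\<forall>r. F' (border_index r) = F r) \<and> (\<forall>r. (\<forall>i\<le>n. r i \<ge> 1) \<longrightarrow> F' r = 0)"

lemma border_index_id: "border_index (\<lambda>i. i) = (\<lambda>i. i)"
  by (auto simp: border_index_def)

lemma fdet_border:
  assumes "a 0 0 = 1" "\<And>j. 0 < j \<Longrightarrow> j \<le> n \<Longrightarrow> a 0 j = 0"
  shows "fdet (Suc n) a = fdet n (\<lambda>i j. a (Suc i) (Suc j))"
proof -
  let ?A = "mat (Suc n) (Suc n) (\<lambda>(i, j). a i j)"
  have "fdet (Suc n) a = (\<Sum>j<Suc n. ?A $$ (0, j) * cofactor ?A 0 j)"
    unfolding fdet_def by (rule laplace_expansion_row[of _ "Suc n"]) auto
  also have "\<dots> = (\<Sum>j\<in>{0}. ?A $$ (0, j) * cofactor ?A 0 j)"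
    using assms by (intro sum.mono_neutral_right) auto
  also have "\<dots> = Determinant.det (mat_delete ?A 0 0)"
    using assms by (simp add: cofactor_def)
  also have "mat_delete ?A 0 0 = mat n n (\<lambda>(i, j). a (Suc i) (Suc j))"
    by (auto simp: mat_delete_def intro!: eq_matI)
  finally show ?thesis by (simp add: fdet_def)
qed

lemma bordered_fdet: "bordered n (\<lambda>r. fdet n (\<lambda>i. f (r i))) (\<lambda>r. fdet (Suc n) (\<lambda>i. border f (r i)))"
  unfolding bordered_def
proof (intro conjI allI impI)
  fix r
  show "fdet (Suc n) (\<lambda>i. border f (border_index r i)) = fdet n (\<lambda>i. f (r i))"
    by (subst fdet_border) (auto simp: border_def border_index_def)
next
  fix r :: "nat \<Rightarrow> nat" assume "\<forall>i\<le>n. 1 \<le> r i"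
  then show "fdet (Suc n) (\<lambda>i. border f (r i)) = 0"
    by (intro fdet_col_zero[of 0]) (auto simp: border_def Suc_le_eq)
qed

text \<open>The summand that raises the unit row vanishes by the second clause of
  \<open>bordered\<close>; the others match those of \<open>F\<close> one by one.\<close>

lemma bordered_shift:
  assumes F: "bordered n F F'" and k: "k > 0"
  shows "bordered n (shift n k F) (shift (Suc n) k F')"
  unfolding bordered_def
proof (intro conjI allI impI)
  fix r
  let ?b = "border_index r"
  have "F' (?b(0 := ?b 0 + k)) = 0"
    using F k unfolding bordered_def by (auto simp: border_index_def)
  moreover have "F' (?b(Suc i := ?b (Suc i) + k)) = F (r(i := r i + k))" for i
  proof -
    have "?b(Suc i := ?b (Suc i) + k) = border_index (r(i := r i + k))"
      by (auto simp: border_index_def fun_eq_iff)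
    then show ?thesis using F by (simp add: bordered_def)
  qed
  ultimately show "shift (Suc n) k F' ?b = shift n k F r"
    unfolding shift_def by (subst sum.lessThan_Suc_shift) simp
next
  fix r :: "nat \<Rightarrow> nat" assume r: "\<forall>i\<le>n. 1 \<le> r i"
  have "\<forall>j\<le>n. 1 \<le> (r(i := r i + k)) j" for i using r k by auto
  then have "F' (r(i := r i + k)) = 0" for i
    using F unfolding bordered_def by blast
  then show "shift (Suc n) k F' r = 0" by (simp add: shift_def)
qed

lemma bordered_id: "bordered n F F' \<Longrightarrow> F' (\<lambda>i. i) = F (\<lambda>i. i)"
  unfolding bordered_def using border_index_id by (auto dest: spec[of _ "\<lambda>i. i"])

definition kp_form :: "nat \<Rightarrow> ((nat \<Rightarrow> nat) \<Rightarrow> real) \<Rightarrow> real" where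
  "kp_form n F = (let S = shift n; e = \<lambda>i. i in
     F e * (S 1 (S 1 (S 1 (S 1 F))) e + 3 * S 2 (S 2 F) e - 4 * S 3 (S 1 F) e)
     - 4 * S 1 (S 1 (S 1 F)) e * S 1 F e + 3 * (S 1 (S 1 F) e)\<^sup>2 - 3 * (S 2 F e)\<^sup>2
     + 4 * S 1 F e * S 3 F e)"

lemma kp_form_bordered:
  assumes "bordered n F F'"
  shows "kp_form (Suc n) F' = kp_form n F"
proof -
  let ?S = "shift n" and ?S' = "shift (Suc n)" and ?e = "\<lambda>i::nat. i"
  have sh: "bordered n (?S k G) (?S' k G')" if "bordered n G G'" "k > 0" for k G G'
    using that by (rule bordered_shift)
  have 1: "bordered n (?S 1 F) (?S' 1 F')" "bordered n (?S 2 F) (?S' 2 F')" "bordered n (?S 3 F) (?S' 3 F')"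
    by (simp_all add: sh assms del: One_nat_def)
  then have 2: "bordered n (?S 1 (?S 1 F)) (?S' 1 (?S' 1 F'))"
    "bordered n (?S 2 (?S 2 F)) (?S' 2 (?S' 2 F'))" "bordered n (?S 3 (?S 1 F)) (?S' 3 (?S' 1 F'))"
    by (simp_all add: sh del: One_nat_def)
  then have 3: "bordered n (?S 1 (?S 1 (?S 1 F))) (?S' 1 (?S' 1 (?S' 1 F')))"
    by (simp add: sh del: One_nat_def)
  then have 4: "bordered n (?S 1 (?S 1 (?S 1 (?S 1 F)))) (?S' 1 (?S' 1 (?S' 1 (?S' 1 F'))))"
    by (simp add: sh del: One_nat_def)
  note ids = bordered_id[OF assms] 1[THEN bordered_id] 2[THEN bordered_id] 3[THEN bordered_id] 4[THEN bordered_id]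
  show ?thesis unfolding kp_form_def Let_def ids ..
qed

lemma kp_form_fdet_rows:
  assumes "fdet n (\<lambda>i. f i) \<noteq> 0"
  shows "kp_form n (\<lambda>r. fdet n (\<lambda>i. f (r i))) = 0"
proof -
  define G where "G j r = fdet (n + j) (\<lambda>i. (border ^^ j) f (r i))" for j r
  have b: "bordered (n + j) (G j) (G (Suc j))" for j
    unfolding G_def using bordered_fdet[of "n + j" "(border ^^ j) f"] by simp
  have "kp_form (n + j) (G j) = kp_form n (G 0) \<and> G j (\<lambda>i. i) = G 0 (\<lambda>i. i)" for j
    by (induction j) (use kp_form_bordered[OF b] bordered_id[OF b] in auto)
  \<comment> \<open>Four borders bring any n to size n + 4, so \<open>kp_large\<close> applies with
    m = n and small sizes need no separate treatment.\<close>
  from this[of 4] have "kp_form (n + 4) (G 4) = kp_form n (G 0)" "G 4 (\<lambda>i. i) \<noteq> 0"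
    using assms by (auto simp: G_def)
  then show ?thesis
    using kp_large[of n "(border ^^ 4) f"]
    unfolding kp_form_def Let_def G_def by simp
qed

section \<open>Virasoro constraints for Hankel minors\<close>

text \<open>Row and column indices are kept apart so that both can be shifted; the Hankel
  determinant is the case where both are the identity.\<close>

definition hankel_minor :: "nat \<Rightarrow> (nat \<Rightarrow> real) \<Rightarrow> (nat \<Rightarrow> nat) \<Rightarrow> (nat \<Rightarrow> nat) \<Rightarrow> real" where
  "hankel_minor n \<mu> r c = fdet n (\<lambda>i j. \<mu> (r i + c j))"

lemma hankel_minor_commute: "hankel_minor n \<mu> r c = hankel_minor n \<mu> c r"
  unfolding hankel_minor_def by (subst fdet_transpose[symmetric]) (simp add: add.commute)

lemma alternating_hankel_minor: "alternating n (\<lambda>r. hankel_minor n \<mu> r c)"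
  unfolding hankel_minor_def by (rule alternating_fdet_rows[of n "\<lambda>k j. \<mu> (k + c j)"])

lemma hankel_minor_eq_rows:
  "i < n \<Longrightarrow> j < n \<Longrightarrow> i \<noteq> j \<Longrightarrow> r i = r j \<Longrightarrow> hankel_minor n \<mu> r c = 0"
  using alternating_eq_0[OF alternating_hankel_minor] .

lemma fdet_hankel_row_replace:
  "fdet n ((\<lambda>i j. \<mu> (r i + c j))(i := \<lambda>j. \<mu> (k + c j))) = hankel_minor n \<mu> (r(i := k)) c"
  unfolding hankel_minor_def by (intro fdet_cong) simp

lemma fdet_hankel_col_replace:
  "fdet n (\<lambda>i l. if l = j then \<mu> (r i + k) else \<mu> (r i + c l)) = hankel_minor n \<mu> r (c(j := k))"
  unfolding hankel_minor_def by (intro fdet_cong) simp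

text \<open>The entry depends on the sum of the two indices only, so adding \<open>k\<close> to the
  row index or to the column index has the same effect on it.\<close>

lemma shift_hankel_rows_eq_cols:
  "shift n k (\<lambda>r. hankel_minor n \<mu> r c) r = shift n k (hankel_minor n \<mu> r) c"
proof -
  let ?a = "\<lambda>i j. \<mu> (r i + c j)"
  have "shift n k (\<lambda>r. hankel_minor n \<mu> r c) r = (\<Sum>i<n. fdet n (?a(i := \<lambda>j. \<mu> (r i + k + c j))))"
    unfolding shift_def fdet_hankel_row_replace ..
  also have "\<dots> = (\<Sum>j<n. fdet n (\<lambda>i l. if l = j then \<mu> (r i + k + c l) else \<mu> (r i + c l)))"
    by (rule sum_row_replace_eq_sum_col_replace)
  also have "\<dots> = (\<Sum>j<n. fdet n (\<lambda>i l. if l = j then \<mu> (r i + (c j + k)) else \<mu> (r i + c l)))"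
    by (intro sum.cong refl fdet_cong) (simp add: algebra_simps)
  also have "\<dots> = shift n k (hankel_minor n \<mu> r) c"
    unfolding shift_def fdet_hankel_col_replace ..
  finally show ?thesis .
qed

lemma shift_commute: "shift n k (shift n l F) r = shift n l (shift n k F) r"
proof -
  have "r(i := r i + k, j := (r(i := r i + k)) j + l) = r(j := r j + l, i := (r(j := r j + l)) i + k)"
    for i j by auto
  then show ?thesis unfolding shift_def by (subst sum.swap) (simp only:)
qed

text \<open>Meant for the moment recursion at an index i + j: its coefficients are affine in the
  index, hence split into a row weight and a column weight. Putting the relation into a row gives a
  zero row; after summation over the rows, the column-weighted part is carried over to columns by
  \<open>sum_row_replace_eq_sum_col_replace\<close>.\<close>

lemma ward_identity:
  assumes "\<And>i j. i < n \<Longrightarrow> j < n \<Longrightarrow>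
      y0 i * \<mu> (\<rho>0 i + c j) + y1 i * \<mu> (\<rho>1 i + c j) + y2 i * \<mu> (\<rho>2 i + c j) + y3 i * \<mu> (\<rho>3 i + c j) +
      z0 j * \<mu> (r i + \<gamma>0 j) + z1 j * \<mu> (r i + \<gamma>1 j) + z2 j * \<mu> (r i + \<gamma>2 j) = 0"
  defines "R \<equiv> \<lambda>\<rho> i. hankel_minor n \<mu> (r(i := \<rho> i)) c"
    and "C \<equiv> \<lambda>\<gamma> j. hankel_minor n \<mu> r (c(j := \<gamma> j))"
  shows "(\<Sum>i<n. y0 i * R \<rho>0 i + y1 i * R \<rho>1 i + y2 i * R \<rho>2 i + y3 i * R \<rho>3 i) +
    (\<Sum>j<n. z0 j * C \<gamma>0 j + z1 j * C \<gamma>1 j + z2 j * C \<gamma>2 j) = 0"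
proof -
  let ?a = "\<lambda>i j. \<mu> (r i + c j)"
  let ?Y = "\<lambda>i j. y0 i * \<mu> (\<rho>0 i + c j) + y1 i * \<mu> (\<rho>1 i + c j) + y2 i * \<mu> (\<rho>2 i + c j) + y3 i * \<mu> (\<rho>3 i + c j)"
  let ?Z = "\<lambda>i j. z0 j * \<mu> (r i + \<gamma>0 j) + z1 j * \<mu> (r i + \<gamma>1 j) + z2 j * \<mu> (r i + \<gamma>2 j)"
  have rows: "fdet n (?a(i := ?Y i)) = y0 i * R \<rho>0 i + y1 i * R \<rho>1 i + y2 i * R \<rho>2 i + y3 i * R \<rho>3 i"
    if "i < n" for i
    unfolding R_def by (simp only: fdet_row_add[OF that] fdet_row_scale[OF that] fdet_hankel_row_replace)
  have cols: "fdet n (\<lambda>i l. if l = j then ?Z i l else ?a i l) = z0 j * C \<gamma>0 j + z1 j * C \<gamma>1 j + z2 j * C \<gamma>2 j"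
    if "j < n" for j
  proof -
    let ?b = "\<lambda>l i. \<mu> (r i + c l)"
    have col: "fdet n (?b(j := \<lambda>i. \<mu> (r i + \<gamma>))) = hankel_minor n \<mu> r (c(j := \<gamma>))" for \<gamma>
      unfolding fdet_hankel_col_replace[symmetric] by (subst fdet_transpose[symmetric]) (intro fdet_cong, auto)
    have "fdet n (\<lambda>i l. if l = j then ?Z i l else ?a i l) = fdet n (\<lambda>l i. if l = j then ?Z i l else ?a i l)"
      by (rule fdet_transpose)
    also have "\<dots> = fdet n (?b(j := \<lambda>i. ?Z i j))" by (intro fdet_cong) auto
    also have "\<dots> = z0 j * fdet n (?b(j := \<lambda>i. \<mu> (r i + \<gamma>0 j))) + z1 j * fdet n (?b(j := \<lambda>i. \<mu> (r i + \<gamma>1 j))) +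
        z2 j * fdet n (?b(j := \<lambda>i. \<mu> (r i + \<gamma>2 j)))"
      by (simp only: fdet_row_add[OF that] fdet_row_scale[OF that])
    finally show ?thesis unfolding C_def col .
  qed
  have "0 = (\<Sum>i<n. fdet n (?a(i := \<lambda>j. ?Y i j + ?Z i j)))"
  proof (rule sum.neutral[symmetric], intro ballI fdet_row_zero)
    fix i j assume "i \<in> {..<n}" "j < n"
    then show "(?a(i := \<lambda>j. ?Y i j + ?Z i j)) i j = 0" using assms(1)[of i j] by (simp add: add_ac)
  qed simp
  also have "\<dots> = (\<Sum>i<n. fdet n (?a(i := ?Y i))) + (\<Sum>i<n. fdet n (?a(i := ?Z i)))"
    unfolding sum.distrib[symmetric] by (intro sum.cong refl fdet_row_add) simp
  also have "(\<Sum>i<n. fdet n (?a(i := ?Z i))) = (\<Sum>j<n. fdet n (\<lambda>i l. if l = j then ?Z i l else ?a i l))"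
    by (rule sum_row_replace_eq_sum_col_replace)
  also have "(\<Sum>i<n. fdet n (?a(i := ?Y i))) =
      (\<Sum>i<n. y0 i * R \<rho>0 i + y1 i * R \<rho>1 i + y2 i * R \<rho>2 i + y3 i * R \<rho>3 i)"
    by (intro sum.cong refl rows) simp
  also have "(\<Sum>j<n. fdet n (\<lambda>i l. if l = j then ?Z i l else ?a i l)) =
      (\<Sum>j<n. z0 j * C \<gamma>0 j + z1 j * C \<gamma>1 j + z2 j * C \<gamma>2 j)"
    by (intro sum.cong refl cols) simp
  finally show ?thesis by (rule sym)
qed

lemma sum_of_nat_lessThan: "(\<Sum>i<n. real i) = real n * (real n - 1) / 2"
  by (induction n) (auto simp: field_simps)

context
  fixes n :: nat and \<mu> :: "nat \<Rightarrow> real" and a0 a1 a2 u0 u1 u2 :: real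
    and H :: "(nat \<Rightarrow> nat) \<Rightarrow> (nat \<Rightarrow> nat) \<Rightarrow> real" and F :: "(nat \<Rightarrow> nat) \<Rightarrow> real"
    and S :: "nat \<Rightarrow> ((nat \<Rightarrow> nat) \<Rightarrow> real) \<Rightarrow> (nat \<Rightarrow> nat) \<Rightarrow> real" and e :: "nat \<Rightarrow> nat"
  assumes n: "n \<ge> 1"
    and moments: "\<And>k. a0 * real k * \<mu> (k - 1) + (a1 * (real k + 1) + u0) * \<mu> k +
      (a2 * (real k + 2) + u1) * \<mu> (k + 1) + u2 * \<mu> (k + 2) = 0"
  defines "H \<equiv> hankel_minor n \<mu>" and "F \<equiv> \<lambda>r. hankel_minor n \<mu> r (\<lambda>i. i)"
    and "S \<equiv> shift n" and "e \<equiv> \<lambda>i. i"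
begin

lemma id_update_self: "e(i := i) = e"
  by (auto simp: e_def)

lemma hankel_rows_eq: "F r = H r e" and hankel_cols_eq: "F r = H e r"
  unfolding F_def H_def e_def by (rule refl, rule hankel_minor_commute)

lemma shift_cols: "S k (H r) e = S k F r"
  unfolding S_def H_def F_def e_def shift_hankel_rows_eq_cols ..

text \<open>Raising a row other than the last by one duplicates the next row, so only the weight of
  the last row matters.\<close>

lemma weighted_shift_row:
  "(\<Sum>i<n. h i * H (e(i := i + 1)) c) = h (n - 1) * (\<Sum>i<n. H (e(i := i + 1)) c)"
proof -
  have "h i * H (e(i := i + 1)) c = h (n - 1) * H (e(i := i + 1)) c" if "i < n" for i
  proof (cases "i = n - 1")
    case False
    then have "H (e(i := i + 1)) c = 0"
      unfolding H_def using that by (intro hankel_minor_eq_rows[of i n "i + 1"]) (auto simp: e_def)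
    then show ?thesis by simp
  qed simp
  then show ?thesis unfolding sum_distrib_left by (intro sum.cong) auto
qed

lemma weighted_shift_col:
  "(\<Sum>i<n. h i * H r (e(i := i + 1))) = h (n - 1) * (\<Sum>i<n. H r (e(i := i + 1)))"
  using weighted_shift_row[of h r] by (simp add: H_def hankel_minor_commute[of n \<mu> r])

text \<open>A lowered row duplicates its predecessor; at i = 0, where truncated subtraction leaves
  the row in place, the factor \<open>real i\<close> vanishes.\<close>

lemma lowered_row: "real i * H (e(i := i - 1)) c = 0" if "i < n"
proof (cases "i = 0")
  case False
  then show ?thesis
    unfolding H_def using that by (simp add: hankel_minor_eq_rows[of i n "i - 1"] e_def)
qed simp

lemma lowered_col: "real i * H r (e(i := i - 1)) = 0" if "i < n"
  using lowered_row[OF that, of r] by (simp add: H_def hankel_minor_commute[of n \<mu> r])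

lemma sum_shifted_minors: "(\<Sum>i<n. H (e(i := i + k)) e) = S k F e" "(\<Sum>i<n. H e (e(i := i + k))) = S k F e"
  by (simp_all add: S_def shift_def hankel_rows_eq[symmetric] hankel_cols_eq[symmetric]) (simp_all add: e_def)

text \<open>In the application \<open>u0\<close>, \<open>u1\<close>, \<open>u2\<close> are
  \<open>a0 * x - b0\<close>, \<open>a1 * x - b1\<close>, \<open>a2 * x - b2\<close>. The recursion
  is taken at index i + j, with the constant parts of its coefficients charged to the rows. The
  \<open>a1\<close> weights i + 1 on rows and j on columns add up to n^2; of the \<open>a2\<close>
  weights only those of the last row and column survive, n + 1 and n - 1.\<close>

lemma virasoro_0:
  "u2 * S 2 F e + (u1 + 2 * real n * a2) * S 1 F e + (real n * u0 + a1 * (real n)\<^sup>2) * F e = 0"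
proof -
  let ?R = "\<lambda>\<rho> i. H (e(i := \<rho> i)) e" and ?C = "\<lambda>\<gamma> j. H e (e(j := \<gamma> j))"
  have "(\<Sum>i<n. (a0 * real i) * ?R (\<lambda>i. i - 1) i + (a1 * (real i + 1) + u0) * ?R (\<lambda>i. i) i +
        (a2 * (real i + 2) + u1) * ?R (\<lambda>i. i + 1) i + u2 * ?R (\<lambda>i. i + 2) i) +
      (\<Sum>j<n. (a0 * real j) * ?C (\<lambda>j. j - 1) j + (a1 * real j) * ?C (\<lambda>j. j) j + (a2 * real j) * ?C (\<lambda>j. j + 1) j) = 0"
    unfolding H_def
  proof (rule ward_identity)
    fix i j
    show "a0 * real i * \<mu> (i - 1 + e j) + (a1 * (real i + 1) + u0) * \<mu> (i + e j) +
        (a2 * (real i + 2) + u1) * \<mu> (i + 1 + e j) + u2 * \<mu> (i + 2 + e j) +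
        a0 * real j * \<mu> (e i + (j - 1)) + a1 * real j * \<mu> (e i + j) + a2 * real j * \<mu> (e i + (j + 1)) = 0"
      \<comment> \<open>The case split is for the truncated \<open>i - 1\<close> and
        \<open>j - 1\<close>, whose coefficients vanish at 0.\<close>
      using moments[of "i + j"] by (cases i; cases j) (simp_all add: e_def algebra_simps)
  qed
  also have "(\<Sum>i<n. (a0 * real i) * ?R (\<lambda>i. i - 1) i + (a1 * (real i + 1) + u0) * ?R (\<lambda>i. i) i +
        (a2 * (real i + 2) + u1) * ?R (\<lambda>i. i + 1) i + u2 * ?R (\<lambda>i. i + 2) i) =
      (\<Sum>i<n. (a1 * (real i + 1) + u0) * F e + (a2 * (real i + 2) + u1) * ?R (\<lambda>i. i + 1) i + u2 * ?R (\<lambda>i. i + 2) i)"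
    using lowered_row by (intro sum.cong refl) (simp add: hankel_rows_eq id_update_self mult.assoc del: mult_eq_0_iff)
  also have "(\<Sum>j<n. (a0 * real j) * ?C (\<lambda>j. j - 1) j + (a1 * real j) * ?C (\<lambda>j. j) j + (a2 * real j) * ?C (\<lambda>j. j + 1) j) =
      (\<Sum>j<n. (a1 * real j) * F e + (a2 * real j) * ?C (\<lambda>j. j + 1) j)"
    using lowered_col by (intro sum.cong refl) (simp add: hankel_rows_eq id_update_self mult.assoc del: mult_eq_0_iff)
  finally have "(\<Sum>i<n. (a1 * (real i + 1) + u0) * F e + (a2 * (real i + 2) + u1) * ?R (\<lambda>i. i + 1) i + u2 * ?R (\<lambda>i. i + 2) i) +
      (\<Sum>j<n. (a1 * real j) * F e + (a2 * real j) * ?C (\<lambda>j. j + 1) j) = 0" .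
  then have "(\<Sum>i<n. a1 * (real i + 1) + u0) * F e + (\<Sum>i<n. (a2 * (real i + 2) + u1) * ?R (\<lambda>i. i + 1) i) + u2 * S 2 F e +
      (\<Sum>j<n. a1 * real j) * F e + (\<Sum>j<n. (a2 * real j) * ?C (\<lambda>j. j + 1) j) = 0"
    by (simp only: sum.distrib sum_distrib_right[symmetric] sum_distrib_left[symmetric] sum_shifted_minors add.assoc)
  then show ?thesis
    unfolding weighted_shift_row weighted_shift_col sum_shifted_minors
    using n by (simp add: sum.distrib sum_distrib_left[symmetric] sum_of_nat_lessThan)
      (simp add: algebra_simps power2_eq_square of_nat_diff)
qed

text \<open>A shift by two leaves the last two rows, with weights n - 2 and n - 1. If p and q are
  the two determinants, then \<open>S 2 F e\<close> is p + q and \<open>S 1 (S 1 F) e\<close> is q -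
  p, from which the weighted sum is recovered.\<close>

lemma weighted_shift_2:
  "2 * (\<Sum>i<n. real i * F (e(i := i + 2))) = (2 * real n - 3) * S 2 F e + S 1 (S 1 F) e"
proof (cases "n = 1")
  case True
  then show ?thesis by (simp add: S_def shift_def e_def numeral_2_eq_2)
next
  case False
  then obtain m where m: "n = Suc (Suc m)" using n by (metis One_nat_def not0_implies_Suc not_one_le_zero)
  have F: "alternating n F" unfolding F_def by (rule alternating_hankel_minor)
  have z: "F (e(i := i + 2)) = 0" if "i < m" for i
    using that m by (intro alternating_eq_0[OF F, of i "i + 2"]) (auto simp: e_def)
  have S2: "S 2 F e = F (e(m := m + 2)) + F (e(Suc m := m + 3))"
    unfolding S_def shift_def m using z by (simp add: e_def eval_nat_numeral)
  have lhs: "(\<Sum>i<n. real i * F (e(i := i + 2))) = real m * F (e(m := m + 2)) + (real m + 1) * F (e(Suc m := m + 3))"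
    unfolding m using z by (simp add: eval_nat_numeral)
  have z1: "S 1 F (e(i := i + 1)) = 0" if "i < Suc m" for i
    unfolding S_def using that m
    by (intro alternating_eq_0[OF alternating_shift[OF F], of i "i + 1"]) (auto simp: e_def)
  let ?e1 = "e(Suc m := m + 2)"
  have z2: "F (?e1(i := i + 1)) = 0" if "i < m" for i
    using that m by (intro alternating_eq_0[OF F, of i "i + 1"]) (auto simp: e_def)
  have "S 1 (S 1 F) e = S 1 F ?e1"
    using z1 m by (subst S_def) (simp add: shift_def e_def)
  also have "\<dots> = F (?e1(m := m + 1)) + F (e(Suc m := m + 3))"
    unfolding S_def shift_def m using z2 by (simp add: e_def eval_nat_numeral)
  \<comment> \<open>Here positions m and m + 1 hold the rows m + 1 and m + 2, the same as in
    \<open>e(m := m + 2)\<close> but in the opposite order.\<close>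
  also have "F (?e1(m := m + 1)) = - F (e(m := m + 2))"
  proof -
    have "?e1(m := m + 1) = (e(m := m + 2))(m := (e(m := m + 2)) (Suc m), Suc m := (e(m := m + 2)) m)"
      by (auto simp: e_def)
    then show ?thesis using alternatingD[OF F, of m "Suc m" "e(m := m + 2)"] m by simp
  qed
  finally have "S 1 (S 1 F) e = - F (e(m := m + 2)) + F (e(Suc m := m + 3))" .
  moreover have "real n = real m + 2" using m by simp
  moreover have "2 * (x * A + (x + 1) * B) = (2 * (x + 2) - 3) * (A + B) + (- A + B)" for x A B :: real
    by (simp add: algebra_simps)
  ultimately show ?thesis unfolding lhs S2 by (simp only:)
qed

text \<open>The recursion at index i + j + 1, split as i + 1 on rows and j on columns. The weighted
  shift by two occurs on both sides, and \<open>weighted_shift_2\<close> is the source of the term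
  \<open>S 1 (S 1 F) e\<close>.\<close>

lemma virasoro_1:
  "u2 * S 3 F e + u1 * S 2 F e + u0 * S 1 F e + a0 * (real n)\<^sup>2 * F e + 2 * real n * a1 * S 1 F e +
    a2 * (2 * real n * S 2 F e + S 1 (S 1 F) e) = 0"
proof -
  let ?R = "\<lambda>\<rho> i. H (e(i := \<rho> i)) e" and ?C = "\<lambda>\<gamma> j. H e (e(j := \<gamma> j))"
  have "(\<Sum>i<n. (a0 * (real i + 1)) * ?R (\<lambda>i. i) i + (a1 * (real i + 2) + u0) * ?R (\<lambda>i. i + 1) i +
        (a2 * (real i + 3) + u1) * ?R (\<lambda>i. i + 2) i + u2 * ?R (\<lambda>i. i + 3) i) +
      (\<Sum>j<n. (a0 * real j) * ?C (\<lambda>j. j) j + (a1 * real j) * ?C (\<lambda>j. j + 1) j + (a2 * real j) * ?C (\<lambda>j. j + 2) j) = 0"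
    unfolding H_def
  proof (rule ward_identity)
    fix i j
    show "a0 * (real i + 1) * \<mu> (i + e j) + (a1 * (real i + 2) + u0) * \<mu> (i + 1 + e j) +
        (a2 * (real i + 3) + u1) * \<mu> (i + 2 + e j) + u2 * \<mu> (i + 3 + e j) +
        a0 * real j * \<mu> (e i + j) + a1 * real j * \<mu> (e i + (j + 1)) + a2 * real j * \<mu> (e i + (j + 2)) = 0"
      using moments[of "i + j + 1"] by (simp add: e_def algebra_simps eval_nat_numeral)
  qed
  then have "(\<Sum>i<n. a0 * (real i + 1)) * F e + (\<Sum>i<n. (a1 * (real i + 2) + u0) * ?R (\<lambda>i. i + 1) i) +
      a2 * (\<Sum>i<n. real i * F (e(i := i + 2))) + (3 * a2 + u1) * S 2 F e + u2 * S 3 F e +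
      (\<Sum>j<n. a0 * real j) * F e + (\<Sum>j<n. (a1 * real j) * ?C (\<lambda>j. j + 1) j) +
      a2 * (\<Sum>j<n. real j * F (e(j := j + 2))) = 0"
    unfolding sum.distrib
    by (simp add: id_update_self sum_distrib_right sum_distrib_left sum_shifted_minors[symmetric] hankel_rows_eq[symmetric] hankel_cols_eq[symmetric])
      (simp add: sum.distrib sum_distrib_left algebra_simps)
  then show ?thesis
    unfolding weighted_shift_row weighted_shift_col sum_shifted_minors
    using n weighted_shift_2
    by (simp add: sum.distrib sum_distrib_left[symmetric] sum_of_nat_lessThan)
      (simp add: algebra_simps power2_eq_square of_nat_diff)
qed

text \<open>Inserting \<open>p\<^sub>2\<close> is not a derivative in x, so it has to be done before
  the recursion is summed: the columns are \<open>?c k\<close>, the identity with column k raised by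
  two, and the results are added over k. The raised column has weight k + 2 in place of k, and this
  excess produces \<open>2 * a0\<close>, the extra \<open>2 * a1\<close> and
  \<open>2 * a2\<close>.\<close>

lemma virasoro_0_squared:
  "u2 * S 2 (S 2 F) e + (u1 + 2 * real n * a2) * S 2 (S 1 F) e +
    (real n * u0 + a1 * ((real n)\<^sup>2 + 2)) * S 2 F e + 2 * a0 * S 1 F e + 2 * a2 * S 3 F e = 0"
proof -
  let ?c = "\<lambda>k. e(k := k + 2)"
  have cs: "(\<Sum>k<n. H (e(i := i + l)) (?c k)) = S 2 F (e(i := i + l))" for i l
    using shift_cols[of 2 "e(i := i + l)"] by (simp add: S_def shift_def e_def)
  have main: "(\<Sum>i<n. (a1 * (real i + 1) + u0) * H e (?c k) +
        (a2 * (real i + 2) + u1) * H (e(i := i + 1)) (?c k) + u2 * H (e(i := i + 2)) (?c k)) +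
      (\<Sum>j<n. (a0 * real (?c k j)) * H e ((?c k)(j := ?c k j - 1)) + (a1 * real (?c k j)) * H e (?c k) +
        (a2 * real (?c k j)) * H e ((?c k)(j := ?c k j + 1))) = 0" for k
  proof -
    have "(\<Sum>i<n. (a0 * real i) * H (e(i := i - 1)) (?c k) + (a1 * (real i + 1) + u0) * H (e(i := i)) (?c k) +
        (a2 * (real i + 2) + u1) * H (e(i := i + 1)) (?c k) + u2 * H (e(i := i + 2)) (?c k)) +
      (\<Sum>j<n. (a0 * real (?c k j)) * H e ((?c k)(j := ?c k j - 1)) + (a1 * real (?c k j)) * H e ((?c k)(j := ?c k j)) +
        (a2 * real (?c k j)) * H e ((?c k)(j := ?c k j + 1))) = 0"
      unfolding H_def
    proof (rule ward_identity)
      fix i j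
      show "a0 * real i * \<mu> (i - 1 + ?c k j) + (a1 * (real i + 1) + u0) * \<mu> (i + ?c k j) +
          (a2 * (real i + 2) + u1) * \<mu> (i + 1 + ?c k j) + u2 * \<mu> (i + 2 + ?c k j) +
          a0 * real (?c k j) * \<mu> (e i + (?c k j - 1)) + a1 * real (?c k j) * \<mu> (e i + ?c k j) +
          a2 * real (?c k j) * \<mu> (e i + (?c k j + 1)) = 0"
        using moments[of "i + ?c k j"] by (cases i; cases "?c k j") (simp_all add: e_def algebra_simps)
    qed
    also have "(\<Sum>i<n. (a0 * real i) * H (e(i := i - 1)) (?c k) + (a1 * (real i + 1) + u0) * H (e(i := i)) (?c k) +
          (a2 * (real i + 2) + u1) * H (e(i := i + 1)) (?c k) + u2 * H (e(i := i + 2)) (?c k)) =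
        (\<Sum>i<n. (a1 * (real i + 1) + u0) * H e (?c k) +
          (a2 * (real i + 2) + u1) * H (e(i := i + 1)) (?c k) + u2 * H (e(i := i + 2)) (?c k))"
      using lowered_row by (intro sum.cong refl) (simp add: id_update_self mult.assoc del: mult_eq_0_iff)
    finally show ?thesis by (simp only: fun_upd_triv)
  qed
  then have "0 = (\<Sum>k<n. (\<Sum>i<n. (a1 * (real i + 1) + u0) * H e (?c k) +
        (a2 * (real i + 2) + u1) * H (e(i := i + 1)) (?c k) + u2 * H (e(i := i + 2)) (?c k)) +
      (\<Sum>j<n. (a0 * real (?c k j)) * H e ((?c k)(j := ?c k j - 1)) + (a1 * real (?c k j)) * H e (?c k) +
        (a2 * real (?c k j)) * H e ((?c k)(j := ?c k j + 1))))"
    by (simp only: main sum.neutral_const)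
  also have "\<dots> = (\<Sum>k<n. \<Sum>i<n. (a1 * (real i + 1) + u0) * H e (?c k)) +
      (\<Sum>i<n. (a2 * (real i + 2) + u1) * (\<Sum>k<n. H (e(i := i + 1)) (?c k))) +
      u2 * (\<Sum>i<n. \<Sum>k<n. H (e(i := i + 2)) (?c k)) +
      a0 * (\<Sum>k<n. \<Sum>j<n. real (?c k j) * H e ((?c k)(j := ?c k j - 1))) +
      (\<Sum>k<n. \<Sum>j<n. (a1 * real (?c k j)) * H e (?c k)) +
      a2 * (\<Sum>k<n. \<Sum>j<n. real (?c k j) * H e ((?c k)(j := ?c k j + 1)))"
  proof -
    have sw: "(\<Sum>i<n. h i * (\<Sum>k<n. H (e(i := i + l)) (?c k))) = (\<Sum>k<n. \<Sum>i<n. h i * H (e(i := i + l)) (?c k))" for h l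
      unfolding sum_distrib_left by (rule sum.swap)
    show ?thesis
      using sw[of _ 1] sw[of "\<lambda>_. u2" 2]
      by (simp add: sum.distrib sum_distrib_left mult.assoc)
  qed
  also have "(\<Sum>i<n. (a2 * (real i + 2) + u1) * (\<Sum>k<n. H (e(i := i + 1)) (?c k))) =
      (\<Sum>i<n. (a2 * (real i + 2) + u1) * S 2 F (e(i := i + 1)))"
    by (simp only: cs)
  also have "u2 * (\<Sum>i<n. \<Sum>k<n. H (e(i := i + 2)) (?c k)) = u2 * S 2 (S 2 F) e"
    unfolding cs by (simp add: S_def shift_def e_def)
  also have "(\<Sum>k<n. \<Sum>j<n. real (?c k j) * H e ((?c k)(j := ?c k j - 1))) = 2 * S 1 F e"
  proof -
    \<comment> \<open>The weight is j plus an excess of two at j = k. For the first part, trading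
      the column shift for a row shift exposes a lowered column, so it vanishes; the excess gives
      \<open>2 * S 1 F e\<close>.\<close>
    have t: "real (?c k j) * H e ((?c k)(j := ?c k j - 1)) =
        real j * H e ((e(j := j - 1))(k := (e(j := j - 1)) k + 2)) + (if j = k then 2 * H e (e(k := k + 1)) else 0)"
      for j k by (cases j) (auto simp: e_def fun_upd_twist algebra_simps)
    have "(\<Sum>k<n. real j * H e ((e(j := j - 1))(k := (e(j := j - 1)) k + 2))) = 0" if "j < n" for j
    proof -
      have "(\<Sum>k<n. real j * H e ((e(j := j - 1))(k := (e(j := j - 1)) k + 2))) =
          real j * S 2 (\<lambda>r. H r (e(j := j - 1))) e"
        unfolding S_def H_def shift_hankel_rows_eq_cols by (simp add: shift_def sum_distrib_left)
      also have "\<dots> = (\<Sum>i<n. real j * H (e(i := i + 2)) (e(j := j - 1)))"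
        by (simp add: S_def shift_def sum_distrib_left) (simp add: e_def)
      also have "\<dots> = 0" by (intro sum.neutral ballI lowered_col that)
      finally show ?thesis .
    qed
    then have "(\<Sum>k<n. \<Sum>j<n. real j * H e ((e(j := j - 1))(k := (e(j := j - 1)) k + 2))) = 0"
      by (subst sum.swap) simp
    then show ?thesis
      unfolding t sum.distrib using sum_shifted_minors(2)[of 1] by (simp add: sum_distrib_left[symmetric])
  qed
  also have "(\<Sum>k<n. \<Sum>j<n. real (?c k j) * H e ((?c k)(j := ?c k j + 1))) =
      (real n - 1) * S 2 (S 1 F) e + 2 * S 3 F e"
  proof -
    have t: "real (?c k j) * H e ((?c k)(j := ?c k j + 1)) =
        real j * H e ((e(j := j + 1))(k := (e(j := j + 1)) k + 2)) + (if j = k then 2 * H e (e(k := k + 3)) else 0)"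
      for j k by (auto simp: e_def fun_upd_twist algebra_simps eval_nat_numeral)
    \<comment> \<open>Moving the shift by two to the rows leaves columns in which only j is raised,
      the form that \<open>weighted_shift_col\<close> requires.\<close>
    have s: "(\<Sum>k<n. real j * H e ((e(j := j + 1))(k := (e(j := j + 1)) k + 2))) =
        (\<Sum>i<n. real j * H (e(i := i + 2)) (e(j := j + 1)))" for j
    proof -
      have "(\<Sum>k<n. real j * H e ((e(j := j + 1))(k := (e(j := j + 1)) k + 2))) =
          real j * S 2 (\<lambda>r. H r (e(j := j + 1))) e"
        unfolding S_def H_def shift_hankel_rows_eq_cols by (simp add: shift_def sum_distrib_left)
      also have "\<dots> = (\<Sum>i<n. real j * H (e(i := i + 2)) (e(j := j + 1)))"
        by (simp add: S_def shift_def sum_distrib_left) (simp add: e_def)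
      finally show ?thesis .
    qed
    have "(\<Sum>k<n. \<Sum>j<n. real j * H e ((e(j := j + 1))(k := (e(j := j + 1)) k + 2))) =
        (\<Sum>j<n. \<Sum>i<n. real j * H (e(i := i + 2)) (e(j := j + 1)))"
      by (subst sum.swap) (simp only: s)
    also have "\<dots> = (\<Sum>i<n. \<Sum>j<n. real j * H (e(i := i + 2)) (e(j := j + 1)))"
      by (rule sum.swap)
    also have "\<dots> = real (n - 1) * (\<Sum>i<n. S 1 F (e(i := i + 2)))"
      unfolding weighted_shift_col sum_distrib_left[symmetric]
      using shift_cols[of 1] by (simp add: S_def shift_def e_def)
    also have "(\<Sum>i<n. S 1 F (e(i := i + 2))) = S 2 (S 1 F) e"
      by (simp add: S_def shift_def e_def)
    finally have s': "(\<Sum>k<n. \<Sum>j<n. real j * H e ((e(j := j + 1))(k := (e(j := j + 1)) k + 2))) =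
        real (n - 1) * S 2 (S 1 F) e" .
    show ?thesis
      unfolding t sum.distrib s' using sum_shifted_minors(2)[of 3] n
      by (simp add: sum_distrib_left[symmetric] of_nat_diff)
  qed
  also have "(\<Sum>k<n. \<Sum>i<n. (a1 * (real i + 1) + u0) * H e (?c k)) =
      (\<Sum>i<n. a1 * (real i + 1) + u0) * S 2 F e"
    unfolding sum_shifted_minors(2)[symmetric] sum_product by (rule sum.swap)
  also have "(\<Sum>k<n. \<Sum>j<n. (a1 * real (?c k j)) * H e (?c k)) = a1 * (real n * (real n - 1) / 2 + 2) * S 2 F e"
  proof -
    have "(\<Sum>j<n. a1 * real (?c k j)) = a1 * (real n * (real n - 1) / 2 + 2)" if "k < n" for k
    proof -
      have "real (?c k j) = real j + (if j = k then 2 else 0)" for j by (simp add: e_def)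
      then show ?thesis
        using that by (simp only: sum_distrib_left[symmetric] sum.distrib sum_of_nat_lessThan) simp
    qed
    then show ?thesis
      unfolding sum_distrib_right[symmetric] sum_shifted_minors(2)[symmetric] sum_distrib_left by (intro sum.cong) auto
  qed
  also have "(\<Sum>i<n. (a2 * (real i + 2) + u1) * S 2 F (e(i := i + 1))) =
      (a2 * (real n + 1) + u1) * S 2 (S 1 F) e"
  proof -
    have "(\<Sum>i<n. (a2 * (real i + 2) + u1) * S 2 F (e(i := i + 1))) =
        (\<Sum>i<n. (a2 * (real i + 2) + u1) * (\<Sum>k<n. H (e(i := i + 1)) (?c k)))"
      unfolding shift_cols[symmetric] by (simp add: S_def shift_def e_def)
    also have "\<dots> = (\<Sum>k<n. \<Sum>i<n. (a2 * (real i + 2) + u1) * H (e(i := i + 1)) (?c k))"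
      unfolding sum_distrib_left by (rule sum.swap)
    also have "\<dots> = (a2 * (real (n - 1) + 2) + u1) * (\<Sum>k<n. \<Sum>i<n. H (e(i := i + 1)) (?c k))"
      by (simp only: weighted_shift_row) (simp only: sum_distrib_left)
    also have "(\<Sum>k<n. \<Sum>i<n. H (e(i := i + 1)) (?c k)) = S 1 (S 2 F) e"
    proof -
      have "(\<Sum>k<n. \<Sum>i<n. H (e(i := i + 1)) (?c k)) = (\<Sum>i<n. S 2 (H (e(i := i + 1))) e)"
        by (subst sum.swap) (simp add: S_def shift_def e_def)
      then show ?thesis unfolding shift_cols by (simp add: S_def shift_def e_def)
    qed
    also have "\<dots> = S 2 (S 1 F) e" unfolding S_def by (rule shift_commute)
    finally show ?thesis using n by (simp add: of_nat_diff add.commute del: fun_upd_apply)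
  qed
  finally show ?thesis
    using n by (simp add: sum.distrib sum_distrib_left[symmetric] sum_of_nat_lessThan)
      (simp add: algebra_simps power2_eq_square)
qed

end

section \<open>The third order equation\<close>

text \<open>
  \<open>Q, W, V, dQ, dW, h2, h3\<close> stand for the averages of \<open>p\<^sub>2, p\<^sub>3, p\<^sub>2\<^sup>2, p\<^sub>1 * p\<^sub>2, p\<^sub>1 * p\<^sub>3, p\<^sub>1\<^sup>2, p\<^sub>1\<^sup>3\<close>,
  and \<open>g\<close> for that of \<open>p\<^sub>1\<close>.
\<close>

lemma third_order_ode_of_relations:
  fixes n :: nat and a0 a1 a2 b0 b1 b2 x g g1 g2 g3 Q dQ W dW V :: real
  defines "y \<equiv> a2 * x - b2" and "B \<equiv> a1 * x - b1 + 2 * real n * a2"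
    and "C \<equiv> real n * (a0 * x - b0) + a1 * (real n)\<^sup>2" and "h2 \<equiv> g1 + g\<^sup>2" and "h3 \<equiv> g2 + 3 * g * g1 + g ^ 3"
  assumes y: "y \<noteq> 0"
    and kp: "g3 + 6 * g1\<^sup>2 + 3 * (V - Q\<^sup>2) - 4 * (dW - g * W) = 0"
    and Q: "y * Q + B * g + C = 0"
    and dQ: "y * dQ + a2 * Q + B * h2 + a1 * g + C * g + real n * a0 = 0"
    and W: "y * W + (a1 * x - b1) * Q + (a0 * x - b0) * g + a0 * (real n)\<^sup>2 + 2 * real n * a1 * g +
      a2 * (2 * real n * Q + h2) = 0"
    and dW: "y * dW + a2 * W + (a1 * x - b1) * dQ + a1 * Q + (a0 * x - b0) * h2 + a0 * g +
      a0 * (real n)\<^sup>2 * g + 2 * real n * a1 * h2 + a2 * (2 * real n * dQ + h3) = 0"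
    and V: "y * V + B * dQ + (C + 2 * a1) * Q + 2 * a0 * g + 2 * a2 * W = 0"
  shows "g3 + 6 * g1\<^sup>2 + 4 * a2 * (g2 + 2 * g * g1) / y + (2 * a2\<^sup>2 * g\<^sup>2 + P2 n a0 a1 a2 b0 b1 b2 x * g1) / y\<^sup>2
    + (P1 n a0 a1 a2 b0 b1 b2 x * g - real n * Q1 n a0 a1 a2 b0 b1 b2 x) / y ^ 3 = 0"
proof -
  \<comment> \<open>Each unknown is multiplied by the power of \<open>y\<close> that makes it
    polynomial in the data: 1 for \<open>Q\<close>, 2 for \<open>dQ\<close> and \<open>W\<close>, 3
    for \<open>dW\<close> and \<open>V\<close>. The only division comes at the end.\<close>
  have 1: "y * Q = - (B * g + C)" using Q by Groebner_Basis.algebra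
  have 2: "y\<^sup>2 * dQ = - (a2 * (y * Q) + y * (B * h2 + a1 * g + C * g + real n * a0))"
    using dQ by Groebner_Basis.algebra
  have 3: "y\<^sup>2 * W = - (B * (y * Q) + y * ((a0 * x - b0) * g + a0 * (real n)\<^sup>2 + 2 * real n * a1 * g + a2 * h2))"
    using W unfolding B_def by Groebner_Basis.algebra
  have 4: "y ^ 3 * dW = - (a2 * (y\<^sup>2 * W) + B * (y\<^sup>2 * dQ) + a1 * y * (y * Q) +
      y\<^sup>2 * ((a0 * x - b0) * h2 + a0 * g + a0 * (real n)\<^sup>2 * g + 2 * real n * a1 * h2 + a2 * h3))"
    using dW unfolding B_def by Groebner_Basis.algebra
  have 5: "y ^ 3 * V = - (B * (y\<^sup>2 * dQ) + (C + 2 * a1) * y * (y * Q) + y\<^sup>2 * (2 * a0 * g) + 2 * a2 * (y\<^sup>2 * W))"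
    using V by Groebner_Basis.algebra
  have 6: "y ^ 3 * (g3 + 6 * g1\<^sup>2) = - 3 * (y ^ 3 * V) + 3 * y * (y * Q)\<^sup>2 + 4 * (y ^ 3 * dW) - 4 * y * g * (y\<^sup>2 * W)"
    using kp by Groebner_Basis.algebra
  have "y ^ 3 * (g3 + 6 * g1\<^sup>2) + y\<^sup>2 * (4 * a2 * (g2 + 2 * g * g1)) + y * (2 * a2\<^sup>2 * g\<^sup>2 + P2 n a0 a1 a2 b0 b1 b2 x * g1)
    + (P1 n a0 a1 a2 b0 b1 b2 x * g - real n * Q1 n a0 a1 a2 b0 b1 b2 x) = 0"
    unfolding 6 5 4 3 2 1
    unfolding P1_def P2_def Q1_def y_def B_def C_def h2_def h3_def by Groebner_Basis.algebra
  moreover have "g3 + 6 * g1\<^sup>2 + c1 / y + c2 / y\<^sup>2 + c3 / y ^ 3 =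
      (y ^ 3 * (g3 + 6 * g1\<^sup>2) + y\<^sup>2 * c1 + y * c2 + c3) / y ^ 3" for c1 c2 c3
    using y by (simp add: field_simps power2_eq_square power3_eq_cube)
  ultimately show ?thesis by (simp only: div_0)
qed

section \<open>Painleve V\<close>

text \<open>Turns a chain of explicit derivatives into values of the iterated \<open>deriv\<close>;
  the set is open because \<open>deriv\<close> at a point depends on a neighbourhood.\<close>

lemma funpow_deriv_eqI:
  assumes "open S" "x \<in> S" "j \<le> m"
    and "\<And>i z. i < m \<Longrightarrow> z \<in> S \<Longrightarrow> (F i has_real_derivative F (Suc i) z) (at z)"
  shows "(deriv ^^ j) (F 0) x = F j x"
  using assms(2,3)
proof (induction j arbitrary: x)
  case (Suc j)
  have "eventually (\<lambda>z. (deriv ^^ j) (F 0) z = F j z) (nhds x)"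
    using eventually_nhds_in_open[OF assms(1) Suc.prems(1)] by eventually_elim (use Suc in auto)
  then have "deriv ((deriv ^^ j) (F 0)) x = deriv (F j) x"
    by (intro deriv_cong_ev refl)
  also have "\<dots> = F (Suc j) x"
    using assms(4) Suc.prems by (intro DERIV_imp_deriv) auto
  finally show ?case by simp
qed simp

lemma times_differentiable_onI:
  assumes "open S"
    and "\<And>i z. i < m \<Longrightarrow> z \<in> S \<Longrightarrow> (F i has_real_derivative F (Suc i) z) (at z)"
  shows "times_differentiable_on m (F 0) S"
  unfolding times_differentiable_on_def
proof (intro allI impI ballI)
  fix j x assume j: "j < m" and x: "x \<in> S"
  have "(F j has_real_derivative F (Suc j) x) (at x)" using assms(2) j x by simp
  then have "((deriv ^^ j) (F 0) has_real_derivative F (Suc j) x) (at x)"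
  proof (rule has_field_derivative_transform_within_open[OF _ assms(1) x])
    fix z assume "z \<in> S"
    then show "F j z = (deriv ^^ j) (F 0) z"
      using funpow_deriv_eqI[of S z j m F] assms j by simp
  qed
  then show "(deriv ^^ j) (F 0) differentiable (at x)" unfolding real_differentiable_def by blast
qed

lemma painleve_transform_derivatives:
  fixes c \<alpha> \<beta> z :: real and h :: "real \<Rightarrow> real"
  assumes "open I" "times_differentiable_on 3 h I"
    and J_def: "J = (\<lambda>x. x - c) ` I" and G_def: "G = painleve_transform c \<alpha> \<beta> h"
  defines "h1 \<equiv> deriv h" and "h2 \<equiv> (deriv ^^ 2) h" and "h3 \<equiv> (deriv ^^ 3) h"
  shows "open J" "times_differentiable_on 2 G J"
    and "z \<in> J \<Longrightarrow> (G has_real_derivative h (z + c) + z * h1 (z + c) + \<alpha>) (at z)"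
    and "z \<in> J \<Longrightarrow> deriv G z = h (z + c) + z * h1 (z + c) + \<alpha>"
    and "z \<in> J \<Longrightarrow> (deriv ^^ 2) G z = 2 * h1 (z + c) + z * h2 (z + c)"
    and "z \<in> J \<Longrightarrow> ((\<lambda>z. h (z + c) + z * h1 (z + c) + \<alpha>) has_real_derivative 2 * h1 (z + c) + z * h2 (z + c)) (at z)"
    and "z \<in> J \<Longrightarrow> ((\<lambda>z. 2 * h1 (z + c) + z * h2 (z + c)) has_real_derivative 3 * h2 (z + c) + z * h3 (z + c)) (at z)"
proof -
  show J: "open J" unfolding J_def using assms(1) by (simp add: open_translation_subtract)
  have D: "((deriv ^^ j) h has_real_derivative (deriv ^^ Suc j) h (z + c)) (at (z + c))"
    if "z \<in> J" "j < 3" for j z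
  proof -
    have "z + c \<in> I" using that by (auto simp: J_def)
    then have "(deriv ^^ j) h differentiable (at (z + c))"
      using assms(2) that by (auto simp: times_differentiable_on_def)
    then show ?thesis by (simp add: DERIV_deriv_iff_real_differentiable)
  qed
  have D': "((\<lambda>z. (deriv ^^ j) h (z + c)) has_real_derivative (deriv ^^ Suc j) h (z + c)) (at z)"
    if "z \<in> J" "j < 3" for j z
    using D[OF that] by (simp add: DERIV_shift)
  have d: "((\<lambda>z. h (z + c)) has_real_derivative h1 (z + c)) (at z)"
    "((\<lambda>z. h1 (z + c)) has_real_derivative h2 (z + c)) (at z)"
    "((\<lambda>z. h2 (z + c)) has_real_derivative h3 (z + c)) (at z)" if "z \<in> J" for z
    using D'[OF that, of 0] D'[OF that, of 1] D'[OF that, of 2]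
    unfolding h1_def h2_def h3_def by (simp_all add: eval_nat_numeral)
  let ?F = "\<lambda>i::nat. if i = 0 then G else if i = 1 then (\<lambda>z. h (z + c) + z * h1 (z + c) + \<alpha>)
    else (\<lambda>z. 2 * h1 (z + c) + z * h2 (z + c))"
  show 1: "(G has_real_derivative h (z + c) + z * h1 (z + c) + \<alpha>) (at z)" if "z \<in> J" for z
    unfolding G_def painleve_transform_def[abs_def]
    by (rule derivative_eq_intros d that refl | simp)+
  show 2: "((\<lambda>z. h (z + c) + z * h1 (z + c) + \<alpha>) has_real_derivative 2 * h1 (z + c) + z * h2 (z + c)) (at z)"
    if "z \<in> J" for z
    by (rule derivative_eq_intros d that refl | simp)+
  show "((\<lambda>z. 2 * h1 (z + c) + z * h2 (z + c)) has_real_derivative 3 * h2 (z + c) + z * h3 (z + c)) (at z)"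
    if "z \<in> J" for z
    by (rule derivative_eq_intros d that refl | simp)+
  have F: "(?F i has_real_derivative ?F (Suc i) z) (at z)" if "i < 2" "z \<in> J" for i z
    using that 1 2 by (cases i) (auto simp: less_Suc_eq)
  show "times_differentiable_on 2 G J" using times_differentiable_onI[of J 2 ?F] J F by simp
  show "deriv G z = h (z + c) + z * h1 (z + c) + \<alpha>" if "z \<in> J" for z
    using 1[OF that] by (rule DERIV_imp_deriv)
  show "(deriv ^^ 2) G z = 2 * h1 (z + c) + z * h2 (z + c)" if "z \<in> J" for z
    using funpow_deriv_eqI[of J z 2 2 ?F] J that F by simp
qed

text \<open>
  Multiplying the third order equation by \<open>(x - b2 / a2) ^ 3\<close> leaves an expression with
  quadratic coefficients in \<open>z = x - b2 / a2\<close>; it is the factor of \<open>2 * G''\<close> in the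
  derivative of the Painleve V equation.
\<close>

lemma third_order_transforms_into_painleve_V:
  assumes "a2 \<noteq> 0"
  shows "transforms_into_painleve_V n a0 a1 a2 b0 b1 b2"
proof -
  define c where "c = b2 / a2"
  \<comment> \<open>\<open>q2\<close>, \<open>q1\<close>, \<open>q0\<close> are the coefficients of
    \<open>P2\<close> in z after division by \<open>a2\<^sup>2\<close>, less a constant 2 that
    \<open>z\<^sup>2 * G3 z + z * G2 z\<close> supplies. After division by \<open>a2 ^ 3\<close>
    those of \<open>P1\<close> are \<open>q1 / 2\<close> and \<open>q0\<close>; this agreement lets
    a single pair \<open>\<alpha>\<close>, \<open>\<beta>\<close> match both polynomials.\<close>
  define q2 where "q2 = (4*a0*a2 - a1^2) / a2^2"
  define p1 where "p1 = 2 * (2*a1*a2*real n - 2*a0*b2 + a1*b1 - 2*a2*b0)"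
  define p0 where "p0 = - 4*a2^2*(real n)^2 - 4*(2*a1*b2 - a2*b1)*real n + 4*b0*b2 - b1^2"
  define q1 where "q1 = (2 * (4*a0*a2 - a1^2) * c + p1) / a2^2"
  define q0 where "q0 = ((4*a0*a2 - a1^2) * c^2 + p1 * c + p0) / a2^2"
  define k0 where "k0 = real n * Q1 n a0 a1 a2 b0 b1 b2 c / a2 ^ 3"
  define k1 where "k1 = real n * (2*a0*a2^2*real n - a1^2*a2*real n + a0*a1*b2 - 2*a0*a2*b1 + a1*a2*b0) / a2 ^ 3"
  \<comment> \<open>Comparing the terms linear in \<open>h\<close> and \<open>deriv h\<close> in
    \<open>Z\<close> below gives \<open>q1 = 8 * \<alpha>\<close> and
    \<open>q0 = - 4 * \<beta>\<close>. The leading coefficient of \<open>P2\<close> gives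
    \<open>- q2\<close> for the first Painleve constant, and the terms free of \<open>h\<close> give
    \<open>A2\<close> and \<open>A3\<close>.\<close>
  define \<alpha> where "\<alpha> = q1 / 8"
  define \<beta> where "\<beta> = - q0 / 4"
  define A2 where "A2 = 2 * (2 * \<alpha>\<^sup>2 - q2 * \<beta> + k1)"
  define A3 where "A3 = 2 * (k0 - 4 * \<alpha> * \<beta>)"
  have b2: "b2 = a2 * c" using assms by (simp add: c_def)
  have e: "a2\<^sup>2 * q2 = 4*a0*a2 - a1^2" "a2\<^sup>2 * q1 = 2 * (4*a0*a2 - a1^2) * c + p1"
      "a2\<^sup>2 * (q1 / 2) = (4*a0*a2 - a1^2) * c + (2*a1*a2*real n - 2*a0*b2 + a1*b1 - 2*a2*b0)"
      "a2\<^sup>2 * q0 = (4*a0*a2 - a1^2) * c^2 + p1 * c + p0"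
    using assms by (simp_all add: q2_def q1_def q0_def) (simp add: p1_def field_simps)
  have P2: "P2 n a0 a1 a2 b0 b1 b2 (z + c) = a2^2 * (q2 * z^2 + q1 * z + q0 + 2)" for z
  proof -
    have "a2^2 * (q2 * z^2 + q1 * z + q0 + 2) = a2\<^sup>2 * q2 * z^2 + a2\<^sup>2 * q1 * z + a2\<^sup>2 * q0 + 2 * a2^2"
      by (simp add: algebra_simps)
    then show ?thesis unfolding e P2_def p1_def p0_def by Groebner_Basis.algebra
  qed
  have P1: "P1 n a0 a1 a2 b0 b1 b2 (z + c) = a2^3 * (q1 / 2 * z + q0)" for z
  proof -
    have "a2^3 * (q1 / 2 * z + q0) = a2 * (a2\<^sup>2 * (q1 / 2) * z + a2\<^sup>2 * q0)"
      by (simp add: algebra_simps power2_eq_square power3_eq_cube)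
    then show ?thesis unfolding e P1_def p1_def p0_def b2 by Groebner_Basis.algebra
  qed
  have k: "a2^3 * k0 = real n * Q1 n a0 a1 a2 b0 b1 b2 c"
      "a2^3 * k1 = real n * (2*a0*a2^2*real n - a1^2*a2*real n + a0*a1*b2 - 2*a0*a2*b1 + a1*a2*b0)"
    using assms by (simp_all add: k0_def k1_def)
  have Q1: "real n * Q1 n a0 a1 a2 b0 b1 b2 (z + c) = a2^3 * (k1 * z + k0)" for z
  proof -
    have "a2^3 * (k1 * z + k0) = a2^3 * k1 * z + a2^3 * k0" by (simp add: algebra_simps)
    then show ?thesis unfolding k Q1_def by Groebner_Basis.algebra
  qed
  have "(solves_third_order_ode n a0 a1 a2 b0 b1 b2 I h \<longrightarrow> (\<exists>A4. solves_painleve_V (- q2) A2 A3 A4 J G)) \<and>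
      (times_differentiable_on 3 h I \<longrightarrow> (\<forall>z\<in>J. (deriv ^^ 2) G z \<noteq> 0) \<longrightarrow>
        (\<exists>A4. solves_painleve_V (- q2) A2 A3 A4 J G) \<longrightarrow> solves_third_order_ode n a0 a1 a2 b0 b1 b2 I h)"
    if I: "open I" "is_interval I" "\<forall>x\<in>I. a2*x - b2 \<noteq> 0" and J: "J = (\<lambda>x. x - c) ` I"
      and G: "G = painleve_transform c \<alpha> \<beta> h" for I h J G
  proof (cases "times_differentiable_on 3 h I")
    case False
    then show ?thesis by (simp add: solves_third_order_ode_def)
  next
    case True
    let ?h1 = "deriv h" and ?h2 = "(deriv ^^ 2) h" and ?h3 = "(deriv ^^ 3) h"
    define G1 where "G1 z = h (z + c) + z * ?h1 (z + c) + \<alpha>" for z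
    define G2 where "G2 z = 2 * ?h1 (z + c) + z * ?h2 (z + c)" for z
    define G3 where "G3 z = 3 * ?h2 (z + c) + z * ?h3 (z + c)" for z
    note d = painleve_transform_derivatives[OF I(1) True J G]
    have dG: "(G has_real_derivative G1 z) (at z)" "(G1 has_real_derivative G2 z) (at z)"
      "(G2 has_real_derivative G3 z) (at z)" "deriv G z = G1 z" "(deriv ^^ 2) G z = G2 z" if "z \<in> J" for z
      using d(3-7)[OF that] by (simp_all add: G1_def[abs_def] G2_def[abs_def] G3_def)
    \<comment> \<open>\<open>\<Phi> z\<close> is the value that \<open>A4\<close> must have for
      Painleve V to hold at \<open>z\<close>; solving the equation for some \<open>A4\<close> means
      that \<open>\<Phi>\<close> is constant.\<close>
    define \<Phi> where "\<Phi> z = (z * G2 z)\<^sup>2 - (z * G1 z - G z) * (- 4 * (G1 z)\<^sup>2 + (- q2) * (z * G1 z - G z) + A2) - A3 * G1 z" for z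
    define Z where "Z z = z\<^sup>2 * G3 z + z * G2 z + 6 * z * (G1 z)\<^sup>2 - 4 * G z * G1 z + q2 * z * (z * G1 z - G z) - A2 * z / 2 - A3 / 2" for z
    have d\<Phi>: "(\<Phi> has_real_derivative 2 * G2 z * Z z) (at z)" if "z \<in> J" for z
    proof -
      have "(\<Phi> has_real_derivative 2 * (z * G2 z) * (G2 z + z * G3 z) -
          (z * G2 z * (- 4 * (G1 z)\<^sup>2 + (- q2) * (z * G1 z - G z) + A2) +
           (z * G1 z - G z) * (- 8 * G1 z * G2 z - q2 * z * G2 z)) - A3 * G2 z) (at z)"
        unfolding \<Phi>_def[abs_def]
        by (rule derivative_eq_intros dG that refl | simp)+ (simp add: algebra_simps)
      then show ?thesis
        by (rule DERIV_cong) (simp add: Z_def algebra_simps power2_eq_square)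
    qed
    have ode: "((deriv ^^ 3) h x + 6 * (deriv h x)^2
        + 4*a2 * ((deriv ^^ 2) h x + 2 * h x * deriv h x) / (a2*x - b2)
        + (2*a2^2 * (h x)^2 + P2 n a0 a1 a2 b0 b1 b2 x * deriv h x) / (a2*x - b2)^2
        + (P1 n a0 a1 a2 b0 b1 b2 x * h x - real n * Q1 n a0 a1 a2 b0 b1 b2 x) / (a2*x - b2)^3
        = 0) \<longleftrightarrow> Z (x - c) = 0" if "x \<in> I" for x
    proof -
      define z where "z = x - c"
      have z: "z \<noteq> 0" and x: "x = z + c" and den: "a2 * x - b2 = a2 * z"
        using I(3) that assms by (auto simp: z_def b2 algebra_simps)
      have "Z z = z ^ 3 * (?h3 x + 6 * (?h1 x)\<^sup>2) + z\<^sup>2 * (4 * (?h2 x + 2 * h x * ?h1 x)) +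
          z * (2 * (h x)\<^sup>2 + (q2 * z^2 + q1 * z + q0 + 2) * ?h1 x) + ((q1 / 2 * z + q0) * h x - (k1 * z + k0))"
      proof -
        have Gz: "G z = z * h x + \<alpha> * z + \<beta>" by (simp add: G painleve_transform_def x)
        have qs: "q1 = 8 * \<alpha>" "q0 = - 4 * \<beta>" by (simp_all add: \<alpha>_def \<beta>_def)
        have As: "A2 * z / 2 = (2 * \<alpha>\<^sup>2 - q2 * \<beta> + k1) * z" "A3 / 2 = k0 - 4 * \<alpha> * \<beta>"
          by (simp_all add: A2_def A3_def)
        show ?thesis
          unfolding Z_def Gz G1_def G2_def G3_def As x[symmetric] qs
          by (simp add: algebra_simps power2_eq_square power3_eq_cube)
      qed
      moreover have "?h3 x + 6 * (?h1 x)^2 + 4*a2 * (?h2 x + 2 * h x * ?h1 x) / (a2*x - b2)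
        + (2*a2^2 * (h x)^2 + P2 n a0 a1 a2 b0 b1 b2 x * ?h1 x) / (a2*x - b2)^2
        + (P1 n a0 a1 a2 b0 b1 b2 x * h x - real n * Q1 n a0 a1 a2 b0 b1 b2 x) / (a2*x - b2)^3 =
        (z ^ 3 * (?h3 x + 6 * (?h1 x)\<^sup>2) + z\<^sup>2 * (4 * (?h2 x + 2 * h x * ?h1 x)) +
          z * (2 * (h x)\<^sup>2 + (q2 * z^2 + q1 * z + q0 + 2) * ?h1 x) + ((q1 / 2 * z + q0) * h x - (k1 * z + k0))) / z ^ 3"
      proof -
        have t1: "4*a2 * (?h2 x + 2 * h x * ?h1 x) / (a2*z) = 4 * (?h2 x + 2 * h x * ?h1 x) / z"
          using assms by simp
        have "2*a2^2 * (h x)^2 + P2 n a0 a1 a2 b0 b1 b2 x * ?h1 x =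
            a2^2 * (2 * (h x)^2 + (q2 * z^2 + q1 * z + q0 + 2) * ?h1 x)"
          unfolding x P2 by (simp add: algebra_simps)
        then have t2: "(2*a2^2 * (h x)^2 + P2 n a0 a1 a2 b0 b1 b2 x * ?h1 x) / (a2*z)^2 =
            (2 * (h x)^2 + (q2 * z^2 + q1 * z + q0 + 2) * ?h1 x) / z^2"
          using assms by (simp add: power_mult_distrib)
        have "P1 n a0 a1 a2 b0 b1 b2 x * h x - real n * Q1 n a0 a1 a2 b0 b1 b2 x =
            a2^3 * ((q1 / 2 * z + q0) * h x - (k1 * z + k0))"
          unfolding x P1 Q1 by (simp add: algebra_simps)
        then have t3: "(P1 n a0 a1 a2 b0 b1 b2 x * h x - real n * Q1 n a0 a1 a2 b0 b1 b2 x) / (a2*z)^3 =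
            ((q1 / 2 * z + q0) * h x - (k1 * z + k0)) / z^3"
          using assms by (simp add: power_mult_distrib)
        have "X + c1 / z + c2 / z\<^sup>2 + c3 / z ^ 3 = (z ^ 3 * X + z\<^sup>2 * c1 + z * c2 + c3) / z ^ 3" for X c1 c2 c3
          using z by (simp add: field_simps power2_eq_square power3_eq_cube)
        then show ?thesis unfolding den t1 t2 t3 .
      qed
      ultimately show ?thesis using z by (simp add: z_def[symmetric])
    qed
    have IJ: "(\<forall>x\<in>I. Z (x - c) = 0) \<longleftrightarrow> (\<forall>z\<in>J. Z z = 0)" by (simp add: J)
    have third: "solves_third_order_ode n a0 a1 a2 b0 b1 b2 I h \<longleftrightarrow> (\<forall>z\<in>J. Z z = 0)"
      unfolding solves_third_order_ode_def IJ[symmetric] using True ode by auto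
    have pv: "solves_painleve_V (- q2) A2 A3 A4 J G \<longleftrightarrow> (\<forall>z\<in>J. \<Phi> z = A4)" for A4
      unfolding solves_painleve_V_def \<Phi>_def using d(2) dG(4,5) by (auto simp: algebra_simps)
    show ?thesis
    proof (intro conjI impI)
      assume "solves_third_order_ode n a0 a1 a2 b0 b1 b2 I h"
      then have Z: "\<And>z. z \<in> J \<Longrightarrow> Z z = 0" by (simp add: third)
      \<comment> \<open>Connectedness makes \<open>\<Phi>\<close> constant and not merely locally
        constant.\<close>
      have "convex J"
        using I(2) unfolding J by (simp add: is_interval_convex_1 convex_translation_subtract)
      moreover have "(\<Phi> has_field_derivative 0) (at z within J)" if "z \<in> J" for z
        using d\<Phi>[OF that] Z[OF that] by (simp add: has_field_derivative_at_within)
      ultimately show "\<exists>A4. solves_painleve_V (- q2) A2 A3 A4 J G"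
        unfolding pv using has_field_derivative_zero_constant[of J \<Phi>] by auto
    next
      assume G2: "\<forall>z\<in>J. (deriv ^^ 2) G z \<noteq> 0" and "\<exists>A4. solves_painleve_V (- q2) A2 A3 A4 J G"
      then obtain A4 where A4: "\<And>z. z \<in> J \<Longrightarrow> \<Phi> z = A4" unfolding pv by auto
      have "Z z = 0" if "z \<in> J" for z
      proof -
        have "((\<lambda>_. A4) has_real_derivative 2 * G2 z * Z z) (at z)"
          by (rule has_field_derivative_transform_within_open[OF d\<Phi>[OF that] d(1) that A4])
        then have "2 * G2 z * Z z = 0" using DERIV_unique DERIV_const by blast
        then show ?thesis using G2 dG(5)[OF that] that by auto
      qed
      then show "solves_third_order_ode n a0 a1 a2 b0 b1 b2 I h" by (simp add: third)
    qed
  qed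
  from this[OF _ _ _ refl refl] show ?thesis
    unfolding transforms_into_painleve_V_def Let_def c_def[symmetric]
    by (intro exI[of _ \<alpha>] exI[of _ \<beta>] exI[of _ "- q2"] exI[of _ A2] exI[of _ A3] allI impI)
qed

section \<open>From the moment recursion to the equation for the logarithmic derivative\<close>

lemma hankel_minor_has_real_derivative:
  assumes "\<And>k. (\<mu> k has_real_derivative \<mu> (Suc k) x) (at x)"
  shows "((\<lambda>x. hankel_minor n (\<lambda>k. \<mu> k x) r c) has_real_derivative
    shift n 1 (\<lambda>r. hankel_minor n (\<lambda>k. \<mu> k x) r c) r) (at x)"
proof -
  have "((\<lambda>x. hankel_minor n (\<lambda>k. \<mu> k x) r c) has_real_derivative
      (\<Sum>i<n. fdet n ((\<lambda>i j. \<mu> (r i + c j) x)(i := \<lambda>j. \<mu> (Suc (r i + c j)) x)))) (at x)"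
    unfolding hankel_minor_def by (intro fdet_has_real_derivative assms)
  then show ?thesis
    unfolding shift_def using fdet_hankel_row_replace[of n "\<lambda>k. \<mu> k x" r c _ "Suc (r _)"] by simp
qed

lemma shift_has_real_derivative:
  assumes "\<And>r. ((\<lambda>x. G x r) has_real_derivative shift n 1 (G x) r) (at x)"
  shows "((\<lambda>x. shift n k (G x) r) has_real_derivative shift n k (shift n 1 (G x)) r) (at x)"
  unfolding shift_def[of n k] by (intro DERIV_sum assms)

text \<open>Separates the algebra from the analysis: the moments enter only through the rule that
  differentiation raises their index, through the recursion, and through the positivity of
  \<open>\<tau>\<close>.\<close>

lemma hankel_log_derivative_ode:
  fixes \<mu> :: "nat \<Rightarrow> real \<Rightarrow> real" and \<tau> :: "real \<Rightarrow> real" and D :: "real set"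
  assumes n: "n \<ge> 1" and D: "open D" and K: "K > 0"
    and der: "\<And>k x. x \<in> D \<Longrightarrow> (\<mu> k has_real_derivative \<mu> (Suc k) x) (at x)"
    and moments: "\<And>k x. x \<in> D \<Longrightarrow>
      a0 * real k * \<mu> (k - 1) x + (a1 * (real k + 1) + (a0 * x - b0)) * \<mu> k x +
      (a2 * (real k + 2) + (a1 * x - b1)) * \<mu> (k + 1) x + (a2 * x - b2) * \<mu> (k + 2) x = 0"
    and \<tau>: "\<And>x. x \<in> D \<Longrightarrow> \<tau> x = K * fdet n (\<lambda>i j. \<mu> (i + j) x)"
    and pos: "\<And>x. x \<in> D \<Longrightarrow> \<tau> x > 0"
  shows "\<And>x. x \<in> D \<Longrightarrow> (\<lambda>x. ln (\<tau> x)) differentiable (at x)"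
    and "solves_third_order_ode n a0 a1 a2 b0 b1 b2 {x \<in> D. a2*x - b2 \<noteq> 0} (deriv (\<lambda>x. ln (\<tau> x)))"
proof -
  define e where "e = (\<lambda>i::nat. i)"
  define F where "F x r = hankel_minor n (\<lambda>k. \<mu> k x) r e" for x r
  define S where "S = shift n"
  define T where "T j x = (S 1 ^^ j) (F x) e" for j x
  have dF: "((\<lambda>x. F x r) has_real_derivative S 1 (F x) r) (at x)" if "x \<in> D" for x r
    unfolding F_def[abs_def] S_def by (rule hankel_minor_has_real_derivative der that)+
  have dS: "((\<lambda>x. S k (F x) r) has_real_derivative S k (S 1 (F x)) r) (at x)" if "x \<in> D" for k x r
    unfolding S_def by (rule shift_has_real_derivative dF[OF that, unfolded S_def])+
  have "((\<lambda>x. (S 1 ^^ j) (F x) r) has_real_derivative (S 1 ^^ Suc j) (F x) r) (at x)" if "x \<in> D" for j x r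
  proof (induction j arbitrary: r)
    case 0
    then show ?case using dF[OF that] by simp
  next
    case (Suc j)
    have "((\<lambda>x. shift n 1 ((S 1 ^^ j) (F x)) r) has_real_derivative
        shift n 1 (shift n 1 ((S 1 ^^ j) (F x))) r) (at x)"
      using Suc by (intro shift_has_real_derivative) (simp add: S_def)
    then show ?case by (simp add: S_def)
  qed
  then have dT: "(T j has_real_derivative T (Suc j) x) (at x)" if "x \<in> D" for j x
    unfolding T_def[abs_def] using that by simp
  have T_0: "\<tau> x = K * T 0 x" if "x \<in> D" for x
    using \<tau>[OF that] by (simp add: T_def F_def hankel_minor_def e_def)
  then have T0: "T 0 x > 0" if "x \<in> D" for x using pos[OF that] K that by (simp add: zero_less_mult_iff)
  \<comment> \<open>\<open>R j\<close> is the average of \<open>p\<^sub>1 ^ j\<close>.\<close>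
  define R where "R j x = T j x / T 0 x" for j x
  have dR: "(R j has_real_derivative R (Suc j) x - R j x * R 1 x) (at x)" if "x \<in> D" for j x
    unfolding R_def[abs_def] using T0[OF that]
    by (auto intro!: derivative_eq_intros dT that simp: field_simps)
  have dln: "((\<lambda>x. ln (\<tau> x)) has_real_derivative R 1 x) (at x)" if "x \<in> D" for x
  proof -
    have "((\<lambda>x. ln (K * T 0 x)) has_real_derivative R 1 x) (at x)"
      using T0[OF that] K by (auto intro!: derivative_eq_intros dT that simp: R_def)
    then show ?thesis
      by (rule has_field_derivative_transform_within_open[OF _ D that]) (simp add: T_0)
  qed
  then show "\<And>x. x \<in> D \<Longrightarrow> (\<lambda>x. ln (\<tau> x)) differentiable (at x)"
    unfolding real_differentiable_def by blast
  define g where "g = deriv (\<lambda>x. ln (\<tau> x))"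
  have g: "g x = R 1 x" if "x \<in> D" for x
    unfolding g_def using dln[OF that] by (rule DERIV_imp_deriv)
  \<comment> \<open>The derivatives of \<open>g\<close> are the cumulants of
    \<open>p\<^sub>1\<close>, written in its moments \<open>R j\<close>.\<close>
  define G where "G j = (if j = 0 then g else if j = 1 then (\<lambda>x. R 2 x - (R 1 x)\<^sup>2)
    else if j = 2 then (\<lambda>x. R 3 x - 3 * R 1 x * R 2 x + 2 * R 1 x ^ 3)
    else (\<lambda>x. R 4 x - 4 * R 1 x * R 3 x - 3 * (R 2 x)\<^sup>2 + 12 * (R 1 x)\<^sup>2 * R 2 x - 6 * R 1 x ^ 4))" for j :: nat
  define S' where "S' = {x \<in> D. a2*x - b2 \<noteq> 0}"
  have S': "open S'"
  proof -
    have "S' = D \<inter> {x. a2*x - b2 \<noteq> 0}" by (auto simp: S'_def)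
    moreover have "open {x. a2*x - b2 \<noteq> 0}" by (intro open_Collect_neq continuous_intros)
    ultimately show ?thesis using D by auto
  qed
  have dG: "(G j has_real_derivative G (Suc j) x) (at x)" if j: "j < 3" and "x \<in> S'" for j x
  proof -
    have x: "x \<in> D" using that by (simp add: S'_def)
    have dR': "(R 1 has_real_derivative R 2 x - R 1 x * R 1 x) (at x)"
      "(R 2 has_real_derivative R 3 x - R 2 x * R 1 x) (at x)"
      "(R 3 has_real_derivative R 4 x - R 3 x * R 1 x) (at x)"
      using dR[OF x, of 1] dR[OF x, of 2] dR[OF x, of 3] by (simp_all add: eval_nat_numeral)
    consider "j = 0" | "j = 1" | "j = 2" using j by linarith
    then show ?thesis
    proof cases
      case 1
      have "(g has_real_derivative R 2 x - R 1 x * R 1 x) (at x)"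
        by (rule has_field_derivative_transform_within_open[OF dR'(1) D x]) (simp add: g)
      then show ?thesis by (simp add: G_def 1 power2_eq_square)
    next
      case 2
      have "((\<lambda>x. R 2 x - (R 1 x)\<^sup>2) has_real_derivative R 3 x - 3 * R 1 x * R 2 x + 2 * R 1 x ^ 3) (at x)"
        by (rule derivative_eq_intros dR' refl | simp)+ (simp add: algebra_simps power2_eq_square power3_eq_cube)
      then show ?thesis by (simp add: G_def 2)
    next
      case 3
      have "((\<lambda>x. R 3 x - 3 * R 1 x * R 2 x + 2 * R 1 x ^ 3) has_real_derivative
          R 4 x - 4 * R 1 x * R 3 x - 3 * (R 2 x)\<^sup>2 + 12 * (R 1 x)\<^sup>2 * R 2 x - 6 * R 1 x ^ 4) (at x)"
        by (rule derivative_eq_intros dR' refl | simp)+ (simp add: algebra_simps eval_nat_numeral)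
      then show ?thesis by (simp add: G_def 3)
    qed
  qed
  have td: "times_differentiable_on 3 g S'"
    using times_differentiable_onI[of S' 3 G] S' dG by (simp add: G_def)
  have ode: "(deriv ^^ 3) g x + 6 * (deriv g x)^2
        + 4*a2 * ((deriv ^^ 2) g x + 2 * g x * deriv g x) / (a2*x - b2)
        + (2*a2^2 * (g x)^2 + P2 n a0 a1 a2 b0 b1 b2 x * deriv g x) / (a2*x - b2)^2
        + (P1 n a0 a1 a2 b0 b1 b2 x * g x - real n * Q1 n a0 a1 a2 b0 b1 b2 x) / (a2*x - b2)^3 = 0"
    if "x \<in> S'" for x
  proof -
    have x: "x \<in> D" and y: "a2*x - b2 \<noteq> 0" using that by (auto simp: S'_def)
    define r1 r2 r3 r4 where "r1 = R 1 x" and "r2 = R 2 x" and "r3 = R 3 x" and "r4 = R 4 x"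
    note r = r1_def r2_def r3_def r4_def
    have "(deriv ^^ j) g x = G j x" if "j \<le> 3" for j
      using funpow_deriv_eqI[of S' x j 3 G] S' \<open>x \<in> S'\<close> that dG by (simp add: G_def)
    from this[of 1] this[of 2] this[of 3]
    have derivs: "deriv g x = r2 - (r1)\<^sup>2" "(deriv ^^ 2) g x = r3 - 3 * r1 * r2 + 2 * r1 ^ 3"
      "(deriv ^^ 3) g x = r4 - 4 * r1 * r3 - 3 * (r2)\<^sup>2 + 12 * (r1)\<^sup>2 * r2 - 6 * r1 ^ 4"
      by (simp_all add: G_def r)
    define t where "t = T 0 x"
    have t: "t \<noteq> 0" using T0[OF x] by (simp add: t_def)
    define q where "q = S 2 (F x) e / t"
    define dq where "dq = S 2 (S 1 (F x)) e / t"
    define w where "w = S 3 (F x) e / t"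
    define dw where "dw = S 3 (S 1 (F x)) e / t"
    define v where "v = S 2 (S 2 (F x)) e / t"
    have Fe: "F x e = t" by (simp add: t_def T_def)
    have sc: "F x e = t" "S 1 (F x) e = t * r1" "S 1 (S 1 (F x)) e = t * r2"
      "S 1 (S 1 (S 1 (F x))) e = t * r3" "S 1 (S 1 (S 1 (S 1 (F x)))) e = t * r4"
      "S 2 (F x) e = t * q" "S 2 (S 1 (F x)) e = t * dq" "S 3 (F x) e = t * w" "S 3 (S 1 (F x)) e = t * dw"
      "S 2 (S 2 (F x)) e = t * v"
      using t by (simp_all add: Fe r R_def T_def q_def dq_def w_def dw_def v_def eval_nat_numeral)
    have "kp_form n (\<lambda>r. fdet n (\<lambda>i j. \<mu> (r i + j) x)) = 0"
      using t by (intro kp_form_fdet_rows[of n "\<lambda>k j. \<mu> (k + j) x"]) (simp add: t_def T_def F_def hankel_minor_def e_def)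
    then have "kp_form n (F x) = 0" by (simp add: F_def[abs_def] hankel_minor_def e_def)
    then have kp: "t\<^sup>2 * (r4 + 3 * v - 4 * dw - 4 * r3 * r1 + 3 * (r2)\<^sup>2 - 3 * q\<^sup>2 + 4 * r1 * w) = 0"
      unfolding kp_form_def Let_def e_def[symmetric] S_def[symmetric] sc
      by (simp add: algebra_simps power2_eq_square)
    have mom: "\<And>k. a0 * real k * \<mu> (k - 1) x + (a1 * (real k + 1) + (a0 * x - b0)) * \<mu> k x +
      (a2 * (real k + 2) + (a1 * x - b1)) * \<mu> (k + 1) x + (a2 * x - b2) * \<mu> (k + 2) x = 0" if "x \<in> D" for x
      using moments[OF that] .
    have v0: "(a2 * x - b2) * S 2 (F x) e + (a1 * x - b1 + 2 * real n * a2) * S 1 (F x) e +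
        (real n * (a0 * x - b0) + a1 * (real n)\<^sup>2) * F x e = 0"
      and v1: "(a2 * x - b2) * S 3 (F x) e + (a1 * x - b1) * S 2 (F x) e + (a0 * x - b0) * S 1 (F x) e +
        a0 * (real n)\<^sup>2 * F x e + 2 * real n * a1 * S 1 (F x) e +
        a2 * (2 * real n * S 2 (F x) e + S 1 (S 1 (F x)) e) = 0"
      and v2: "(a2 * x - b2) * S 2 (S 2 (F x)) e + (a1 * x - b1 + 2 * real n * a2) * S 2 (S 1 (F x)) e +
        (real n * (a0 * x - b0) + a1 * ((real n)\<^sup>2 + 2)) * S 2 (F x) e + 2 * a0 * S 1 (F x) e +
        2 * a2 * S 3 (F x) e = 0" if "x \<in> D" for x
      using virasoro_0[OF n mom[OF that]] virasoro_1[OF n mom[OF that]] virasoro_0_squared[OF n mom[OF that]]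
      by (simp_all add: F_def[abs_def] S_def e_def)
    \<comment> \<open>The constraints hold on the whole open set \<open>D\<close>, so they may be
      differentiated, which inserts \<open>p\<^sub>1\<close> into them.\<close>
    have zero: "d = 0" if "\<And>x. x \<in> D \<Longrightarrow> f x = 0" "(f has_real_derivative d) (at x)" for f :: "real \<Rightarrow> real" and d
    proof -
      have "((\<lambda>_. 0) has_real_derivative d) (at x)"
        by (rule has_field_derivative_transform_within_open[OF that(2) D x that(1)])
      then show ?thesis using DERIV_unique DERIV_const by blast
    qed
    have dv0: "a2 * S 2 (F x) e + (a2 * x - b2) * S 2 (S 1 (F x)) e + a1 * S 1 (F x) e +
        (a1 * x - b1 + 2 * real n * a2) * S 1 (S 1 (F x)) e + real n * a0 * F x e +
        (real n * (a0 * x - b0) + a1 * (real n)\<^sup>2) * S 1 (F x) e = 0"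
      by (rule zero[OF v0], assumption) (rule derivative_eq_intros dS[OF x] dF[OF x] refl | simp)+
    have dv1: "a2 * S 3 (F x) e + (a2 * x - b2) * S 3 (S 1 (F x)) e + a1 * S 2 (F x) e + (a1 * x - b1) * S 2 (S 1 (F x)) e +
        a0 * S 1 (F x) e + (a0 * x - b0) * S 1 (S 1 (F x)) e +
        a0 * (real n)\<^sup>2 * S 1 (F x) e + 2 * real n * a1 * S 1 (S 1 (F x)) e +
        a2 * (2 * real n * S 2 (S 1 (F x)) e + S 1 (S 1 (S 1 (F x))) e) = 0"
    proof (rule zero[OF v1])
      have d11: "((\<lambda>x. S 1 (S 1 (F x)) e) has_real_derivative S 1 (S 1 (S 1 (F x))) e) (at x)"
        using dT[OF x, of 2] by (simp add: T_def[abs_def] eval_nat_numeral)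
      show "((\<lambda>x. (a2 * x - b2) * S 3 (F x) e + (a1 * x - b1) * S 2 (F x) e + (a0 * x - b0) * S 1 (F x) e +
        a0 * (real n)\<^sup>2 * F x e + 2 * real n * a1 * S 1 (F x) e +
        a2 * (2 * real n * S 2 (F x) e + S 1 (S 1 (F x)) e)) has_real_derivative
        a2 * S 3 (F x) e + (a2 * x - b2) * S 3 (S 1 (F x)) e + a1 * S 2 (F x) e + (a1 * x - b1) * S 2 (S 1 (F x)) e +
        a0 * S 1 (F x) e + (a0 * x - b0) * S 1 (S 1 (F x)) e +
        a0 * (real n)\<^sup>2 * S 1 (F x) e + 2 * real n * a1 * S 1 (S 1 (F x)) e +
        a2 * (2 * real n * S 2 (S 1 (F x)) e + S 1 (S 1 (S 1 (F x))) e)) (at x)"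
        by (rule derivative_eq_intros d11 dS[OF x] dF[OF x] refl)+ simp
    qed assumption
    have canc: "s = 0" if "t * s = 0" for s using that t by simp
    show ?thesis
      unfolding derivs g[OF x] r1_def[symmetric]
    proof (rule third_order_ode_of_relations[OF y, where V = v and Q = q and dW = dw and W = w and dQ = dq])
      \<comment> \<open>In g''' + 6 g'^2 the terms r1^2 r2 and r1^4 cancel, and r4 - 4 r1 r3 + 3
        r2^2 remains, as in the KP form.\<close>
      have "r4 + 3 * v - 4 * dw - 4 * r3 * r1 + 3 * (r2)\<^sup>2 - 3 * q\<^sup>2 + 4 * r1 * w = 0"
        using kp t by simp
      then show "r4 - 4 * r1 * r3 - 3 * (r2)\<^sup>2 + 12 * (r1)\<^sup>2 * r2 - 6 * r1 ^ 4 +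
          6 * (r2 - (r1)\<^sup>2)\<^sup>2 + 3 * (v - q\<^sup>2) - 4 * (dw - r1 * w) = 0"
        by (simp add: algebra_simps power2_eq_square power4_eq_xxxx)
      show "(a2 * x - b2) * q + (a1 * x - b1 + 2 * real n * a2) * r1 + (real n * (a0 * x - b0) + a1 * (real n)\<^sup>2) = 0"
        using v0[OF x] unfolding sc by - (rule canc, simp add: algebra_simps power2_eq_square power3_eq_cube)
      show "(a2 * x - b2) * dq + a2 * q + (a1 * x - b1 + 2 * real n * a2) * (r2 - (r1)\<^sup>2 + (r1)\<^sup>2) +
          a1 * r1 + (real n * (a0 * x - b0) + a1 * (real n)\<^sup>2) * r1 + real n * a0 = 0"
        using dv0 unfolding sc by - (rule canc, simp add: algebra_simps power2_eq_square power3_eq_cube)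
      show "(a2 * x - b2) * w + (a1 * x - b1) * q + (a0 * x - b0) * r1 + a0 * (real n)\<^sup>2 + 2 * real n * a1 * r1 +
          a2 * (2 * real n * q + (r2 - (r1)\<^sup>2 + (r1)\<^sup>2)) = 0"
        using v1[OF x] unfolding sc by - (rule canc, simp add: algebra_simps power2_eq_square power3_eq_cube)
      show "(a2 * x - b2) * dw + a2 * w + (a1 * x - b1) * dq + a1 * q +
          (a0 * x - b0) * (r2 - (r1)\<^sup>2 + (r1)\<^sup>2) + a0 * r1 + a0 * (real n)\<^sup>2 * r1 +
          2 * real n * a1 * (r2 - (r1)\<^sup>2 + (r1)\<^sup>2) +
          a2 * (2 * real n * dq + (r3 - 3 * r1 * r2 + 2 * r1 ^ 3 + 3 * r1 * (r2 - (r1)\<^sup>2) + r1 ^ 3)) = 0"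
        using dv1 unfolding sc by - (rule canc, simp add: algebra_simps power2_eq_square power3_eq_cube)
      show "(a2 * x - b2) * v + (a1 * x - b1 + 2 * real n * a2) * dq +
          (real n * (a0 * x - b0) + a1 * (real n)\<^sup>2 + 2 * a1) * q + 2 * a0 * r1 + 2 * a2 * w = 0"
        using v2[OF x] unfolding sc by - (rule canc, simp add: algebra_simps power2_eq_square power3_eq_cube)
    qed
  qed
  show "solves_third_order_ode n a0 a1 a2 b0 b1 b2 {x \<in> D. a2*x - b2 \<noteq> 0} (deriv (\<lambda>x. ln (\<tau> x)))"
    unfolding solves_third_order_ode_def g_def[symmetric] S'_def[symmetric] using td ode by blast
qed

section \<open>The multiple integral as a Hankel determinant\<close>

text \<open>Multiplication by x sends the k-th Newton polynomial to the next one plus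
  \<open>y k\<close> times itself, whence the recursion for the coefficients. Leading coefficient 1
  makes the change of basis unitriangular.\<close>

lemma newton_basis_expansion:
  fixes y :: "nat \<Rightarrow> real"
  shows "\<exists>u. (\<forall>x. x ^ j = (\<Sum>k\<le>j. (\<Prod>i<k. x - y i) * u k)) \<and> u j = 1"
proof (induction j)
  case 0
  show ?case by (intro exI[of _ "\<lambda>_. 1"]) simp
next
  case (Suc j)
  then obtain u where u: "\<And>x. x ^ j = (\<Sum>k\<le>j. (\<Prod>i<k. x - y i) * u k)" "u j = 1" by auto
  define u' where "u' k = (if k \<le> j then y k * u k else 0) + (if k = 0 then 0 else u (k - 1))" for k
  have "x ^ Suc j = (\<Sum>k\<le>Suc j. (\<Prod>i<k. x - y i) * u' k)" for x
  proof -
    let ?p = "\<lambda>k. \<Prod>i<k. x - y i"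
    have "x ^ Suc j = (\<Sum>k\<le>j. x * (?p k * u k))" by (simp add: u(1) sum_distrib_left)
    also have "\<dots> = (\<Sum>k\<le>j. ?p k * (y k * u k)) + (\<Sum>k\<le>j. ?p (Suc k) * u k)"
      unfolding sum.distrib[symmetric] by (intro sum.cong refl) (simp add: algebra_simps)
    also have "(\<Sum>k\<le>j. ?p k * (y k * u k)) = (\<Sum>k\<le>Suc j. ?p k * (if k \<le> j then y k * u k else 0))"
      by simp
    also have "(\<Sum>k\<le>j. ?p (Suc k) * u k) = (\<Sum>k\<le>Suc j. ?p k * (if k = 0 then 0 else u (k - 1)))"
      by (subst sum.atMost_Suc_shift) simp
    finally show ?thesis unfolding sum.distrib[symmetric] u'_def by (simp only: distrib_left)
  qed
  moreover have "u' (Suc j) = 1" by (simp add: u'_def u(2))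
  ultimately show ?case by blast
qed

lemma fdet_mult: "fdet n a * fdet n b = fdet n (\<lambda>i j. \<Sum>k<n. a i k * b k j)"
proof -
  let ?A = "mat n n (\<lambda>(i, j). a i j)" and ?B = "mat n n (\<lambda>(i, j). b i j)"
  have "?A * ?B = mat n n (\<lambda>(i, j). \<Sum>k<n. a i k * b k j)"
    by (rule eq_matI) (auto simp: scalar_prod_def atLeast0LessThan)
  then show ?thesis unfolding fdet_def using det_mult[of ?A n ?B] by simp
qed

lemma fdet_lower_triangular:
  assumes "\<And>i j. i < j \<Longrightarrow> j < n \<Longrightarrow> a i j = 0"
  shows "fdet n a = (\<Prod>i<n. a i i)"
  unfolding fdet_def using assms
  by (subst det_lower_triangular[of n]) (auto simp: prod_list_diag_prod atLeast0LessThan)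

text \<open>The matrix factors through the Newton basis at its own nodes: the j-th Newton polynomial
  vanishes at \<open>y i\<close> for i < j, so the values are lower triangular, and the coefficients
  are unitriangular.\<close>

lemma fdet_vandermonde: "fdet n (\<lambda>i j. y i ^ j) = (\<Prod>i<n. \<Prod>k<i. y i - y k)"
proof -
  obtain u where u: "\<And>j x. x ^ j = (\<Sum>k\<le>j. (\<Prod>i<k. x - y i) * u j k)" "\<And>j. u j j = 1"
    using newton_basis_expansion[of _ y] by metis
  define U where "U k j = (if k \<le> j then u j k else 0)" for k j
  let ?p = "\<lambda>i j. \<Prod>k<j. y i - y k"
  have "fdet n (\<lambda>i j. y i ^ j) = fdet n (\<lambda>i j. \<Sum>k<n. ?p i k * U k j)"
  proof (rule fdet_cong)
    fix i j assume "j < n"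
    then have "(\<Sum>k<n. ?p i k * U k j) = (\<Sum>k\<le>j. ?p i k * u j k)"
      by (intro sum.mono_neutral_cong_right) (auto simp: U_def)
    then show "y i ^ j = (\<Sum>k<n. ?p i k * U k j)" using u(1) by simp
  qed
  also have "\<dots> = fdet n ?p * fdet n U" by (rule fdet_mult[symmetric])
  also have "fdet n U = 1"
  proof -
    have "fdet n (\<lambda>i j. U j i) = 1"
      by (subst fdet_lower_triangular) (auto simp: U_def u(2))
    then show ?thesis by (simp add: fdet_transpose[of n U])
  qed
  also have "fdet n ?p = (\<Prod>i<n. ?p i i)"
    by (rule fdet_lower_triangular) (auto intro!: prod_zero)
  finally show ?thesis by simp
qed

lemma prod_atLeast1_atMost: "(\<Prod>k\<in>{1..n}. f k) = (\<Prod>i<n. f (Suc i))"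
proof -
  have "{1..n} = Suc ` {..<n}" by (simp add: image_Suc_lessThan)
  then show ?thesis by (simp add: prod.reindex)
qed

lemma Vdm_squared_eq_prod: "(Vdm n z)\<^sup>2 = (\<Prod>j<n. \<Prod>i<j. (z (Suc j) - z (Suc i))\<^sup>2)"
proof -
  have "Vdm n z = (\<Prod>j<n. \<Prod>i<j. z (Suc i) - z (Suc j))"
    unfolding Vdm_def prod_atLeast1_atMost atLeastLessThanSuc_atLeastAtMost ..
  then show ?thesis by (simp add: prod_power_distrib power2_commute)
qed

lemma Vdm_squared_eq_fdet: "(Vdm n z)\<^sup>2 = (fdet n (\<lambda>i j. z (Suc i) ^ j))\<^sup>2"
  unfolding Vdm_squared_eq_prod fdet_vandermonde by (simp add: prod_power_distrib)

text \<open>With both Vandermonde factors expanded by Leibniz, every term is a product of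
  one-dimensional moments. Substituting \<open>q \<circ> p\<close> for \<open>q\<close> shows that
  each of the n! permutations \<open>p\<close> contributes the same Hankel determinant.\<close>

lemma andreief:
  fixes w :: "real \<Rightarrow> real"
  assumes w: "\<And>k. integrable lborel (\<lambda>z. z ^ k * w z)"
  shows "integrable (PiM {1..n} (\<lambda>_. lborel)) (\<lambda>z. (Vdm n z)\<^sup>2 * (\<Prod>k\<in>{1..n}. w (z k)))"
    and "(\<integral>z. (Vdm n z)\<^sup>2 * (\<Prod>k\<in>{1..n}. w (z k)) \<partial>PiM {1..n} (\<lambda>_. lborel)) =
      fact n * fdet n (\<lambda>i j. \<integral>z. z ^ (i + j) * w z \<partial>lborel)"
proof -
  interpret product_sigma_finite "\<lambda>_::nat. lborel :: real measure" by standard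
  let ?M = "PiM {1..n} (\<lambda>_. lborel) :: (nat \<Rightarrow> real) measure" and ?P = "{p. p permutes {..<n}}"
  define m where "m k = (\<integral>z. z ^ k * w z \<partial>lborel)" for k
  define h where "h p q z = (\<Prod>k\<in>{1..n}. z k ^ (p (k - 1) + q (k - 1)) * w (z k))" for p q :: "nat \<Rightarrow> nat" and z :: "nat \<Rightarrow> real"
  have h: "integrable ?M (h p q)" for p q
    unfolding h_def by (rule product_integrable_prod) (use w in auto)
  have int_h: "(\<integral>z. h p q z \<partial>?M) = (\<Prod>i<n. m (p i + q i))" for p q
  proof -
    have "(\<integral>z. h p q z \<partial>?M) = (\<Prod>k\<in>{1..n}. m (p (k - 1) + q (k - 1)))"
      unfolding h_def m_def by (rule product_integral_prod) (use w in auto)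
    then show ?thesis unfolding prod_atLeast1_atMost by simp
  qed
  have expand: "(Vdm n z)\<^sup>2 * (\<Prod>k\<in>{1..n}. w (z k)) = (\<Sum>p\<in>?P. \<Sum>q\<in>?P. signof p * signof q * h p q z)" for z
    unfolding Vdm_squared_eq_fdet
    unfolding fdet_perm power2_eq_square sum_product sum_distrib_right h_def prod_atLeast1_atMost
    by (intro sum.cong refl) (simp add: sum_distrib_left prod.distrib power_add mult_ac)
  show "integrable ?M (\<lambda>z. (Vdm n z)\<^sup>2 * (\<Prod>k\<in>{1..n}. w (z k)))"
    unfolding expand by (intro Bochner_Integration.integrable_sum integrable_mult_right h)
  have "(\<integral>z. (Vdm n z)\<^sup>2 * (\<Prod>k\<in>{1..n}. w (z k)) \<partial>?M) =
      (\<Sum>p\<in>?P. \<Sum>q\<in>?P. signof p * signof q * (\<Prod>i<n. m (p i + q i)))"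
  proof -
    have "(\<integral>z. (Vdm n z)\<^sup>2 * (\<Prod>k\<in>{1..n}. w (z k)) \<partial>?M) =
        (\<Sum>p\<in>?P. \<integral>z. (\<Sum>q\<in>?P. signof p * signof q * h p q z) \<partial>?M)"
      unfolding expand
      by (intro Bochner_Integration.integral_sum Bochner_Integration.integrable_sum integrable_mult_right h)
    also have "\<dots> = (\<Sum>p\<in>?P. \<Sum>q\<in>?P. \<integral>z. signof p * signof q * h p q z \<partial>?M)"
      by (intro sum.cong refl Bochner_Integration.integral_sum integrable_mult_right h)
    finally show ?thesis by (simp only: integral_mult_right_zero int_h)
  qed
  also have "\<dots> = (\<Sum>p\<in>?P. fdet n (\<lambda>i j. m (i + j)))"
  proof (rule sum.cong[OF refl])
    fix p assume "p \<in> ?P"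
    then have p: "p permutes {..<n}" by simp
    have pp: "permutation p" using p finite_lessThan by (auto simp: permutation_permutes)
    have "(\<Sum>q\<in>?P. signof p * signof q * (\<Prod>i<n. m (p i + q i))) =
        (\<Sum>q\<in>?P. signof p * signof (q \<circ> p) * (\<Prod>i<n. m (p i + (q \<circ> p) i)))"
      by (rule sum_permutations_compose_right[OF p])
    also have "\<dots> = (\<Sum>q\<in>?P. signof q * (\<Prod>i<n. m (i + q i)))"
    proof (rule sum.cong[OF refl])
      fix q assume "q \<in> ?P"
      then have q: "permutation q" using finite_lessThan by (auto simp: permutation_permutes)
      have "sign p * sign p = 1" by (simp add: sign_def)
      then have "signof p * signof (q \<circ> p) = (signof q :: real)"
        using sign_compose[OF q pp] by (metis mult.commute mult.left_commute mult.right_neutral of_int_mult)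
      moreover have "(\<Prod>i<n. m (p i + (q \<circ> p) i)) = (\<Prod>i<n. m (i + q i))"
        using prod.reindex_bij_betw[OF permutes_imp_bij[OF p], of "\<lambda>i. m (i + q i)"] by simp
      ultimately show "signof p * signof (q \<circ> p) * (\<Prod>i<n. m (p i + (q \<circ> p) i)) = signof q * (\<Prod>i<n. m (i + q i))"
        by simp
    qed
    finally show "(\<Sum>q\<in>?P. signof p * signof q * (\<Prod>i<n. m (p i + q i))) = fdet n (\<lambda>i j. m (i + j))"
      by (simp add: fdet_perm)
  qed
  also have "\<dots> = fact n * fdet n (\<lambda>i j. m (i + j))"
    by (simp add: card_permutations)
  finally show "(\<integral>z. (Vdm n z)\<^sup>2 * (\<Prod>k\<in>{1..n}. w (z k)) \<partial>?M) =
      fact n * fdet n (\<lambda>i j. \<integral>z. z ^ (i + j) * w z \<partial>lborel)"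
    by (simp add: m_def)
qed

section \<open>Convergence and positivity of the n-fold integral\<close>

text \<open>
  To bound a one-dimensional integral by the full one, the remaining variables are kept in
  disjoint small intervals on the side of \<open>(p + q) / 2\<close> opposite to the first one, where
  \<open>Vdm\<close> is bounded below.
\<close>

lemma half_line_integral_bound:
  fixes w :: "real \<Rightarrow> real" and s :: real
  assumes n: "n \<ge> 1" and w[measurable]: "w \<in> borel_measurable borel"
    and pq: "p < q" "\<And>z. p < z \<Longrightarrow> z < q \<Longrightarrow> w z \<noteq> 0" and s: "\<bar>s\<bar> = 1"
  defines "m \<equiv> (p + q) / 2"
  shows "\<exists>K\<noteq>0. K * (\<integral>\<^sup>+z. indicator {z. s * (z - m) \<le> 0} z * ennreal \<bar>w z\<bar> \<partial>lborel) \<le>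
    (\<integral>\<^sup>+z. ennreal ((Vdm n z)\<^sup>2 * (\<Prod>k\<in>{1..n}. \<bar>w (z k)\<bar>)) \<partial>PiM {1..n} (\<lambda>_. lborel))"
proof -
  interpret product_sigma_finite "\<lambda>_::nat. lborel :: real measure" by standard
  let ?M = "PiM {1..n} (\<lambda>_. lborel) :: (nat \<Rightarrow> real) measure"
  \<comment> \<open>The spacing is such that intervals of radius \<open>\<eta> / 4\<close> with
    centres at distance \<open>k * \<eta>\<close> from \<open>m\<close>, for k up to n, stay within
    distance \<open>(q - p) / 2\<close> of \<open>m\<close>.\<close>
  define \<eta> where "\<eta> = (q - p) / (2 * (real n + 1))"
  have \<eta>: "\<eta> > 0" using pq by (simp add: \<eta>_def)
  have n\<eta>: "real n * \<eta> + \<eta> = (q - p) / 2"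
  proof -
    have "x \<noteq> 0 \<Longrightarrow> x * (d / (2 * x)) = d / 2" for x d :: real by simp
    from this[of "real n + 1" "q - p"] have "(real n + 1) * \<eta> = (q - p) / 2"
      unfolding \<eta>_def by linarith
    then show ?thesis by (simp add: algebra_simps)
  qed
  \<comment> \<open>The first variable ranges over a half line; the others sit on the opposite side
    in blocks at least \<open>\<eta> / 2\<close> apart from each other and from it.\<close>
  define J where "J k = (if k = 1 then {z. s * (z - m) \<le> 0} else {z. \<bar>s * (z - m) - real k * \<eta>\<bar> \<le> \<eta> / 4})" for k :: nat
  have J[measurable]: "J k \<in> sets borel" for k
    unfolding J_def by (cases "k = 1") auto
  define I where "I k = (\<integral>\<^sup>+z. indicator (J k) z * ennreal \<bar>w z\<bar> \<partial>lborel)" for k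
  have ss: "s * s = 1" using s by (metis abs_mult_self mult.right_neutral)
  \<comment> \<open>Nonzero because \<open>w\<close> has no zeros on an interval of positive length.
    The value may be infinite, so the constant \<open>K\<close> built from it is only claimed to be
    nonzero.\<close>
  have I: "I k \<noteq> 0" if k: "k \<in> {2..n}" for k
  proof
    assume "I k = 0"
    then have ae: "AE z in lborel. indicator (J k) z * ennreal \<bar>w z\<bar> = 0"
      unfolding I_def by (subst (asm) nn_integral_0_iff_AE) auto
    let ?c = "m + s * (real k * \<eta>)"
    have sub: "w z \<noteq> 0" "z \<in> J k" if "z \<in> {?c - \<eta> / 4..?c + \<eta> / 4}" for z
    proof -
      have "s * (z - m) - real k * \<eta> = s * (z - ?c)" using ss by (simp add: algebra_simps)
      then have "\<bar>s * (z - m) - real k * \<eta>\<bar> = \<bar>z - ?c\<bar>" using s by (simp add: abs_mult)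
      moreover have "\<bar>z - ?c\<bar> \<le> \<eta> / 4" using that unfolding abs_le_iff by auto
      ultimately have *: "\<bar>s * (z - m) - real k * \<eta>\<bar> \<le> \<eta> / 4" by (simp only:)
      then show "z \<in> J k" using k by (simp add: J_def)
      have "real k * \<eta> \<le> real n * \<eta>" using k \<eta> by (simp add: mult_right_mono)
      moreover have k0: "0 \<le> real k * \<eta>" using \<eta> by simp
      moreover have tri: "\<bar>X\<bar> \<le> Y + \<eta> / 4" if "\<bar>X - Y\<bar> \<le> \<eta> / 4" "0 \<le> Y" for X Y
        using that by linarith
      ultimately have "\<bar>s * (z - m)\<bar> < (q - p) / 2" using tri[OF * k0] \<eta> n\<eta> by linarith
      then have "\<bar>z - m\<bar> < (q - p) / 2" using s by (simp add: abs_mult)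
      then show "w z \<noteq> 0" by (intro pq(2)) (auto simp: m_def abs_less_iff field_simps)
    qed
    have "AE z in lborel. z \<notin> {?c - \<eta> / 4..?c + \<eta> / 4}"
      using ae
    proof eventually_elim
      case (elim z)
      show ?case
      proof
        assume "z \<in> {?c - \<eta> / 4..?c + \<eta> / 4}"
        then show False using sub[of z] elim by simp
      qed
    qed
    then have "{?c - \<eta> / 4..?c + \<eta> / 4} \<in> null_sets lborel"
      by (subst AE_iff_null_sets) auto
    then have "emeasure lborel {?c - \<eta> / 4..?c + \<eta> / 4} = 0" by (rule null_setsD1)
    then show False using \<eta> by simp
  qed
  define c where "c = (\<Prod>j<n. \<Prod>i<j. (\<eta> / 2)\<^sup>2)"
  have c: "c > 0" unfolding c_def using \<eta> by (intro prod_pos ballI) auto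
  have lower: "c \<le> (Vdm n z)\<^sup>2" if z: "\<And>k. k \<in> {1..n} \<Longrightarrow> z k \<in> J k" for z
    unfolding c_def Vdm_squared_eq_prod
  proof (intro prod_mono conjI prod_nonneg ballI)
    fix j i assume ij: "j \<in> {..<n}" "i \<in> {..<j}"
    have zj: "z (Suc j) \<in> J (Suc j)" and zi: "z (Suc i) \<in> J (Suc i)" using z ij by auto
    have jj: "\<bar>s * (z (Suc j) - m) - real (Suc j) * \<eta>\<bar> \<le> \<eta> / 4"
      using zj ij by (auto simp: J_def)
    have diff: "s * (z (Suc j) - z (Suc i)) = s * (z (Suc j) - m) - s * (z (Suc i) - m)"
      by (simp add: algebra_simps)
    have "s * (z (Suc j) - z (Suc i)) \<ge> \<eta> / 2"
    proof (cases "i = 0")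
      case True
      have "real (Suc j) * \<eta> \<ge> 2 * \<eta>" using ij \<eta> by (intro mult_right_mono) auto
      moreover have "s * (z (Suc i) - m) \<le> 0" using zi True by (simp add: J_def)
      ultimately show ?thesis unfolding diff using jj \<eta> by linarith
    next
      case False
      have "real (Suc j) * \<eta> \<ge> (real (Suc i) + 1) * \<eta>" using ij \<eta> by (intro mult_right_mono) auto
      then have "real (Suc j) * \<eta> \<ge> real (Suc i) * \<eta> + \<eta>" by (simp add: algebra_simps)
      moreover have "\<bar>s * (z (Suc i) - m) - real (Suc i) * \<eta>\<bar> \<le> \<eta> / 4"
        using zi False by (simp add: J_def)
      ultimately show ?thesis unfolding diff using jj \<eta> by linarith
    qed
    then have "\<eta> / 2 \<le> \<bar>z (Suc j) - z (Suc i)\<bar>" using s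
      by (metis abs_ge_self abs_mult mult_1 order_trans)
    then show "(\<eta> / 2)\<^sup>2 \<le> (z (Suc j) - z (Suc i))\<^sup>2"
      using \<eta> by (metis abs_le_square_iff abs_of_nonneg half_gt_zero less_imp_le)
  qed (use \<eta> in auto)
  have "ennreal c * (\<Prod>k\<in>{1..n}. I k) = ennreal c * (\<integral>\<^sup>+z. (\<Prod>k\<in>{1..n}. indicator (J k) (z k) * ennreal \<bar>w (z k)\<bar>) \<partial>?M)"
    unfolding I_def by (subst product_nn_integral_prod) auto
  also have "\<dots> = (\<integral>\<^sup>+z. ennreal c * (\<Prod>k\<in>{1..n}. indicator (J k) (z k) * ennreal \<bar>w (z k)\<bar>) \<partial>?M)"
    by (rule nn_integral_cmult[symmetric]) measurable
  also have "\<dots> \<le> (\<integral>\<^sup>+z. ennreal ((Vdm n z)\<^sup>2 * (\<Prod>k\<in>{1..n}. \<bar>w (z k)\<bar>)) \<partial>?M)"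
  proof (rule nn_integral_mono)
    fix z :: "nat \<Rightarrow> real"
    show "ennreal c * (\<Prod>k\<in>{1..n}. indicator (J k) (z k) * ennreal \<bar>w (z k)\<bar>) \<le>
        ennreal ((Vdm n z)\<^sup>2 * (\<Prod>k\<in>{1..n}. \<bar>w (z k)\<bar>))"
    proof (cases "\<forall>k\<in>{1..n}. z k \<in> J k")
      case True
      then have "ennreal c * (\<Prod>k\<in>{1..n}. indicator (J k) (z k) * ennreal \<bar>w (z k)\<bar>) =
          ennreal (c * (\<Prod>k\<in>{1..n}. \<bar>w (z k)\<bar>))"
        using c by (simp add: ennreal_mult prod_ennreal prod_nonneg)
      also have "\<dots> \<le> ennreal ((Vdm n z)\<^sup>2 * (\<Prod>k\<in>{1..n}. \<bar>w (z k)\<bar>))"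
        using lower True by (intro ennreal_leI mult_right_mono) (auto intro: prod_nonneg)
      finally show ?thesis .
    next
      case False
      then obtain k where "k \<in> {1..n}" "z k \<notin> J k" by blast
      then have "(\<Prod>k\<in>{1..n}. indicator (J k) (z k) * ennreal \<bar>w (z k)\<bar>) = 0"
        by (intro prod_zero bexI[of _ k]) simp_all
      then show ?thesis by (simp only: mult_zero_right zero_le)
    qed
  qed
  also have "(\<Prod>k\<in>{1..n}. I k) = I 1 * (\<Prod>k\<in>{2..n}. I k)"
  proof -
    have "{1..n} = insert 1 {2..n}" using n by auto
    then show ?thesis by simp
  qed
  finally have "ennreal c * (\<Prod>k\<in>{2..n}. I k) * I 1 \<le>
      (\<integral>\<^sup>+z. ennreal ((Vdm n z)\<^sup>2 * (\<Prod>k\<in>{1..n}. \<bar>w (z k)\<bar>)) \<partial>?M)"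
    by (simp add: mult_ac)
  moreover have "ennreal c * (\<Prod>k\<in>{2..n}. I k) \<noteq> 0"
    using c I by (auto simp: prod_zero_iff)
  ultimately show ?thesis unfolding I_def J_def by (intro exI[of _ "ennreal c * (\<Prod>k\<in>{2..n}. I k)"]) (simp add: I_def J_def)
qed

text \<open>The two signs in \<open>half_line_integral_bound\<close> give two half lines, which
  together cover the real line.\<close>

lemma integrable_weight_of_integrable:
  fixes w :: "real \<Rightarrow> real"
  assumes n: "n \<ge> 1" and w[measurable]: "w \<in> borel_measurable borel"
    and pq: "p < q" "\<And>z. p < z \<Longrightarrow> z < q \<Longrightarrow> w z \<noteq> 0"
    and int: "integrable (PiM {1..n} (\<lambda>_. lborel)) (\<lambda>z. (Vdm n z)\<^sup>2 * (\<Prod>k\<in>{1..n}. w (z k)))"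
  shows "integrable lborel w"
proof -
  let ?m = "(p + q) / 2" and ?M = "PiM {1..n} (\<lambda>_. lborel) :: (nat \<Rightarrow> real) measure"
  let ?Y = "\<lambda>s. {z. s * (z - ?m) \<le> 0}"
  have fin: "(\<integral>\<^sup>+z. ennreal ((Vdm n z)\<^sup>2 * (\<Prod>k\<in>{1..n}. \<bar>w (z k)\<bar>)) \<partial>?M) < \<infinity>"
    using int unfolding integrable_iff_bounded by (simp add: abs_mult abs_prod)
  have half: "(\<integral>\<^sup>+z. indicator (?Y s) z * ennreal \<bar>w z\<bar> \<partial>lborel) < \<infinity>" if s: "\<bar>s\<bar> = 1" for s
  proof -
    obtain K where "K \<noteq> 0" "K * (\<integral>\<^sup>+z. indicator (?Y s) z * ennreal \<bar>w z\<bar> \<partial>lborel) \<le>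
        (\<integral>\<^sup>+z. ennreal ((Vdm n z)\<^sup>2 * (\<Prod>k\<in>{1..n}. \<bar>w (z k)\<bar>)) \<partial>?M)"
      using half_line_integral_bound[OF n w pq s] by blast
    then have "K \<noteq> 0" "K * (\<integral>\<^sup>+z. indicator (?Y s) z * ennreal \<bar>w z\<bar> \<partial>lborel) < \<infinity>"
      using fin by (auto intro: le_less_trans)
    then show ?thesis by (auto simp: ennreal_mult_less_top less_top)
  qed
  have "(\<integral>\<^sup>+z. ennreal (norm (w z)) \<partial>lborel) \<le>
      (\<integral>\<^sup>+z. indicator (?Y 1) z * ennreal \<bar>w z\<bar> + indicator (?Y (-1)) z * ennreal \<bar>w z\<bar> \<partial>lborel)"
    by (intro nn_integral_mono) (auto simp: indicator_def)
  also have "\<dots> = (\<integral>\<^sup>+z. indicator (?Y 1) z * ennreal \<bar>w z\<bar> \<partial>lborel) +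
      (\<integral>\<^sup>+z. indicator (?Y (-1)) z * ennreal \<bar>w z\<bar> \<partial>lborel)"
    by (intro nn_integral_add) auto
  also have "\<dots> < \<infinity>" using half[of 1] half[of "-1"] by (simp add: less_top)
  finally show ?thesis unfolding integrable_iff_bounded by simp
qed

text \<open>The bound from below is nonzero already because of the mass of \<open>w\<close> on the
  left half of the interval from p to q.\<close>

lemma integral_Vdm_squared_pos:
  fixes w :: "real \<Rightarrow> real"
  assumes n: "n \<ge> 1" and w[measurable]: "w \<in> borel_measurable borel"
    and pq: "p < q" "\<And>z. p < z \<Longrightarrow> z < q \<Longrightarrow> w z \<noteq> 0" and nonneg: "\<And>z. w z \<ge> 0"
    and int: "integrable (PiM {1..n} (\<lambda>_. lborel)) (\<lambda>z. (Vdm n z)\<^sup>2 * (\<Prod>k\<in>{1..n}. w (z k)))"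
  shows "0 < (\<integral>z. (Vdm n z)\<^sup>2 * (\<Prod>k\<in>{1..n}. w (z k)) \<partial>PiM {1..n} (\<lambda>_. lborel))"
proof -
  let ?m = "(p + q) / 2" and ?M = "PiM {1..n} (\<lambda>_. lborel) :: (nat \<Rightarrow> real) measure"
  let ?Y = "{z. 1 * (z - ?m) \<le> 0}"
  obtain K where K: "K \<noteq> 0" "K * (\<integral>\<^sup>+z. indicator ?Y z * ennreal \<bar>w z\<bar> \<partial>lborel) \<le>
      (\<integral>\<^sup>+z. ennreal ((Vdm n z)\<^sup>2 * (\<Prod>k\<in>{1..n}. \<bar>w (z k)\<bar>)) \<partial>?M)"
    using half_line_integral_bound[OF n w pq, of 1] by auto
  have "(\<integral>\<^sup>+z. indicator ?Y z * ennreal \<bar>w z\<bar> \<partial>lborel) \<noteq> 0"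
  proof
    assume "(\<integral>\<^sup>+z. indicator ?Y z * ennreal \<bar>w z\<bar> \<partial>lborel) = 0"
    then have "AE z in lborel. indicator ?Y z * ennreal \<bar>w z\<bar> = 0"
      by (subst (asm) nn_integral_0_iff_AE) auto
    then have "AE z in lborel. z \<notin> {p<..<?m}"
    proof eventually_elim
      case (elim z)
      show ?case
      proof
        assume "z \<in> {p<..<?m}"
        then show False using pq(1) pq(2)[of z] elim by (auto simp: field_simps)
      qed
    qed
    then have "{p<..<?m} \<in> null_sets lborel" by (subst AE_iff_null_sets) auto
    then have "emeasure lborel {p<..<?m} = 0" by (rule null_setsD1)
    then show False using pq(1) by (simp add: field_simps)
  qed
  then have "(\<integral>\<^sup>+z. ennreal ((Vdm n z)\<^sup>2 * (\<Prod>k\<in>{1..n}. w (z k))) \<partial>?M) \<noteq> 0"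
    using K nonneg by auto
  also have "(\<integral>\<^sup>+z. ennreal ((Vdm n z)\<^sup>2 * (\<Prod>k\<in>{1..n}. w (z k))) \<partial>?M) =
      ennreal (\<integral>z. (Vdm n z)\<^sup>2 * (\<Prod>k\<in>{1..n}. w (z k)) \<partial>?M)"
    using int nonneg by (intro nn_integral_eq_integral AE_I2 mult_nonneg_nonneg prod_nonneg) auto
  finally show ?thesis by (simp add: ennreal_eq_0_iff)
qed

section \<open>Moments of an exponentially tilted weight\<close>

lemma power_div_fact_le_exp:
  fixes t :: real
  assumes "t \<ge> 0"
  shows "t ^ k / fact k \<le> exp t"
proof -
  have s: "summable (\<lambda>n. t ^ n / fact n)"
    using summable_exp_generic[of t] by (simp add: divide_inverse mult.commute)
  have "(\<Sum>n\<in>{k}. t ^ n / fact n) \<le> (\<Sum>n. t ^ n / fact n)"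
    using assms by (intro sum_le_suminf s) auto
  then show ?thesis by (simp add: exp_def divide_inverse mult.commute)
qed

text \<open>Convergence at parameters on both sides of \<open>y\<close> leaves a margin
  \<open>d\<close>: \<open>exp (d * \<bar>z\<bar>)\<close> absorbs the power of z, and the resulting
  \<open>exp (x * z + e * \<bar>z\<bar>)\<close> is at most the sum of the two given
  exponentials.\<close>

lemma integrable_power_exp:
  fixes v :: "real \<Rightarrow> real"
  assumes v[measurable]: "v \<in> borel_measurable borel" and y: "\<bar>y - x\<bar> < e"
    and int: "integrable lborel (\<lambda>z. exp ((x + e) * z) * v z)" "integrable lborel (\<lambda>z. exp ((x - e) * z) * v z)"
  shows "integrable lborel (\<lambda>z. z ^ k * (exp (y * z) * v z))"
proof -
  define d where "d = e - \<bar>y - x\<bar>"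
  have d: "d > 0" using y by (simp add: d_def)
  let ?C = "fact k / d ^ k"
  have bound: "\<bar>z\<bar> ^ k * exp (y * z) \<le> ?C * (exp ((x + e) * z) + exp ((x - e) * z))" for z
  proof -
    have "(d * \<bar>z\<bar>) ^ k / fact k \<le> exp (d * \<bar>z\<bar>)" using d by (intro power_div_fact_le_exp) simp
    then have "\<bar>z\<bar> ^ k \<le> ?C * exp (d * \<bar>z\<bar>)" using d by (simp add: field_simps power_mult_distrib)
    then have "\<bar>z\<bar> ^ k * exp (y * z) \<le> ?C * exp (d * \<bar>z\<bar>) * exp (y * z)"
      by (intro mult_right_mono) auto
    also have "\<dots> \<le> ?C * exp (d * \<bar>z\<bar>) * (exp (x * z) * exp ((e - d) * \<bar>z\<bar>))"
    proof (rule mult_left_mono)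
      have "(y - x) * z \<le> \<bar>y - x\<bar> * \<bar>z\<bar>" by (metis abs_ge_self abs_mult)
      then show "exp (y * z) \<le> exp (x * z) * exp ((e - d) * \<bar>z\<bar>)"
        by (simp add: exp_add[symmetric] d_def algebra_simps)
    qed (use d in simp)
    also have "?C * exp (d * \<bar>z\<bar>) * (exp (x * z) * exp ((e - d) * \<bar>z\<bar>)) = ?C * exp (x * z + e * \<bar>z\<bar>)"
      by (simp add: exp_add[symmetric] mult.assoc) (simp add: algebra_simps)
    also have "\<dots> \<le> ?C * (exp ((x + e) * z) + exp ((x - e) * z))"
      using d by (intro mult_left_mono) (auto simp: abs_if algebra_simps add_increasing add_increasing2)
    finally show ?thesis .
  qed
  show ?thesis
  proof (rule Bochner_Integration.integrable_bound)
    show "integrable lborel (\<lambda>z. ?C * (\<bar>exp ((x + e) * z) * v z\<bar> + \<bar>exp ((x - e) * z) * v z\<bar>))"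
      using int by auto
    show "AE z in lborel. norm (z ^ k * (exp (y * z) * v z)) \<le>
        norm (?C * (\<bar>exp ((x + e) * z) * v z\<bar> + \<bar>exp ((x - e) * z) * v z\<bar>))"
    proof (rule AE_I2)
      fix z
      have "norm (z ^ k * (exp (y * z) * v z)) = \<bar>z\<bar> ^ k * exp (y * z) * \<bar>v z\<bar>"
        by (simp add: abs_mult power_abs)
      also have "\<dots> \<le> ?C * (exp ((x + e) * z) + exp ((x - e) * z)) * \<bar>v z\<bar>"
        using bound by (intro mult_right_mono) auto
      also have "\<dots> = norm (?C * (\<bar>exp ((x + e) * z) * v z\<bar> + \<bar>exp ((x - e) * z) * v z\<bar>))"
        using d by (simp add: abs_mult algebra_simps)
      finally show "norm (z ^ k * (exp (y * z) * v z)) \<le>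
        norm (?C * (\<bar>exp ((x + e) * z) * v z\<bar> + \<bar>exp ((x - e) * z) * v z\<bar>))" .
    qed
  qed measurable
qed

lemma abs_exp_minus_linear_le: "\<bar>exp u - 1 - u\<bar> \<le> u\<^sup>2 * exp \<bar>u\<bar>" for u :: real
proof -
  obtain t where t: "\<bar>t\<bar> \<le> \<bar>u\<bar>" "exp u = (\<Sum>m<2. u ^ m / fact m) + exp t / fact 2 * u ^ 2"
    using Maclaurin_exp_le[of u 2] by auto
  then have "exp u - 1 - u = exp t / 2 * u\<^sup>2" by (simp add: eval_nat_numeral)
  then have "\<bar>exp u - 1 - u\<bar> = exp t / 2 * u\<^sup>2" by (simp only: abs_mult) simp
  also have "\<dots> \<le> exp \<bar>u\<bar> * u\<^sup>2"
  proof (rule mult_right_mono)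
    have "exp t \<le> exp \<bar>u\<bar>" using t(1) by simp
    moreover have "exp t / 2 \<le> exp t" by simp
    ultimately show "exp t / 2 \<le> exp \<bar>u\<bar>" by linarith
  qed simp
  finally show ?thesis by (simp add: mult.commute)
qed

text \<open>Differentiation under the integral with an explicit error: by the Taylor remainder the
  difference quotient misses the next moment by at most \<open>B * \<bar>h\<bar>\<close>.\<close>

lemma moment_has_real_derivative:
  fixes v :: "real \<Rightarrow> real"
  assumes v[measurable]: "v \<in> borel_measurable borel" and e: "e > 0"
    and int: "integrable lborel (\<lambda>z. exp ((x + e) * z) * v z)" "integrable lborel (\<lambda>z. exp ((x - e) * z) * v z)"
  defines "\<mu> \<equiv> \<lambda>k x. \<integral>z. z ^ k * (exp (x * z) * v z) \<partial>lborel"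
  shows "(\<mu> k has_real_derivative \<mu> (Suc k) x) (at x)"
proof -
  have I: "integrable lborel (\<lambda>z. z ^ k * (exp (y * z) * v z))" if "\<bar>y - x\<bar> < e" for k y
    by (rule integrable_power_exp[OF v that int])
  \<comment> \<open>The remainder contributes z^2 and \<open>exp \<bar>h * z\<bar>\<close>. For
    \<open>\<bar>h\<bar> \<le> e / 2\<close> it is dominated by the absolute moments of order k + 2
    at the parameters \<open>x + e / 2\<close> and \<open>x - e / 2\<close>.\<close>
  define w where "w z = z ^ (k + 2) * (exp ((x + e / 2) * z) * v z)" for z
  define w' where "w' z = z ^ (k + 2) * (exp ((x - e / 2) * z) * v z)" for z
  define B where "B = (\<integral>z. \<bar>w z\<bar> + \<bar>w' z\<bar> \<partial>lborel)"
  have W: "integrable lborel (\<lambda>z. \<bar>w z\<bar> + \<bar>w' z\<bar>)"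
    unfolding w_def w'_def using I[of "x + e / 2" "k + 2"] I[of "x - e / 2" "k + 2"] e by (intro Bochner_Integration.integrable_add integrable_abs) auto
  have bound: "\<bar>(\<mu> k (x + h) - \<mu> k x) / h - \<mu> (Suc k) x\<bar> \<le> B * \<bar>h\<bar>" if h: "h \<noteq> 0" "\<bar>h\<bar> \<le> e / 2" for h
  proof -
    have I3: "integrable lborel (\<lambda>z. z ^ k * (exp ((x + h) * z) * v z))" "integrable lborel (\<lambda>z. z ^ k * (exp (x * z) * v z))"
      "integrable lborel (\<lambda>z. z ^ Suc k * (exp (x * z) * v z))"
      using I[of "x + h" k] I[of x k] I[of x "Suc k"] h e by auto
    have "\<bar>\<mu> k (x + h) - \<mu> k x - h * \<mu> (Suc k) x\<bar> =
        \<bar>\<integral>z. z ^ k * (exp ((x + h) * z) * v z) - z ^ k * (exp (x * z) * v z) - h * (z ^ Suc k * (exp (x * z) * v z)) \<partial>lborel\<bar>"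
      unfolding \<mu>_def using I3 by (simp del: power_Suc)
    also have "\<dots> \<le> (\<integral>z. h\<^sup>2 * (\<bar>w z\<bar> + \<bar>w' z\<bar>) \<partial>lborel)"
    proof (rule integral_abs_bound[THEN order_trans], rule integral_mono)
      show "integrable lborel (\<lambda>z. h\<^sup>2 * (\<bar>w z\<bar> + \<bar>w' z\<bar>))" using W by (rule integrable_mult_right)
      show "integrable lborel (\<lambda>z. \<bar>z ^ k * (exp ((x + h) * z) * v z) - z ^ k * (exp (x * z) * v z) -
          h * (z ^ Suc k * (exp (x * z) * v z))\<bar>)"
        by (intro integrable_abs Bochner_Integration.integrable_diff integrable_mult_right I3)
      fix z
      have "\<bar>z ^ k * (exp ((x + h) * z) * v z) - z ^ k * (exp (x * z) * v z) - h * (z ^ Suc k * (exp (x * z) * v z))\<bar> =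
          \<bar>z\<bar> ^ k * exp (x * z) * \<bar>v z\<bar> * \<bar>exp (h * z) - 1 - h * z\<bar>"
      proof -
        have "z ^ k * (exp ((x + h) * z) * v z) - z ^ k * (exp (x * z) * v z) - h * (z ^ Suc k * (exp (x * z) * v z)) =
            z ^ k * exp (x * z) * v z * (exp (h * z) - 1 - h * z)"
          by (simp add: distrib_right exp_add algebra_simps)
        then show ?thesis by (simp add: abs_mult power_abs)
      qed
      also have "\<dots> \<le> \<bar>z\<bar> ^ k * exp (x * z) * \<bar>v z\<bar> * ((h * z)\<^sup>2 * exp \<bar>h * z\<bar>)"
        by (intro mult_left_mono abs_exp_minus_linear_le) auto
      also have "\<dots> \<le> \<bar>z\<bar> ^ k * exp (x * z) * \<bar>v z\<bar> * ((h * z)\<^sup>2 * (exp (e / 2 * z) + exp (- (e / 2 * z))))"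
      proof (intro mult_left_mono)
        have "\<bar>h * z\<bar> \<le> e / 2 * \<bar>z\<bar>" using mult_right_mono[OF h(2), of "\<bar>z\<bar>"] by (simp add: abs_mult)
        then have "exp \<bar>h * z\<bar> \<le> exp (e / 2 * \<bar>z\<bar>)" by simp
        also have "\<dots> \<le> exp (e / 2 * z) + exp (- (e / 2 * z))"
          by (cases "z \<ge> 0") (auto simp: add_increasing add_increasing2)
        finally show "exp \<bar>h * z\<bar> \<le> exp (e / 2 * z) + exp (- (e / 2 * z))" .
      qed auto
      also have "\<dots> = h\<^sup>2 * (\<bar>w z\<bar> + \<bar>w' z\<bar>)"
      proof -
        have "exp ((x + e / 2) * z) = exp (x * z) * exp (e / 2 * z)" "exp ((x - e / 2) * z) = exp (x * z) * exp (- (e / 2 * z))"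
          by (simp_all add: exp_add[symmetric] algebra_simps)
        moreover have "\<bar>z ^ (k + 2)\<bar> = \<bar>z\<bar> ^ k * z\<^sup>2"
          by (simp only: power_add abs_mult power_abs power2_abs)
        ultimately show ?thesis
          unfolding w_def w'_def abs_mult by (simp add: power_mult_distrib algebra_simps)
      qed
      finally show "\<bar>z ^ k * (exp ((x + h) * z) * v z) - z ^ k * (exp (x * z) * v z) - h * (z ^ Suc k * (exp (x * z) * v z))\<bar> \<le>
          h\<^sup>2 * (\<bar>w z\<bar> + \<bar>w' z\<bar>)" .
    qed
    also have "\<dots> = h\<^sup>2 * B" by (simp add: B_def)
    finally have "\<bar>\<mu> k (x + h) - \<mu> k x - h * \<mu> (Suc k) x\<bar> / \<bar>h\<bar> \<le> h\<^sup>2 * B / \<bar>h\<bar>"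
      by (intro divide_right_mono) auto
    moreover have "(\<mu> k (x + h) - \<mu> k x) / h - \<mu> (Suc k) x = (\<mu> k (x + h) - \<mu> k x - h * \<mu> (Suc k) x) / h"
      using h by (simp add: field_simps)
    moreover have "h\<^sup>2 * B / \<bar>h\<bar> = B * \<bar>h\<bar>" using h by (simp add: power2_eq_square abs_if)
    ultimately show ?thesis by (simp add: abs_divide)
  qed
  have "((\<lambda>h. (\<mu> k (x + h) - \<mu> k x) / h - \<mu> (Suc k) x) \<longlongrightarrow> 0) (at 0)"
  proof (rule Lim_null_comparison)
    have "eventually (\<lambda>h. h \<noteq> 0 \<and> \<bar>h\<bar> \<le> e / 2) (at 0)"
      unfolding eventually_at using e by (intro exI[of _ "e / 2"]) (auto simp: dist_real_def)
    then show "eventually (\<lambda>h. norm ((\<mu> k (x + h) - \<mu> k x) / h - \<mu> (Suc k) x) \<le> B * \<bar>h\<bar>) (at 0)"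
      by eventually_elim (use bound in simp)
    show "((\<lambda>h. B * \<bar>h\<bar>) \<longlongrightarrow> 0) (at 0)" by (auto intro!: tendsto_eq_intros)
  qed
  then show ?thesis by (simp add: DERIV_def LIM_zero_iff)
qed

section \<open>Integration by parts across integrable singularities\<close>

text \<open>Of three frontier points the middle one would lie in the interior of the closure, which
  for a convex set is its interior.\<close>

lemma finite_frontier_is_interval:
  fixes E :: "real set"
  assumes "is_interval E"
  shows "finite (frontier E)"
proof (rule ccontr)
  have E: "convex E" using assms by (simp add: is_interval_convex_1)
  have P: False if "a \<in> frontier E" "b \<in> frontier E" "c \<in> frontier E" "a < b" "b < c" for a b c
  proof -
    have "{a..c} \<subseteq> closure E"
      using that convex_closure[OF E] by (auto simp: frontier_def is_interval_convex_1[symmetric] is_interval_1)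
    then have "{a<..<c} \<subseteq> interior (closure E)"
      by (intro interior_maximal) auto
    then have "b \<in> interior E" using that convex_interior_closure[OF E] by auto
    then show False using that by (simp add: frontier_def)
  qed
  assume "infinite (frontier E)"
  then obtain B where B: "finite B" "card B = 3" "B \<subseteq> frontier E"
    using infinite_arbitrarily_large by blast
  from B(2) obtain x y z where xyz: "B = {x, y, z}" "x \<noteq> y" "y \<noteq> z" "x \<noteq> z"
    by (auto simp: card_3_iff)
  have m: "x \<in> frontier E" "y \<in> frontier E" "z \<in> frontier E" using B xyz by auto
  show False
    using xyz m P[of x y z] P[of x z y] P[of y x z] P[of y z x] P[of z x y] P[of z y x]
    by linarith
qed

lemma finite_zeros_quadratic:
  fixes a0 a1 a2 :: real
  assumes "a0 \<noteq> 0 \<or> a1 \<noteq> 0 \<or> a2 \<noteq> 0"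
  shows "finite {z. a0 + a1 * z + a2 * z\<^sup>2 = 0}"
proof -
  have "finite {z. poly [:a0, a1, a2:] z = 0}" using assms by (intro poly_roots_finite) auto
  then show ?thesis by (simp add: power2_eq_square algebra_simps)
qed

lemma abs_integral_le_total:
  fixes f :: "real \<Rightarrow> real"
  assumes "integrable lborel f"
  shows "f integrable_on {s..t}" "(\<lambda>z. \<bar>f z\<bar>) integrable_on {s..t}"
    "integral {s..t} (\<lambda>z. \<bar>f z\<bar>) \<le> integral UNIV (\<lambda>z. \<bar>f z\<bar>)"
proof -
  have "f integrable_on UNIV" using integrable_on_lborel[OF assms] .
  then show "f integrable_on {s..t}" by (rule integrable_on_subinterval) simp
  have a: "(\<lambda>z. \<bar>f z\<bar>) integrable_on UNIV"
    using integrable_on_lborel[OF integrable_abs[OF assms]] .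
  then show b: "(\<lambda>z. \<bar>f z\<bar>) integrable_on {s..t}" by (rule integrable_on_subinterval) simp
  show "integral {s..t} (\<lambda>z. \<bar>f z\<bar>) \<le> integral UNIV (\<lambda>z. \<bar>f z\<bar>)"
    by (rule integral_subset_le) (use a b in auto)
qed

text \<open>
  If \<open>F\<close> stayed away from \<open>0\<close> near \<open>p\<close>, then \<open>\<phi>\<close> would dominate a multiple of \<open>1 / (z - p)\<close>,
  whose integral diverges logarithmically.
\<close>

lemma tendsto_0_at_right_of_integrable_quotient:
  fixes F f \<phi> :: "real \<Rightarrow> real"
  assumes \<delta>: "\<delta> > 0" and C: "C > 0"
    and F: "\<And>z. p < z \<Longrightarrow> z < p + \<delta> \<Longrightarrow> (F has_real_derivative f z) (at z)"
    and f: "integrable lborel f" and \<phi>: "integrable lborel \<phi>"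
    and bound: "\<And>z. p < z \<Longrightarrow> z < p + \<delta> \<Longrightarrow> \<bar>F z\<bar> \<le> C * (z - p) * \<bar>\<phi> z\<bar>"
  shows "(F \<longlongrightarrow> 0) (at_right p)"
proof -
  \<comment> \<open>\<open>N t\<close> bounds the variation of \<open>F\<close> between p and t and
    tends to 0 with t - p, so it is enough to bound \<open>F\<close> by \<open>N\<close>.\<close>
  define N where "N t = integral {p..t} (\<lambda>z. \<bar>f z\<bar>)" for t
  define M where "M = integral UNIV (\<lambda>z. \<bar>\<phi> z\<bar>)"
  have diff: "\<bar>F t - F s\<bar> \<le> N t" if "p < s" "s \<le> t" "t < p + \<delta>" for s t
  proof -
    have "(f has_integral (F t - F s)) {s..t}"
    proof (rule fundamental_theorem_of_calculus[OF that(2)])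
      fix z assume "z \<in> {s..t}"
      then have "(F has_real_derivative f z) (at z)" using F[of z] that by simp
      then show "(F has_vector_derivative f z) (at z within {s..t})"
        by (simp add: has_real_derivative_iff_has_vector_derivative has_vector_derivative_at_within)
    qed
    then have "\<bar>F t - F s\<bar> = \<bar>integral {s..t} f\<bar>" by (simp add: integral_unique)
    also have "\<dots> \<le> integral {s..t} (\<lambda>z. \<bar>f z\<bar>)"
      using integral_norm_bound_integral[OF abs_integral_le_total(1)[OF f, of s t] abs_integral_le_total(2)[OF f, of s t]] by simp
    also have "\<dots> \<le> N t"
      unfolding N_def using that by (intro integral_subset_le abs_integral_le_total f) auto
    finally show ?thesis .
  qed
  have le: "\<bar>F t\<bar> \<le> N t" if t: "p < t" "t < p + \<delta>" for t
  proof (rule ccontr)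
    assume "\<not> \<bar>F t\<bar> \<le> N t"
    \<comment> \<open>An excess over \<open>N t\<close> persists at every point between p and t,
      since \<open>F\<close> varies there by at most \<open>N t\<close>.\<close>
    define \<epsilon> where "\<epsilon> = \<bar>F t\<bar> - N t"
    have \<epsilon>: "\<epsilon> > 0" using \<open>\<not> _\<close> by (simp add: \<epsilon>_def)
    have low: "\<epsilon> / C * (1 / (s - p)) \<le> \<bar>\<phi> s\<bar>" if "p < s" "s \<le> t" for s
    proof -
      have "\<epsilon> \<le> \<bar>F s\<bar>" using diff[of s t] that t by (simp add: \<epsilon>_def)
      also have "\<dots> \<le> C * (s - p) * \<bar>\<phi> s\<bar>" using bound that t by simp
      finally show ?thesis using that C by (simp add: field_simps)
    qed
    \<comment> \<open>On a logarithmic scale, \<open>r\<close> is the length over which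
      \<open>\<epsilon> / C * (1 / (z - p))\<close> integrates to \<open>M + 1\<close>, more than
      the whole mass \<open>M\<close> of \<open>\<bar>\<phi>\<bar>\<close>.\<close>
    define r where "r = (M + 1) * C / \<epsilon>"
    define s where "s = p + (t - p) * exp (- r)"
    have M: "M \<ge> 0" unfolding M_def by (rule integral_nonneg) (use integrable_on_lborel[OF integrable_abs[OF \<phi>]] in auto)
    have r: "r \<ge> 0" using M C \<epsilon> by (simp add: r_def)
    have s: "p < s" "s \<le> t"
    proof -
      have "(t - p) * exp (- r) \<le> (t - p) * 1" using t r by (intro mult_left_mono) auto
      then show "s \<le> t" by (simp add: s_def)
      show "p < s" using t by (simp add: s_def)
    qed
    have "((\<lambda>z. \<epsilon> / C * (1 / (z - p))) has_integral (\<epsilon> / C * ln (t - p) - \<epsilon> / C * ln (s - p))) {s..t}"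
    proof (rule fundamental_theorem_of_calculus[OF s(2)])
      fix z assume "z \<in> {s..t}"
      then have "((\<lambda>z. \<epsilon> / C * ln (z - p)) has_real_derivative \<epsilon> / C * (1 / (z - p))) (at z)"
        using s C by (auto intro!: derivative_eq_intros)
      then show "((\<lambda>z. \<epsilon> / C * ln (z - p)) has_vector_derivative \<epsilon> / C * (1 / (z - p))) (at z within {s..t})"
        by (simp add: has_real_derivative_iff_has_vector_derivative has_vector_derivative_at_within)
    qed
    moreover have "\<epsilon> / C * ln (t - p) - \<epsilon> / C * ln (s - p) = M + 1"
    proof -
      have "ln (s - p) = ln (t - p) - r" using t by (simp add: s_def ln_mult)
      then have "\<epsilon> / C * ln (t - p) - \<epsilon> / C * ln (s - p) = \<epsilon> / C * r"
        by (simp only: right_diff_distrib)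
      also have "\<dots> = M + 1" using C \<epsilon> by (simp add: r_def)
      finally show ?thesis .
    qed
    ultimately have "((\<lambda>z. \<epsilon> / C * (1 / (z - p))) has_integral (M + 1)) {s..t}" by simp
    moreover have "((\<lambda>z. \<bar>\<phi> z\<bar>) has_integral integral {s..t} (\<lambda>z. \<bar>\<phi> z\<bar>)) {s..t}"
      using abs_integral_le_total(2)[OF \<phi>] by (rule integrable_integral)
    ultimately have "M + 1 \<le> integral {s..t} (\<lambda>z. \<bar>\<phi> z\<bar>)"
      by (rule has_integral_le) (use low s in auto)
    also have "\<dots> \<le> M" unfolding M_def by (rule abs_integral_le_total[OF \<phi>])
    finally show False by simp
  qed
  have "continuous_on {p..p + \<delta>} N"
    unfolding N_def by (intro indefinite_integral_continuous_1 abs_integral_le_total f)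
  then have "(N \<longlongrightarrow> N p) (at p within {p..p + \<delta>})"
    using \<delta> by (auto simp: continuous_on_def)
  moreover have "at p within {p..p + \<delta>} = at_right p"
    using \<delta> at_within_Icc_at_right[of p "p + \<delta>"] by simp
  ultimately have "(N \<longlongrightarrow> 0) (at_right p)" by (simp add: N_def)
  moreover have "eventually (\<lambda>z. norm (F z) \<le> N z) (at_right p)"
    unfolding eventually_at_right_field using le \<delta> by (intro exI[of _ "p + \<delta>"]) auto
  ultimately show ?thesis by (rule Lim_null_comparison[rotated])
qed

text \<open>The limit from the left is the limit from the right for the reflected functions.\<close>

lemma tendsto_0_at_of_integrable_quotient:
  fixes F f \<phi> :: "real \<Rightarrow> real"
  assumes \<delta>: "\<delta> > 0" and C: "C > 0"
    and F: "\<And>z. z \<noteq> p \<Longrightarrow> \<bar>z - p\<bar> < \<delta> \<Longrightarrow> (F has_real_derivative f z) (at z)"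
    and f: "integrable lborel f" and \<phi>: "integrable lborel \<phi>"
    and bound: "\<And>z. z \<noteq> p \<Longrightarrow> \<bar>z - p\<bar> < \<delta> \<Longrightarrow> \<bar>F z\<bar> \<le> C * \<bar>z - p\<bar> * \<bar>\<phi> z\<bar>"
  shows "(F \<longlongrightarrow> 0) (at p)"
proof (rule filterlim_split_at)
  show "(F \<longlongrightarrow> 0) (at_right p)"
  proof (rule tendsto_0_at_right_of_integrable_quotient[OF \<delta> C _ f \<phi>])
    fix z assume z: "p < z" "z < p + \<delta>"
    show "(F has_real_derivative f z) (at z)" using F z by simp
    show "\<bar>F z\<bar> \<le> C * (z - p) * \<bar>\<phi> z\<bar>" using bound[of z] z by simp
  qed
  have "((\<lambda>z. F (- z)) \<longlongrightarrow> 0) (at_right (- p))"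
  proof (rule tendsto_0_at_right_of_integrable_quotient[OF \<delta> C])
    show "integrable lborel (\<lambda>z. - f (- z))" "integrable lborel (\<lambda>z. \<phi> (- z))"
      using lborel_integrable_real_affine[OF f, of "-1" 0] lborel_integrable_real_affine[OF \<phi>, of "-1" 0] by simp_all
    fix z assume z: "- p < z" "z < - p + \<delta>"
    show "((\<lambda>z. F (- z)) has_real_derivative - f (- z)) (at z)"
      using DERIV_chain2[OF F[of "- z"] DERIV_minus[OF DERIV_ident]] z by simp
    show "\<bar>F (- z)\<bar> \<le> C * (z - (- p)) * \<bar>\<phi> (- z)\<bar>" 
    proof -
      have "\<bar>- z - p\<bar> = z - (- p)" using z by simp
      then show ?thesis using bound[of "- z"] z by (simp add: add.commute)
    qed
  qed
  then show "(F \<longlongrightarrow> 0) (at_left p)"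
    by (simp add: at_left_minus[of p] filterlim_filtermap)
qed

text \<open>On symmetric intervals the integral of \<open>f\<close> is \<open>F t - F (- t)\<close>.
  If the limit were nonzero, \<open>\<bar>F t\<bar> + \<bar>F (- t)\<bar>\<close> would stay away
  from 0 for large t, against the integrability of \<open>F\<close>. The set \<open>K\<close> admits
  points where \<open>F\<close> is continuous without being differentiable.\<close>

lemma integral_derivative_eq_0:
  fixes F f :: "real \<Rightarrow> real"
  assumes K: "finite K" and F: "\<And>z. z \<notin> K \<Longrightarrow> (F has_real_derivative f z) (at z)"
    and cont: "continuous_on UNIV F" and int_F: "integrable lborel F" and int_f: "integrable lborel f"
  shows "(\<integral>z. f z \<partial>lborel) = 0"
proof (rule ccontr)
  let ?I = "\<integral>z. f z \<partial>lborel"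
  assume I: "?I \<noteq> 0"
  have ftc: "(f has_integral (F t - F (- t))) {- t..t}" if "t \<ge> 0" for t
  proof (rule fundamental_theorem_of_calculus_strong[OF K])
    show "continuous_on {- t..t} F" by (rule continuous_on_subset[OF cont]) simp
    show "- t \<le> t" using that by simp
    fix z assume "z \<in> {- t..t} - K"
    then show "(F has_vector_derivative f z) (at z)"
      using F[of z] by (simp add: has_real_derivative_iff_has_vector_derivative)
  qed
  have "(f has_integral ?I) UNIV" by (rule has_integral_integral_lborel[OF int_f])
  then obtain B where B: "B > 0"
    "\<And>a b. ball 0 B \<subseteq> cbox a b \<Longrightarrow> norm (integral (cbox a b) (\<lambda>x. if x \<in> UNIV then f x else 0) - ?I) < \<bar>?I\<bar> / 2"
    using I unfolding has_integral_alt' by (meson half_gt_zero zero_less_abs_iff)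
  define h where "h t = \<bar>F t\<bar> + \<bar>F (- t)\<bar>" for t
  have int_h: "integrable lborel h"
    unfolding h_def using lborel_integrable_real_affine[OF int_F, of "-1" 0] int_F by auto
  have low: "\<bar>?I\<bar> / 2 \<le> h t" if "t \<ge> B" for t
  proof -
    have "ball 0 B \<subseteq> cbox (- t) t" using that by (auto simp: dist_real_def)
    then have "norm (integral {- t..t} f - ?I) < \<bar>?I\<bar> / 2" using B(2)[of "- t" t] by simp
    moreover have "integral {- t..t} f = F t - F (- t)" using ftc[of t] that B(1) by (simp add: integral_unique)
    ultimately have "\<bar>F t - F (- t) - ?I\<bar> < \<bar>?I\<bar> / 2" by simp
    then show ?thesis unfolding h_def by linarith
  qed
  define L where "L = integral UNIV (\<lambda>z. \<bar>h z\<bar>)"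
  have L: "L \<ge> 0" unfolding L_def by (rule integral_nonneg) (use integrable_on_lborel[OF integrable_abs[OF int_h]] in auto)
  \<comment> \<open>Between \<open>B\<close> and \<open>T\<close> the lower bound
    \<open>\<bar>?I\<bar> / 2\<close> alone accumulates \<open>L + 1\<close>.\<close>
  define T where "T = B + 2 * (L + 1) / \<bar>?I\<bar>"
  have T: "T \<ge> B" using L by (simp add: T_def)
  have "((\<lambda>_. \<bar>?I\<bar> / 2) has_integral (T - B) * (\<bar>?I\<bar> / 2)) {B..T}"
    using has_integral_const_real[of "\<bar>?I\<bar> / 2" B T] T by simp
  moreover have "((\<lambda>z. \<bar>h z\<bar>) has_integral integral {B..T} (\<lambda>z. \<bar>h z\<bar>)) {B..T}"
    using abs_integral_le_total(2)[OF int_h] by (rule integrable_integral)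
  ultimately have "(T - B) * (\<bar>?I\<bar> / 2) \<le> integral {B..T} (\<lambda>z. \<bar>h z\<bar>)"
  proof (rule has_integral_le)
    fix z assume "z \<in> {B..T}"
    then show "\<bar>?I\<bar> / 2 \<le> \<bar>h z\<bar>" using low[of z] abs_ge_self[of "h z"] by (simp add: order_trans)
  qed
  also have "\<dots> \<le> L" unfolding L_def by (rule abs_integral_le_total[OF int_h])
  finally show False using I by (simp add: T_def)
qed

section \<open>The matrix integral\<close>

context
  fixes a0 a1 a2 b0 b1 b2 :: real and E :: "real set" and \<rho> :: "real \<Rightarrow> real"
    and U :: "real set" and v :: "real \<Rightarrow> real"
  assumes interval: "is_interval E" and nonempty: "interior E \<noteq> {}"
    and nonzero: "a0 \<noteq> 0 \<or> a1 \<noteq> 0 \<or> a2 \<noteq> 0"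
    and weight: "\<And>z. z \<in> interior E \<Longrightarrow> quadratic a0 a1 a2 z \<noteq> 0 \<Longrightarrow>
           0 < \<rho> z \<and> \<rho> differentiable (at z) \<and>
           - deriv \<rho> z / \<rho> z = quadratic b0 b1 b2 z / quadratic a0 a1 a2 z"
    and boundary: "\<And>k::nat. vanishes_at_endpoints E (\<lambda>z. quadratic a0 a1 a2 z * \<rho> z * z ^ k)"
  defines "U \<equiv> {z \<in> interior E. quadratic a0 a1 a2 z \<noteq> 0}"
    and "v \<equiv> \<lambda>z. if z \<in> U then \<rho> z else 0"
begin

lemma finite_zeros: "finite {z. quadratic a0 a1 a2 z = 0}"
  unfolding quadratic_def using nonzero by (rule finite_zeros_quadratic)

lemma open_U: "open U"
proof -
  have "U = interior E - {z. quadratic a0 a1 a2 z = 0}" by (auto simp: U_def)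
  then show ?thesis using finite_imp_closed[OF finite_zeros] by (simp add: open_Diff)
qed

lemma finite_exceptional: "finite (frontier E \<union> {z. quadratic a0 a1 a2 z = 0})"
  using finite_zeros finite_frontier_is_interval[OF interval] by simp

text \<open>The hypotheses leave the values of \<open>\<rho>\<close> on this set arbitrary.
  Finiteness makes it negligible, so that \<open>v\<close> can stand for the weight in
  one-dimensional integrals.\<close>

lemma finite_E_minus_U: "finite (E - U)"
  by (rule finite_subset[OF _ finite_exceptional]) (use closure_subset in \<open>auto simp: U_def frontier_def\<close>)

lemma U_subset: "U \<subseteq> E"
  using interior_subset by (auto simp: U_def)

lemma rho_has_real_derivative:
  assumes "z \<in> U"
  shows "(\<rho> has_real_derivative - (quadratic b0 b1 b2 z / quadratic a0 a1 a2 z) * \<rho> z) (at z)"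
proof -
  have w: "0 < \<rho> z" "\<rho> differentiable (at z)" "- deriv \<rho> z / \<rho> z = quadratic b0 b1 b2 z / quadratic a0 a1 a2 z"
    using weight[of z] assms by (auto simp: U_def)
  have "- (quadratic b0 b1 b2 z / quadratic a0 a1 a2 z) * \<rho> z = deriv \<rho> z"
    unfolding w(3)[symmetric] using w(1) by simp
  then show ?thesis using w(2) by (simp add: DERIV_deriv_iff_real_differentiable)
qed

lemma v_measurable [measurable]: "v \<in> borel_measurable borel"
proof -
  have "continuous_on U \<rho>"
    using rho_has_real_derivative DERIV_isCont by (intro continuous_at_imp_continuous_on) blast
  then have "(\<lambda>z. indicator U z *\<^sub>R \<rho> z) \<in> borel_measurable borel"
    using open_U by (intro borel_measurable_continuous_on_indicator) auto
  moreover have "(\<lambda>z. indicator U z *\<^sub>R \<rho> z) = v" by (auto simp: v_def indicator_def)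
  ultimately show ?thesis by simp
qed

lemma v_nonneg: "v z \<ge> 0"
  using weight[of z] by (auto simp: v_def U_def)

lemma v_pos_interval: obtains p q where "p < q" "\<And>z. p < z \<Longrightarrow> z < q \<Longrightarrow> v z > 0"
proof -
  have "infinite (interior E)" using nonempty finite_imp_not_open open_interior by blast
  then have "\<not> interior E \<subseteq> {z. quadratic a0 a1 a2 z = 0}" using finite_zeros finite_subset by blast
  then obtain c where "c \<in> U" by (auto simp: U_def)
  then obtain e where e: "e > 0" "ball c e \<subseteq> U" using open_U open_contains_ball by blast
  have "v z > 0" if "c - e < z" "z < c + e" for z
  proof -
    have "z \<in> U" using e that by (auto simp: dist_real_def subset_eq)
    then show ?thesis using weight[of z] by (auto simp: v_def U_def)
  qed
  then show ?thesis using that[of "c - e" "c + e"] e(1) by auto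
qed

text \<open>The one-variable factor of the integrand of \<open>tau\<close>. The switch to
  \<open>v\<close> is made for this factor, in dimension one, rather than on the product
  space.\<close>

definition restricted_weight :: "real \<Rightarrow> real \<Rightarrow> real" where
  "restricted_weight x z = indicator E z * (exp (x * z) * \<rho> z)"

lemma restricted_weight_eq: "z \<notin> E - U \<Longrightarrow> z ^ k * restricted_weight x z = z ^ k * (exp (x * z) * v z)"
  using U_subset by (auto simp: restricted_weight_def v_def indicator_def)

lemma restricted_weight_eq': "z \<notin> E - U \<Longrightarrow> restricted_weight x z = exp (x * z) * v z"
  using restricted_weight_eq[of z 0 x] by simp

lemma indicator_integrand:
  assumes "z \<in> space (PiM {1..n} (\<lambda>_. lborel))"
  shows "indicator (PiE {1..n} (\<lambda>_. E)) z *\<^sub>R integrand n \<rho> x z =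
    (Vdm n z)\<^sup>2 * (\<Prod>k\<in>{1..n}. restricted_weight x (z k))"
proof -
  have "indicator (PiE {1..n} (\<lambda>_. E)) z = (\<Prod>k\<in>{1..n}. indicator E (z k) :: real)"
  proof (cases "\<forall>k\<in>{1..n}. z k \<in> E")
    case True
    then show ?thesis using assms by (simp add: space_PiM indicator_def PiE_def Pi_def)
  next
    case False
    then obtain k where "k \<in> {1..n}" "z k \<notin> E" by blast
    then have "(\<Prod>k\<in>{1..n}. indicator E (z k) :: real) = 0" "z \<notin> PiE {1..n} (\<lambda>_. E)"
      by (auto intro!: prod_zero bexI[of _ k] simp: PiE_def)
    then show ?thesis by simp
  qed
  then show ?thesis
    by (simp add: integrand_def restricted_weight_def prod.distrib mult_ac)
qed

lemma restricted_weight_measurable [measurable]: "restricted_weight x \<in> borel_measurable borel"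
proof (rule measurable_discrete_difference[where X = "E - U" and f = "\<lambda>z. exp (x * z) * v z"])
  show "countable (E - U)" using finite_E_minus_U by (rule countable_finite)
qed (auto simp: restricted_weight_eq')

lemma integrable_weight:
  assumes n: "n \<ge> 1"
    and int: "set_integrable (PiM {1..n} (\<lambda>_. lborel)) (PiE {1..n} (\<lambda>_. E)) (integrand n \<rho> x)"
  shows "integrable lborel (\<lambda>z. exp (x * z) * v z)"
proof -
  obtain p q where pq: "p < q" "\<And>z. p < z \<Longrightarrow> z < q \<Longrightarrow> v z > 0" by (rule v_pos_interval) blast
  have "integrable (PiM {1..n} (\<lambda>_. lborel)) (\<lambda>z. (Vdm n z)\<^sup>2 * (\<Prod>k\<in>{1..n}. restricted_weight x (z k)))"
    using int unfolding set_integrable_def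
    by (subst (asm) Bochner_Integration.integrable_cong[OF refl indicator_integrand]) auto
  moreover have "restricted_weight x z \<noteq> 0" if "p < z" "z < q" for z
  proof -
    have "v z > 0" using pq that by blast
    then have "z \<notin> E - U" by (auto simp: v_def split: if_splits)
    then show ?thesis using \<open>v z > 0\<close> by (simp add: restricted_weight_eq')
  qed
  ultimately have "integrable lborel (restricted_weight x)"
    by (intro integrable_weight_of_integrable[OF n restricted_weight_measurable pq(1)])
  moreover have "integrable lborel (restricted_weight x) \<longleftrightarrow> integrable lborel (\<lambda>z. exp (x * z) * v z)"
    by (rule integrable_discrete_difference[where X = "E - U"])
      (auto simp: restricted_weight_eq' countable_finite[OF finite_E_minus_U])
  ultimately show ?thesis by simp
qed

text \<open>This is what the interior in \<open>convergence_domain\<close> is for: the parameter can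
  be moved to both sides, as \<open>integrable_power_exp\<close> and
  \<open>moment_has_real_derivative\<close> require.\<close>

lemma integrable_weight_nearby:
  assumes n: "n \<ge> 1" and x: "x \<in> convergence_domain n E \<rho>"
  obtains e where "e > 0" "integrable lborel (\<lambda>z. exp ((x + e) * z) * v z)"
    "integrable lborel (\<lambda>z. exp ((x - e) * z) * v z)"
proof -
  have "open (convergence_domain n E \<rho>)" by (simp add: convergence_domain_def)
  then obtain e where e: "e > 0" "cball x e \<subseteq> convergence_domain n E \<rho>"
    using x open_contains_cball by blast
  have "integrable lborel (\<lambda>z. exp (y * z) * v z)" if "y \<in> convergence_domain n E \<rho>" for y
    using that interior_subset unfolding convergence_domain_def by (intro integrable_weight[OF n]) blast
  moreover have "x + e \<in> cball x e" "x - e \<in> cball x e" using e(1) by (auto simp: dist_real_def)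
  ultimately show ?thesis using that[of e] e by blast
qed

definition moment :: "nat \<Rightarrow> real \<Rightarrow> real" where
  "moment k x = (\<integral>z. z ^ k * (exp (x * z) * v z) \<partial>lborel)"

lemma integrable_moment:
  assumes n: "n \<ge> 1" and x: "x \<in> convergence_domain n E \<rho>"
  shows "integrable lborel (\<lambda>z. z ^ k * (exp (x * z) * v z))"
proof -
  obtain e where "e > 0" "integrable lborel (\<lambda>z. exp ((x + e) * z) * v z)"
    "integrable lborel (\<lambda>z. exp ((x - e) * z) * v z)"
    using integrable_weight_nearby[OF assms] .
  then show ?thesis by (intro integrable_power_exp[of v x x e]) auto
qed

lemma moment_derivative:
  assumes n: "n \<ge> 1" and x: "x \<in> convergence_domain n E \<rho>"
  shows "(moment k has_real_derivative moment (Suc k) x) (at x)"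
proof -
  obtain e where "e > 0" "integrable lborel (\<lambda>z. exp ((x + e) * z) * v z)"
    "integrable lborel (\<lambda>z. exp ((x - e) * z) * v z)"
    using integrable_weight_nearby[OF assms] .
  then show ?thesis unfolding moment_def[abs_def] by (intro moment_has_real_derivative[OF v_measurable])
qed

lemma tau_eq_hankel:
  assumes n: "n \<ge> 1" and x: "x \<in> convergence_domain n E \<rho>"
  shows "tau n E \<rho> x = fact n * fdet n (\<lambda>i j. moment (i + j) x)" "tau n E \<rho> x > 0"
proof -
  let ?M = "PiM {1..n} (\<lambda>_. lborel) :: (nat \<Rightarrow> real) measure"
  note ddiff = countable_finite[OF finite_E_minus_U]
  have int: "integrable lborel (\<lambda>z. z ^ k * restricted_weight x z)" for k
  proof -
    have "integrable lborel (\<lambda>z. z ^ k * restricted_weight x z) \<longleftrightarrow> integrable lborel (\<lambda>z. z ^ k * (exp (x * z) * v z))"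
      by (rule integrable_discrete_difference[where X = "E - U"]) (auto simp: restricted_weight_eq' ddiff)
    then show ?thesis using integrable_moment[OF assms] by simp
  qed
  have mom: "(\<integral>z. z ^ k * restricted_weight x z \<partial>lborel) = moment k x" for k
    unfolding moment_def
    by (rule integral_discrete_difference[where X = "E - U"]) (auto simp: restricted_weight_eq' ddiff)
  have "tau n E \<rho> x = (\<integral>z. (Vdm n z)\<^sup>2 * (\<Prod>k\<in>{1..n}. restricted_weight x (z k)) \<partial>?M)"
    unfolding tau_def set_lebesgue_integral_def
    by (rule Bochner_Integration.integral_cong[OF refl indicator_integrand])
  also have "\<dots> = fact n * fdet n (\<lambda>i j. moment (i + j) x)"
    unfolding andreief(2)[OF int] mom ..
  finally show 1: "tau n E \<rho> x = fact n * fdet n (\<lambda>i j. moment (i + j) x)" .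
  obtain p q where pq: "p < q" "\<And>z. p < z \<Longrightarrow> z < q \<Longrightarrow> v z > 0" by (rule v_pos_interval) blast
  have "0 < (\<integral>z. (Vdm n z)\<^sup>2 * (\<Prod>k\<in>{1..n}. exp (x * z k) * v (z k)) \<partial>?M)"
    by (rule integral_Vdm_squared_pos[OF n _ pq(1)])
      (use andreief(1)[OF integrable_moment[OF assms]] pq(2) v_nonneg in \<open>force+\<close>)
  also have "\<dots> = fact n * fdet n (\<lambda>i j. moment (i + j) x)"
    unfolding andreief(2)[OF integrable_moment[OF assms]] moment_def ..
  finally show "tau n E \<rho> x > 0" unfolding 1 .
qed

text \<open>The right side is the integral of the derivative of \<open>F\<close>, which is A z^k exp
  (x z) times the weight. The work lies in showing that \<open>F\<close>, which is 0 off
  \<open>U\<close>, is continuous on the whole line, so that neither the endpoints of E nor the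
  zeros of A inside E leave boundary terms.\<close>

lemma moment_recursion:
  assumes n: "n \<ge> 1" and x: "x \<in> convergence_domain n E \<rho>"
  shows "a0 * real k * moment (k - 1) x + (a1 * (real k + 1) + (a0 * x - b0)) * moment k x +
      (a2 * (real k + 2) + (a1 * x - b1)) * moment (k + 1) x + (a2 * x - b2) * moment (k + 2) x = 0"
proof -
  let ?A = "quadratic a0 a1 a2"
  define m where "m j z = z ^ j * (exp (x * z) * v z)" for j z
  have m: "integrable lborel (m j)" for j unfolding m_def by (rule integrable_moment[OF assms])
  define F where "F z = a0 * m k z + a1 * m (k + 1) z + a2 * m (k + 2) z" for z
  define f where "f z = a0 * real k * m (k - 1) z + (a1 * (real k + 1) + (a0 * x - b0)) * m k z +
      (a2 * (real k + 2) + (a1 * x - b1)) * m (k + 1) z + (a2 * x - b2) * m (k + 2) z" for z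
  have F_eq: "F z = ?A z * z ^ k * (exp (x * z) * v z)" for z
    by (simp add: F_def m_def quadratic_def algebra_simps power_add power2_eq_square)
  have int_F: "integrable lborel F" and int_f: "integrable lborel f"
    unfolding F_def f_def by (intro Bochner_Integration.integrable_add integrable_mult_right m)+
  have F_0: "F z = 0" if "z \<notin> U" for z using that by (simp add: F_eq v_def)
  have dF: "(F has_real_derivative f z) (at z)" if z: "z \<notin> frontier E \<union> {z. ?A z = 0}" for z
  proof (cases "z \<in> U")
    case True
    then have Az: "?A z \<noteq> 0" by (simp add: U_def)
    have "((\<lambda>z. ?A z * z ^ k * (exp (x * z) * \<rho> z)) has_real_derivative f z) (at z)"
    proof -
      have dA: "(?A has_real_derivative a1 + 2 * a2 * z) (at z)"
        unfolding quadratic_def[abs_def] by (auto intro!: derivative_eq_intros)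
      have "((\<lambda>z. ?A z * z ^ k * (exp (x * z) * \<rho> z)) has_real_derivative
          ((a1 + 2 * a2 * z) * z ^ k + ?A z * (real k * z ^ (k - 1))) * (exp (x * z) * \<rho> z) +
          ?A z * z ^ k * (x * exp (x * z) * \<rho> z + exp (x * z) * (- (quadratic b0 b1 b2 z / ?A z) * \<rho> z))) (at z)"
        by (rule derivative_eq_intros dA rho_has_real_derivative[OF True] refl | simp)+
          (simp add: mult_ac)
      moreover have "((a1 + 2 * a2 * z) * z ^ k + ?A z * (real k * z ^ (k - 1))) * (exp (x * z) * \<rho> z) +
          ?A z * z ^ k * (x * exp (x * z) * \<rho> z + exp (x * z) * (- (quadratic b0 b1 b2 z / ?A z) * \<rho> z)) = f z"
      proof -
        have "((a1 + 2 * a2 * z) * z ^ k + ?A z * (real k * z ^ (k - 1))) * (exp (x * z) * \<rho> z) +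
          ?A z * z ^ k * (x * exp (x * z) * \<rho> z + exp (x * z) * (- (quadratic b0 b1 b2 z / ?A z) * \<rho> z)) =
          ((a1 + 2 * a2 * z) * z ^ k + ?A z * (real k * z ^ (k - 1)) + (x * ?A z - quadratic b0 b1 b2 z) * z ^ k) * (exp (x * z) * \<rho> z)"
          using Az by (simp add: field_simps)
        also have "\<dots> = f z"
          using True unfolding f_def m_def v_def quadratic_def
          by (cases k) (simp_all add: algebra_simps power2_eq_square)
        finally show ?thesis .
      qed
      ultimately show ?thesis by simp
    qed
    then show ?thesis
      by (rule has_field_derivative_transform_within_open[OF _ open_U True]) (simp add: F_eq v_def)
  next
    case False
    then have "z \<notin> closure E" using z by (auto simp: U_def frontier_def)
    then have "z \<in> - closure E" "open (- closure E)" by auto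
    moreover have "f z = 0" using False by (simp add: f_def m_def v_def)
    moreover have "F y = 0" if "y \<in> - closure E" for y
      using that closure_subset U_subset by (intro F_0) blast
    ultimately show ?thesis
      using has_field_derivative_transform_within_open[of "\<lambda>_. 0" 0 z "- closure E" F] by simp
  qed
  \<comment> \<open>At a finite endpoint the boundary hypothesis controls \<open>F\<close> from
    inside E, and \<open>F\<close> is 0 elsewhere.\<close>
  have lim: "(F \<longlongrightarrow> 0) (at p)" if p: "p \<in> frontier E" for p
  proof -
    have "((\<lambda>z. ?A z * \<rho> z * z ^ k * exp (x * z)) \<longlongrightarrow> 0 * exp (x * p)) (at p within interior E)"
      using boundary[of k] p unfolding vanishes_at_endpoints_def by (intro tendsto_intros) auto
    then have "eventually (\<lambda>z. \<bar>?A z * \<rho> z * z ^ k * exp (x * z)\<bar> < e) (at p within interior E)" if "e > 0" for e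
      using that by (auto dest!: tendstoD simp: dist_real_def)
    then have *: "eventually (\<lambda>z. z \<noteq> p \<longrightarrow> z \<in> interior E \<longrightarrow> \<bar>?A z * \<rho> z * z ^ k * exp (x * z)\<bar> < e) (nhds p)" if "e > 0" for e
      using that by (simp add: eventually_at_filter)
    show ?thesis
    proof (rule tendstoI)
      fix e :: real assume e: "e > 0"
      have "eventually (\<lambda>z. z \<noteq> p \<longrightarrow> dist (F z) 0 < e) (nhds p)"
        using *[OF e]
      proof eventually_elim
        case (elim z)
        show ?case
        proof (cases "z \<in> U")
          case True
          then show ?thesis using elim by (auto simp: F_eq v_def U_def mult_ac)
        qed (use e in \<open>simp add: F_0\<close>)
      qed
      then show "eventually (\<lambda>z. dist (F z) 0 < e) (at p)" by (simp add: eventually_at_filter)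
    qed
  qed
  \<comment> \<open>The boundary hypothesis does not reach a zero of A inside E. There
    \<open>F\<close> is A times the integrable function \<open>m k\<close>, and A vanishes at least
    to first order.\<close>
  have lim': "(F \<longlongrightarrow> 0) (at p)" if p: "p \<in> interior E" "?A p = 0" for p
  proof -
    have "\<not> p islimpt {z. ?A z = 0}" using finite_zeros islimpt_finite by blast
    then have "eventually (\<lambda>z. z \<notin> {z. ?A z = 0}) (at p)" by (simp add: islimpt_iff_eventually)
    moreover have "eventually (\<lambda>z. z \<in> interior E) (at p)"
      using eventually_at_in_open'[OF open_interior p(1)] .
    ultimately have "eventually (\<lambda>z. z \<in> U) (at p)" by eventually_elim (simp add: U_def)
    then obtain d where d: "d > 0" "\<And>z. z \<noteq> p \<Longrightarrow> dist z p < d \<Longrightarrow> z \<in> U"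
      unfolding eventually_at by blast
    \<comment> \<open>A bound on \<open>\<bar>a1 + a2 * (z + p)\<bar>\<close>, the modulus of the
      difference quotient of A at p, for z within d of p; the added 1 makes it positive.\<close>
    define C where "C = \<bar>a1\<bar> + \<bar>a2\<bar> * (2 * \<bar>p\<bar> + d) + 1"
    show ?thesis
    proof (rule tendsto_0_at_of_integrable_quotient[OF d(1) _ _ int_f m[of k]])
      show "C > 0" using d(1) unfolding C_def by (intro add_nonneg_pos add_nonneg_nonneg) auto
      fix z assume z: "z \<noteq> p" "\<bar>z - p\<bar> < d"
      then have zU: "z \<in> U" using d(2) by (simp add: dist_real_def)
      then show "(F has_real_derivative f z) (at z)" by (intro dF) (auto simp: U_def frontier_def)
      have "?A z = (z - p) * (a1 + a2 * (z + p))"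
      proof -
        have "?A z - ?A p = (z - p) * (a1 + a2 * (z + p))"
          by (simp add: quadratic_def algebra_simps power2_eq_square)
        then show ?thesis using p(2) by simp
      qed
      then have "\<bar>?A z\<bar> = \<bar>z - p\<bar> * \<bar>a1 + a2 * (z + p)\<bar>" by (simp add: abs_mult)
      also have "\<bar>a1 + a2 * (z + p)\<bar> \<le> C"
      proof -
        have "\<bar>z + p\<bar> \<le> 2 * \<bar>p\<bar> + d" using z by linarith
        then have "\<bar>a2 * (z + p)\<bar> \<le> \<bar>a2\<bar> * (2 * \<bar>p\<bar> + d)" by (simp add: abs_mult mult_left_mono)
        then show ?thesis unfolding C_def by linarith
      qed
      finally have "\<bar>?A z\<bar> \<le> \<bar>z - p\<bar> * C" by (simp add: mult_left_mono)
      then have "\<bar>?A z\<bar> * \<bar>m k z\<bar> \<le> \<bar>z - p\<bar> * C * \<bar>m k z\<bar>" by (rule mult_right_mono) simp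
      then show "\<bar>F z\<bar> \<le> C * \<bar>z - p\<bar> * \<bar>m k z\<bar>"
        by (simp add: F_eq m_def abs_mult mult_ac)
    qed
  qed
  have "continuous_on UNIV F"
  proof (intro continuous_at_imp_continuous_on ballI)
    fix p
    show "isCont F p"
    proof (cases "p \<in> frontier E \<union> {z. ?A z = 0}")
      case False
      then show ?thesis using dF DERIV_isCont by blast
    next
      case True
      show ?thesis
      proof (cases "p \<in> frontier E \<or> p \<in> interior E")
        case True
        then have "(F \<longlongrightarrow> 0) (at p)" using lim[of p] lim'[of p] \<open>p \<in> frontier E \<union> _\<close> by (auto simp: frontier_def)
        moreover have "F p = 0" using \<open>p \<in> frontier E \<union> _\<close> by (intro F_0) (auto simp: U_def frontier_def)
        ultimately show ?thesis by (simp add: isCont_def)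
      next
        case False
        then have "p \<in> - closure E" "open (- closure E)" by (auto simp: frontier_def)
        moreover have "F y = 0" if "y \<in> - closure E" for y
          using that closure_subset U_subset by (intro F_0) blast
        ultimately have "(F has_real_derivative 0) (at p)"
          using has_field_derivative_transform_within_open[of "\<lambda>_. 0" 0 p "- closure E" F] by simp
        then show ?thesis by (rule DERIV_isCont)
      qed
    qed
  qed
  then have "(\<integral>z. f z \<partial>lborel) = 0"
    using integral_derivative_eq_0[OF finite_exceptional dF _ int_F int_f] by simp
  moreover have "(\<integral>z. f z \<partial>lborel) = a0 * real k * moment (k - 1) x + (a1 * (real k + 1) + (a0 * x - b0)) * moment k x +
      (a2 * (real k + 2) + (a1 * x - b1)) * moment (k + 1) x + (a2 * x - b2) * moment (k + 2) x"
  proof -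
    have mm: "moment j x = (\<integral>z. m j z \<partial>lborel)" for j by (simp add: moment_def m_def)
    show ?thesis unfolding f_def mm
      by (simp only: Bochner_Integration.integral_add Bochner_Integration.integrable_add integrable_mult_right m integral_mult_right_zero)
  qed
  ultimately show ?thesis by simp
qed

end

theorem proposition2p1:
  fixes n :: nat and a0 a1 a2 b0 b1 b2 :: real
    and E :: "real set" and \<rho> :: "real \<Rightarrow> real"
  assumes "n \<ge> 1"
    and "is_interval E" and "interior E \<noteq> {}"
    and "a0 \<noteq> 0 \<or> a1 \<noteq> 0 \<or> a2 \<noteq> 0"
    and "\<And>z. z \<in> interior E \<Longrightarrow> quadratic a0 a1 a2 z \<noteq> 0 \<Longrightarrow>
           0 < \<rho> z \<and> \<rho> differentiable (at z) \<and>
           - deriv \<rho> z / \<rho> z = quadratic b0 b1 b2 z / quadratic a0 a1 a2 z"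
    and "\<And>k::nat. vanishes_at_endpoints E (\<lambda>z. quadratic a0 a1 a2 z * \<rho> z * z ^ k)"
  shows "(\<forall>x\<in>convergence_domain n E \<rho>.
            0 < tau n E \<rho> x \<and> (\<lambda>x. ln (tau n E \<rho> x)) differentiable (at x)) \<and>
         solves_third_order_ode n a0 a1 a2 b0 b1 b2
           {x \<in> convergence_domain n E \<rho>. a2*x - b2 \<noteq> 0} (log_deriv_tau n E \<rho>) \<and>
         (a2 \<noteq> 0 \<longrightarrow> transforms_into_painleve_V n a0 a1 a2 b0 b1 b2)"
proof -
  note weight = assms(2-6)
  have D: "open (convergence_domain n E \<rho>)" by (simp add: convergence_domain_def)
  have K: "(fact n :: real) > 0" by simp
  note ode = hankel_log_derivative_ode[OF assms(1) D K moment_derivative[OF weight assms(1)]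
      moment_recursion[OF weight assms(1)] tau_eq_hankel[OF weight assms(1)]]
  show ?thesis
    using ode tau_eq_hankel(2)[OF weight assms(1)] third_order_transforms_into_painleve_V
    by (auto simp: log_deriv_tau_def)
qed

end
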